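(* Assume hypotheses H(A), H(B), H(F), H(G), H(0), H(W), H($\ell$) and H($\varphi$) spelled out in the context, and let $\mathcal P\subset\Lambda\times\Xi$ be a nonempty compact set. Assume in addition that the map $(w,\zeta,\eta)\mapsto m_{\zeta,\eta}(w)$ is sequentially lower semicontinuous on $\mathcal W_{ad}\times\mathcal P$, where $\mathcal W_{ad}$ is endowed with the weak topology of $L^2(I,Y)$ and $\mathcal P$ with the metric topology of $\Lambda\times\Xi$. For $\alpha\in[0,1]$ put $$\mathcal H_\alpha(w)=\alpha\inf_{(\zeta,\eta)\in\mathcal P}m_{\zeta,\eta}(w)+(1-\alpha)\sup_{(\zeta,\eta)\in\mathcal P}m_{\zeta,\eta}(w)+\mathcal R(w),\qquad w\in\mathcal W_{ad}.$$ Then for every $\alpha\in[0,1]$ there exists $w_\alpha^*\in\mathcal W_{ad}$ such that $\mathcal H_\alpha(w_\alpha^* )=\inf_{w\in\mathcal W_{ad}}\mathcal H_\alpha(w)$.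
   Context: **Setting.** $E,H,Y$ are real separable Hilbert spaces with norms $\|\cdot\|_E,\|\cdot\|,\|\cdot\|_Y$ ($\langle\cdot,\cdot\rangle$ is the inner product of $H$), $I=[0,b]$ with $b>0$, $(\Lambda,d_\Lambda)$ and $(\Xi,d_\Xi)$ are metric spaces, $\Lambda\times\Xi$ has the product metric. Spaces $C(I,\cdot)$ carry the sup norm. $\operatorname{Haus}$ is the Hausdorff metric between sets; for a set $S$ in a normed space $\|S\|:=\sup_{s\in S}\|s\|$. A multifunction $\Phi$ on $I$ is measurable if $\{t:\Phi(t)\subset O\}$ is Lebesgue measurable for every open $O$. A set $S\subset H$ is ball-relatively compact if its intersection with every closed ball centered at $0$ is relatively compact. For a maximal monotone $B:D(B)\subset H\rightrightarrows H$, $B^0(v)$ is the minimal-norm element of $B(v)$. The pseudo-distance of maximal monotone operators is $$\operatorname{dis}(B_1,B_2)=\sup\Big\{\tfrac{\langle y-y',x'-x\rangle}{1+\|y\|+\|y'\|}: x\in D(B_1),y\in B_1(x),x'\in D(B_2),y'\in B_2(x')\Big\}\in[0,\infty].$$ **Data.** Linear operators $A_\zeta:D(A_\zeta)\subset E\to E$ ($\zeta\in\Lambda$); maximal monotone operators $B(t,u,\eta):D(B(t,u,\eta))\subset H\rightrightarrows H$ ($(t,u,\eta)\in I\times H\times\Xi$); multifunctions $F:I\times E\times H\times\Lambda\rightrightarrows E$, $G:I\times E\times H\times\Xi\rightrightarrows H$, $W:I\rightrightarrows Y$; a bounded linear operator $\mathcal B:Y\to E$; maps $x_0:\Lambda\to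 E$, $u_0:\Xi\to H$ with $u_0(\eta)\in D(B(0,u_0(\eta),\eta))$; functions $\ell:I\times E\times H\times\Lambda\times\Xi\to\mathbb R$, $\varphi:E\times H\times\Lambda\times\Xi\to\mathbb R$. **H(A).** Each $A_\zeta$ generates a $C_0$-semigroup $\{T_\zeta(t)\}_{t\ge0}$ on $E$ with $T_\zeta(t)$ compact for all $t>0$; for every bounded $D\subset\Lambda$ there is $M_D>0$ with $\sup_{t\in I}\|T_\zeta(t)\|_{\mathcal L(E)}\le M_D$ for all $\zeta\in D$; whenever $\zeta_n\to\zeta$, $\sup_{t\in I}\|T_{\zeta_n}(t)x-T_\zeta(t)x\|_E\to0$ for every $x\in E$, and $\sup_{t\in[\delta,b]}\|T_{\zeta_n}(t)-T_\zeta(t)\|_{\mathcal L(E)}\to0$ for every $0<\delta<b$. **H(B).** (i) There are $\theta\in W^{1,2}(I,\mathbb R)$, $\lambda\in[0,1)$, $\lambda'>0$ with $\operatorname{dis}(B(t,u,\eta_1),B(s,v,\eta_2))\le|\theta(t)-\theta(s)|+\lambda\|u-v\|+\lambda' d_\Xi(\eta_1,\eta_2)$ for all $t,s\in I$, $u,v\in H$, $\eta_1,\eta_2\in\Xi$. (ii) There is $M_B>0$ with $\|B^0(t,u,\eta)v\|\le M_B(1+\|u\|+\|v\|)$ for all $t\in I$, $u\in H$, $\eta\in\Xi$, $v\in D(B(t,u,\eta))$. (iii) For every bounded $\Omega\subset H\times\Xi$, $\bigcup_{t\in I,(u,\eta)\in\Omega}D(B(t,u,\eta))$ is ball-relatively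 compact in $H$. (iv) For every bounded $D\subset\Xi$ and $r>0$ there is $\varrho_D\in L^1(I,\mathbb R_+)$ with $\langle v_1-v_2,u_1-u_2\rangle\ge-\varrho_D(t)\|u_1-u_2\|^2$ for all $t\in I$, $\|u_1\|,\|u_2\|\le r$, $\eta_1,\eta_2\in D$, $v_i\in B(t,u_i,\eta_i)(u_i)$. **H(F).** $F$ has nonempty weakly compact convex values and: (i) $t\mapsto F(t,x,u,\zeta)$ is measurable for all $(x,u,\zeta)$; (ii) for every bounded $D\subset\Lambda$ there is $k_D\in L^1(I,\mathbb R_+)$ with $\operatorname{Haus}(F(t,x,u,\zeta),F(t,y,v,\zeta))\le k_D(t)(\|x-y\|_E+\|u-v\|)$ for all $(x,u),(y,v)$, $\zeta\in D$, a.e. $t$; (iii) for every bounded $D\subset\Lambda$ there is $M_F>0$ with $\|F(t,x,u,\zeta)\|_E\le M_F(1+\|x\|_E+\|u\|)$ for a.e. $t$ and all $(x,u,\zeta)\in E\times H\times D$; (iv) $\operatorname{Haus}(F(t,x,u,\zeta_1),F(t,x,u,\zeta_2))\le\gamma_1(d_\Lambda(\zeta_1,\zeta_2))\rho_1(t,\|x\|_E,\|u\|)$ for all $(x,u)$, $\zeta_1,\zeta_2$, a.e. $t$, where $\gamma_1(r)\to0$ as $r\to0^+$ and for every bounded $S\subset L^2(I,E)\times L^2(I,H)$ there is $\omega_S\in L^1(I,\mathbb R_+)$ with $\rho_1(t,\|x(t)\|_E,\|u(t)\|)\le\omega_S(t)$ for a.e. $t$ and all $(x,u)\in S$. **H(G).**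 $G$ has nonempty weakly compact convex values and: (i) $t\mapsto G(t,x,u,\eta)$ is measurable; (ii) for every bounded $D\subset\Xi$ there is $l_D\in L^1(I,\mathbb R_+)$ with $\operatorname{Haus}(G(t,x,u,\eta),G(t,y,v,\eta))\le l_D(t)(\|x-y\|_E+\|u-v\|)$ for all $(x,u),(y,v)$, $\eta\in D$, a.e. $t$; (iii) for every bounded $D\subset\Xi$ there is $M_G>0$ with $\|G(t,x,u,\eta)\|\le M_G(1+\|x\|_E+\|u\|)$ for a.e. $t$ and all $(x,u,\eta)\in E\times H\times D$; (iv) $\operatorname{Haus}(G(t,x,u,\eta_1),G(t,x,u,\eta_2))\le\gamma_2(d_\Xi(\eta_1,\eta_2))\rho_2(t,\|x\|_E,\|u\|)$ for all $(x,u)$, $\eta_1,\eta_2$, a.e. $t$, where $\gamma_2(r)\to0$ as $r\to0^+$ and for every bounded $Q\subset C(I,E)\times C(I,H)$ there is $\omega_Q\in L^1(I,\mathbb R_+)$ with $\rho_2(t,\|x(t)\|_E,\|u(t)\|)\le\omega_Q(t)$ for a.e. $t$ and all $(x,u)\in Q$. **H(0).** $x_0$ and $u_0$ are continuous, and for every bounded $D\subset\Lambda\times\Xi$ there is $\varpi_D>0$ with $\max\{\|x_0(\zeta)\|_E,\|u_0(\eta)\|\}\le\varpi_D$ for all $(\zeta,\eta)\in D$. **H(W).** $W$ is measurable with nonempty closed convex values, and there is $\phi_W\in L^2(I,\mathbb R_+)$ with $\sup_{v\in W(t)}\|v\|_Y\le\phi_W(t)$ for a.e. $t$. **H($\ell$).**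 (i) $t\mapsto\ell(t,x,u,\zeta,\eta)$ is measurable for all $(x,u,\zeta,\eta)$. (ii) For a.e. $t$, all $x,y\in E$ and all $(u,\zeta,\eta)$, $|\ell(t,x,u,\zeta,\eta)-\ell(t,y,u,\zeta,\eta)|\le(1+\max\{\|x\|_E,\|y\|_E\})\,\kappa(t,\|x-y\|_E)$, where $\kappa:I\times\mathbb R_+\to\mathbb R_+$ is Carath\'eodory, $\kappa(t,0)=0$ for a.e. $t$, and for each $R>0$ there is $\beta_R\in L^1(I,\mathbb R_+)$ with $\sup_{0\le r\le R}\kappa(t,r)\le\beta_R(t)$ for a.e. $t$. (iii) For a.e. $t$ and all $(x,\zeta,\eta)$, $u\mapsto\ell(t,x,u,\zeta,\eta)$ is convex. (iv) For every bounded $D\subset\Lambda\times\Xi$ there is $\vartheta_D\in L^1(I,\mathbb R_+)$ with $|\ell(t,0,u,\zeta,\eta)|\le\vartheta_D(t)(1+\|u\|)$ for a.e. $t$, all $u\in H$, $(\zeta,\eta)\in D$. (v) For a.e. $t$, $(x,u,\zeta,\eta)\mapsto\ell(t,x,u,\zeta,\eta)$ is continuous. **H($\varphi$).** $\varphi$ is continuous. **Controls and controlled solution sets.** $\mathcal W_{ad}=\{w\in L^2(I,Y):w(t)\in W(t)\text{ for a.e. }t\in I\}$. For $w\in\mathcal W_{ad}$ and $(\zeta,\eta)\in\Lambda\times\Xi$, $\mathcal S_{\zeta,\eta}(w)$ is the set of mild solutions of $\dot x\in A_\zeta x+F(t,x,u,\zeta)+\mathcal Bw(t)$, $\dot u\in-B(t,u,\eta)(u)+G(t,x,u,\eta)$,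 $x(0)=x_0(\zeta)$, $u(0)=u_0(\eta)$, i.e. pairs $(x,u)\in C(I,E)\times W^{1,2}(I,H)$ with $u(0)=u_0(\eta)$ for which there are integrable $f:I\to E$, $g:I\to H$ such that, for a.e. $t\in I$, $f(t)\in F(t,x(t),u(t),\zeta)$, $g(t)\in G(t,x(t),u(t),\eta)$, $-\dot u(t)+g(t)\in B(t,u(t),\eta)(u(t))$ (in particular $u(t)\in D(B(t,u(t),\eta))$), and for all $t\in I$, $x(t)=T_\zeta(t)x_0(\zeta)+\int_0^tT_\zeta(t-s)(f(s)+\mathcal Bw(s))\,ds$. **Costs.** $\mathcal J_{\zeta,\eta}(x,u)=\int_0^b\ell(t,x(t),u(t),\zeta,\eta)\,dt+\varphi(x(b),u(b),\zeta,\eta)$; $m_{\zeta,\eta}(w)=\inf_{(x,u)\in\mathcal S_{\zeta,\eta}(w)}\mathcal J_{\zeta,\eta}(x,u)$; $\mathcal R(w)=\frac12\int_0^b\|w(t)\|_Y^2\,dt$. *)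

theory Defs
  imports "HOL-Analysis.Analysis"
begin

text \<open>Elements of Lebesgue spaces are represented by functions on the whole line; only their
  values on \<open>{0..b}\<close>, up to null sets, matter.\<close>

definition L1_nonneg :: "real \<Rightarrow> (real \<Rightarrow> real) set" where
  "L1_nonneg b = {k. integrable (lebesgue_on {0..b}) k \<and> (\<forall>t\<in>{0..b}. 0 \<le> k t)}"

definition L2 :: "real \<Rightarrow> (real \<Rightarrow> 'a::{banach,second_countable_topology}) set" where
  "L2 b = {f. f \<in> borel_measurable (lebesgue_on {0..b}) \<and>
              integrable (lebesgue_on {0..b}) (\<lambda>t. (norm (f t))\<^sup>2)}"

definition L2_norm :: "real \<Rightarrow> (real \<Rightarrow> 'a::{banach,second_countable_topology}) \<Rightarrow> real" where
  "L2_norm b f = sqrt (LINT t|lebesgue_on {0..b}. (norm (f t))\<^sup>2)"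

definition L2_dual :: "real \<Rightarrow> ((real \<Rightarrow> 'a::{banach,second_countable_topology}) \<Rightarrow> real) set" where
  "L2_dual b = {\<Phi>. (\<forall>f\<in>L2 b. \<forall>g\<in>L2 b. \<Phi> (\<lambda>t. f t + g t) = \<Phi> f + \<Phi> g) \<and>
                   (\<forall>c. \<forall>f\<in>L2 b. \<Phi> (\<lambda>t. c *\<^sub>R f t) = c * \<Phi> f) \<and>
                   (\<exists>C. \<forall>f\<in>L2 b. \<bar>\<Phi> f\<bar> \<le> C * L2_norm b f)}"

definition L2_weakly_converges ::
  "real \<Rightarrow> (nat \<Rightarrow> real \<Rightarrow> 'a::{banach,second_countable_topology}) \<Rightarrow> (real \<Rightarrow> 'a) \<Rightarrow> bool" where
  "L2_weakly_converges b w w' \<longleftrightarrow> (\<forall>\<Phi>\<in>L2_dual b. (\<lambda>n. \<Phi> (w n)) \<longlonglongrightarrow> \<Phi> w')"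

text \<open>The Sobolev space \<open>W\<^sup>1\<^sup>,\<^sup>2\<close> is described through absolutely continuous representatives: functions
  that are differentiable almost everywhere, with square integrable derivative \<open>v\<close>, and that are
  the (Bochner) indefinite integral of this derivative.\<close>

definition has_W12_derivative ::
  "real \<Rightarrow> (real \<Rightarrow> 'a::{banach,second_countable_topology}) \<Rightarrow> (real \<Rightarrow> 'a) \<Rightarrow> bool" where
  "has_W12_derivative b u v \<longleftrightarrow>
     v \<in> L2 b \<and>
     (AE t in lebesgue_on {0..b}. (u has_vector_derivative v t) (at t within {0..b})) \<and>
     (\<forall>t\<in>{0..b}. u t = u 0 + (LINT s|lebesgue_on {0..t}. v s))"

definition W12 :: "real \<Rightarrow> (real \<Rightarrow> 'a::{banach,second_countable_topology}) set" where
  "W12 b = {u. \<exists>v. has_W12_derivative b u v}"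

definition weak_topology :: "'a::real_normed_vector topology" where
  "weak_topology = topology_generated_by {f -` U | (f :: 'a \<Rightarrow> real) U. bounded_linear f \<and> open U}"

text \<open>Only used for nonempty sets, for which \<^const>\<open>infdist\<close> is the genuine distance.\<close>

definition Haus :: "'a::metric_space set \<Rightarrow> 'a set \<Rightarrow> ereal" where
  "Haus S S' = max (SUP s\<in>S. ereal (infdist s S')) (SUP s\<in>S'. ereal (infdist s S))"

definition set_norm :: "'a::real_normed_vector set \<Rightarrow> ereal" where
  "set_norm S = (SUP s\<in>S. ereal (norm s))"

definition measurable_multi :: "real \<Rightarrow> (real \<Rightarrow> 'a::topological_space set) \<Rightarrow> bool" where
  "measurable_multi b \<Phi> \<longleftrightarrow> (\<forall>U. open U \<longrightarrow> {t\<in>{0..b}. \<Phi> t \<subseteq> U} \<in> sets (lebesgue_on {0..b}))"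

definition ball_relatively_compact :: "'a::real_normed_vector set \<Rightarrow> bool" where
  "ball_relatively_compact S \<longleftrightarrow> (\<forall>r. compact (closure (S \<inter> cball 0 r)))"

text \<open>A set-valued operator is a function into sets; its domain consists of the points with
  nonempty value.\<close>

definition op_dom :: "('h \<Rightarrow> 'h set) \<Rightarrow> 'h set" where
  "op_dom B = {v. B v \<noteq> {}}"

definition monotone_operator :: "('h::real_inner \<Rightarrow> 'h set) \<Rightarrow> bool" where
  "monotone_operator B \<longleftrightarrow> (\<forall>x x'. \<forall>y\<in>B x. \<forall>y'\<in>B x'. 0 \<le> (y - y') \<bullet> (x - x'))"

definition maximal_monotone :: "('h::real_inner \<Rightarrow> 'h set) \<Rightarrow> bool" where
  "maximal_monotone B \<longleftrightarrow> monotone_operator B \<and>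
     (\<forall>C. monotone_operator C \<and> (\<forall>x. B x \<subseteq> C x) \<longrightarrow> C = B)"

definition min_section :: "('h::real_inner \<Rightarrow> 'h set) \<Rightarrow> 'h \<Rightarrow> 'h" where
  "min_section B v = arg_min_on norm (B v)"

definition op_dis :: "('h::real_inner \<Rightarrow> 'h set) \<Rightarrow> ('h \<Rightarrow> 'h set) \<Rightarrow> ereal" where
  "op_dis B1 B2 =
     (SUP (x, y, x', y') \<in> {(x, y, x', y'). x \<in> op_dom B1 \<and> y \<in> B1 x \<and> x' \<in> op_dom B2 \<and> y' \<in> B2 x'}.
        ereal (((y - y') \<bullet> (x' - x)) / (1 + norm y + norm y')))"

definition C0_semigroup :: "(real \<Rightarrow> 'e::real_normed_vector \<Rightarrow>\<^sub>L 'e) \<Rightarrow> bool" where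
  "C0_semigroup T \<longleftrightarrow> T 0 = id_blinfun \<and>
     (\<forall>s\<ge>0. \<forall>t\<ge>0. T (s + t) = T s o\<^sub>L T t) \<and>
     (\<forall>x. ((\<lambda>t. T t x) \<longlongrightarrow> x) (at_right 0))"

definition linear_operator :: "'e::real_vector set \<Rightarrow> ('e \<Rightarrow> 'e) \<Rightarrow> bool" where
  "linear_operator D A \<longleftrightarrow> subspace D \<and>
     (\<forall>x\<in>D. \<forall>y\<in>D. A (x + y) = A x + A y) \<and> (\<forall>c. \<forall>x\<in>D. A (c *\<^sub>R x) = c *\<^sub>R A x)"

definition generates ::
  "'e::real_normed_vector set \<Rightarrow> ('e \<Rightarrow> 'e) \<Rightarrow> (real \<Rightarrow> 'e \<Rightarrow>\<^sub>L 'e) \<Rightarrow> bool" where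
  "generates D A T \<longleftrightarrow> C0_semigroup T \<and>
     D = {x. \<exists>y. ((\<lambda>h. (1 / h) *\<^sub>R (T h x - x)) \<longlongrightarrow> y) (at_right 0)} \<and>
     (\<forall>x\<in>D. ((\<lambda>h. (1 / h) *\<^sub>R (T h x - x)) \<longlongrightarrow> A x) (at_right 0))"

definition compact_operator :: "('e::real_normed_vector \<Rightarrow>\<^sub>L 'e) \<Rightarrow> bool" where
  "compact_operator L \<longleftrightarrow> (\<forall>S. bounded S \<longrightarrow> compact (closure (blinfun_apply L ` S)))"

definition hyp_A ::
  "real \<Rightarrow> ('l::metric_space \<Rightarrow> 'e::real_normed_vector set) \<Rightarrow> ('l \<Rightarrow> 'e \<Rightarrow> 'e) \<Rightarrow>
   ('l \<Rightarrow> real \<Rightarrow> 'e \<Rightarrow>\<^sub>L 'e) \<Rightarrow> bool" where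
  "hyp_A b DA A T \<longleftrightarrow>
     (\<forall>\<zeta>. generates (DA \<zeta>) (A \<zeta>) (T \<zeta>) \<and> (\<forall>t>0. compact_operator (T \<zeta> t))) \<and>
     (\<forall>D. bounded D \<longrightarrow> (\<exists>M>0. \<forall>\<zeta>\<in>D. \<forall>t\<in>{0..b}. norm (T \<zeta> t) \<le> M)) \<and>
     (\<forall>z \<zeta>. z \<longlonglongrightarrow> \<zeta> \<longrightarrow>
        (\<forall>x. (\<lambda>n. SUP t\<in>{0..b}. norm (T (z n) t x - T \<zeta> t x)) \<longlonglongrightarrow> 0) \<and>
        (\<forall>\<delta>. 0 < \<delta> \<and> \<delta> < b \<longrightarrow> (\<lambda>n. SUP t\<in>{\<delta>..b}. norm (T (z n) t - T \<zeta> t)) \<longlonglongrightarrow> 0))"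

definition hyp_B ::
  "real \<Rightarrow> (real \<Rightarrow> 'h::{real_inner,banach,second_countable_topology} \<Rightarrow> 'k::metric_space \<Rightarrow>
     'h \<Rightarrow> 'h set) \<Rightarrow> bool" where
  "hyp_B b B \<longleftrightarrow>
     (\<exists>\<theta>\<in>W12 b. \<exists>L L'. 0 \<le> L \<and> L < 1 \<and> 0 < L' \<and>
        (\<forall>t\<in>{0..b}. \<forall>s\<in>{0..b}. \<forall>u v \<eta>1 \<eta>2.
           op_dis (B t u \<eta>1) (B s v \<eta>2) \<le>
             ereal (\<bar>\<theta> t - \<theta> s\<bar> + L * norm (u - v) + L' * dist \<eta>1 \<eta>2))) \<and>
     (\<exists>M>0. \<forall>t\<in>{0..b}. \<forall>u \<eta>. \<forall>v\<in>op_dom (B t u \<eta>).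
        norm (min_section (B t u \<eta>) v) \<le> M * (1 + norm u + norm v)) \<and>
     (\<forall>\<Omega>. bounded \<Omega> \<longrightarrow>
        ball_relatively_compact (\<Union>t\<in>{0..b}. \<Union>(u, \<eta>)\<in>\<Omega>. op_dom (B t u \<eta>))) \<and>
     (\<forall>D r. bounded D \<and> 0 < r \<longrightarrow> (\<exists>\<rho>\<in>L1_nonneg b.
        \<forall>t\<in>{0..b}. \<forall>u1 u2. \<forall>\<eta>1\<in>D. \<forall>\<eta>2\<in>D. norm u1 \<le> r \<longrightarrow> norm u2 \<le> r \<longrightarrow>
          (\<forall>v1\<in>B t u1 \<eta>1 u1. \<forall>v2\<in>B t u2 \<eta>2 u2.
             (v1 - v2) \<bullet> (u1 - u2) \<ge> - \<rho> t * (norm (u1 - u2))\<^sup>2)))"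

definition hyp_F ::
  "real \<Rightarrow> (real \<Rightarrow> 'e::{real_inner,banach,second_countable_topology} \<Rightarrow>
     'h::{real_inner,banach,second_countable_topology} \<Rightarrow> 'l::metric_space \<Rightarrow> 'e set) \<Rightarrow> bool" where
  "hyp_F b F \<longleftrightarrow>
     (\<forall>t\<in>{0..b}. \<forall>x u \<zeta>. F t x u \<zeta> \<noteq> {} \<and> compactin weak_topology (F t x u \<zeta>) \<and> convex (F t x u \<zeta>)) \<and>
     (\<forall>x u \<zeta>. measurable_multi b (\<lambda>t. F t x u \<zeta>)) \<and>
     (\<forall>D. bounded D \<longrightarrow> (\<exists>k\<in>L1_nonneg b. \<forall>x u y v. \<forall>\<zeta>\<in>D. AE t in lebesgue_on {0..b}.
        Haus (F t x u \<zeta>) (F t y v \<zeta>) \<le> ereal (k t * (norm (x - y) + norm (u - v))))) \<and>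
     (\<forall>D. bounded D \<longrightarrow> (\<exists>M>0. AE t in lebesgue_on {0..b}. \<forall>x u. \<forall>\<zeta>\<in>D.
        set_norm (F t x u \<zeta>) \<le> ereal (M * (1 + norm x + norm u)))) \<and>
     (\<exists>(\<gamma> :: real \<Rightarrow> real) (\<rho> :: real \<Rightarrow> real \<Rightarrow> real \<Rightarrow> real).
        (\<gamma> \<longlongrightarrow> 0) (at_right 0) \<and>
        (\<forall>S. S \<subseteq> L2 b \<times> L2 b \<and> (\<exists>C. \<forall>(x, u)\<in>S. L2_norm b x \<le> C \<and> L2_norm b u \<le> C) \<longrightarrow>
           (\<exists>\<omega>\<in>L1_nonneg b. \<forall>(x :: real \<Rightarrow> 'e, u :: real \<Rightarrow> 'h)\<in>S. AE t in lebesgue_on {0..b}.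
              \<rho> t (norm (x t)) (norm (u t)) \<le> \<omega> t)) \<and>
        (\<forall>x u \<zeta>1 \<zeta>2. AE t in lebesgue_on {0..b}.
           Haus (F t x u \<zeta>1) (F t x u \<zeta>2) \<le> ereal (\<gamma> (dist \<zeta>1 \<zeta>2) * \<rho> t (norm x) (norm u))))"

definition hyp_G ::
  "real \<Rightarrow> (real \<Rightarrow> 'e::{real_inner,banach,second_countable_topology} \<Rightarrow>
     'h::{real_inner,banach,second_countable_topology} \<Rightarrow> 'k::metric_space \<Rightarrow> 'h set) \<Rightarrow> bool" where
  "hyp_G b G \<longleftrightarrow>
     (\<forall>t\<in>{0..b}. \<forall>x u \<eta>. G t x u \<eta> \<noteq> {} \<and> compactin weak_topology (G t x u \<eta>) \<and> convex (G t x u \<eta>)) \<and>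
     (\<forall>x u \<eta>. measurable_multi b (\<lambda>t. G t x u \<eta>)) \<and>
     (\<forall>D. bounded D \<longrightarrow> (\<exists>l\<in>L1_nonneg b. \<forall>x u y v. \<forall>\<eta>\<in>D. AE t in lebesgue_on {0..b}.
        Haus (G t x u \<eta>) (G t y v \<eta>) \<le> ereal (l t * (norm (x - y) + norm (u - v))))) \<and>
     (\<forall>D. bounded D \<longrightarrow> (\<exists>M>0. AE t in lebesgue_on {0..b}. \<forall>x u. \<forall>\<eta>\<in>D.
        set_norm (G t x u \<eta>) \<le> ereal (M * (1 + norm x + norm u)))) \<and>
     (\<exists>(\<gamma> :: real \<Rightarrow> real) (\<rho> :: real \<Rightarrow> real \<Rightarrow> real \<Rightarrow> real).
        (\<gamma> \<longlongrightarrow> 0) (at_right 0) \<and>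
        (\<forall>Q. (\<forall>(x, u)\<in>Q. continuous_on {0..b} x \<and> continuous_on {0..b} u) \<and>
             (\<exists>C. \<forall>(x, u)\<in>Q. \<forall>t\<in>{0..b}. norm (x t) \<le> C \<and> norm (u t) \<le> C) \<longrightarrow>
           (\<exists>\<omega>\<in>L1_nonneg b. AE t in lebesgue_on {0..b}. \<forall>(x :: real \<Rightarrow> 'e, u :: real \<Rightarrow> 'h)\<in>Q.
              \<rho> t (norm (x t)) (norm (u t)) \<le> \<omega> t)) \<and>
        (\<forall>x u \<eta>1 \<eta>2. AE t in lebesgue_on {0..b}.
           Haus (G t x u \<eta>1) (G t x u \<eta>2) \<le> ereal (\<gamma> (dist \<eta>1 \<eta>2) * \<rho> t (norm x) (norm u))))"

definition hyp_0 ::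
  "('l::metric_space \<Rightarrow> 'e::real_normed_vector) \<Rightarrow> ('k::metric_space \<Rightarrow> 'h::real_normed_vector) \<Rightarrow> bool" where
  "hyp_0 x0 u0 \<longleftrightarrow> continuous_on UNIV x0 \<and> continuous_on UNIV u0 \<and>
     (\<forall>D. bounded D \<longrightarrow> (\<exists>C>0. \<forall>(\<zeta>, \<eta>)\<in>D. max (norm (x0 \<zeta>)) (norm (u0 \<eta>)) \<le> C))"

definition hyp_W :: "real \<Rightarrow> (real \<Rightarrow> 'y::{real_inner,banach,second_countable_topology} set) \<Rightarrow> bool" where
  "hyp_W b W \<longleftrightarrow> measurable_multi b W \<and>
     (\<forall>t\<in>{0..b}. W t \<noteq> {} \<and> closed (W t) \<and> convex (W t)) \<and>
     (\<exists>\<phi>\<in>L2 b. (\<forall>t\<in>{0..b}. 0 \<le> \<phi> t) \<and>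
        (AE t in lebesgue_on {0..b}. set_norm (W t) \<le> ereal (\<phi> t)))"

definition Caratheodory :: "real \<Rightarrow> (real \<Rightarrow> real \<Rightarrow> real) \<Rightarrow> bool" where
  "Caratheodory b \<kappa> \<longleftrightarrow> (\<forall>r\<ge>0. (\<lambda>t. \<kappa> t r) \<in> borel_measurable (lebesgue_on {0..b})) \<and>
     (AE t in lebesgue_on {0..b}. continuous_on {0..} (\<kappa> t))"

definition hyp_ell ::
  "real \<Rightarrow> (real \<Rightarrow> 'e::real_normed_vector \<Rightarrow> 'h::real_normed_vector \<Rightarrow> 'l::metric_space \<Rightarrow>
     'k::metric_space \<Rightarrow> real) \<Rightarrow> bool" where
  "hyp_ell b ell \<longleftrightarrow>
     (\<forall>x u \<zeta> \<eta>. (\<lambda>t. ell t x u \<zeta> \<eta>) \<in> borel_measurable (lebesgue_on {0..b})) \<and>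
     (\<exists>\<kappa> :: real \<Rightarrow> real \<Rightarrow> real.
        (\<forall>t\<in>{0..b}. \<forall>r\<ge>0. 0 \<le> \<kappa> t r) \<and> Caratheodory b \<kappa> \<and>
        (AE t in lebesgue_on {0..b}. \<kappa> t 0 = 0) \<and>
        (\<forall>R>0. \<exists>\<beta>\<in>L1_nonneg b. AE t in lebesgue_on {0..b}. \<forall>r\<in>{0..R}. \<kappa> t r \<le> \<beta> t) \<and>
        (AE t in lebesgue_on {0..b}. \<forall>x y u \<zeta> \<eta>.
           \<bar>ell t x u \<zeta> \<eta> - ell t y u \<zeta> \<eta>\<bar> \<le> (1 + max (norm x) (norm y)) * \<kappa> t (norm (x - y)))) \<and>
     (AE t in lebesgue_on {0..b}. \<forall>x \<zeta> \<eta>. convex_on UNIV (\<lambda>u. ell t x u \<zeta> \<eta>)) \<and>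
     (\<forall>D. bounded D \<longrightarrow> (\<exists>\<theta>\<in>L1_nonneg b. AE t in lebesgue_on {0..b}. \<forall>u. \<forall>(\<zeta>, \<eta>)\<in>D.
        \<bar>ell t 0 u \<zeta> \<eta>\<bar> \<le> \<theta> t * (1 + norm u))) \<and>
     (AE t in lebesgue_on {0..b}. continuous_on UNIV (\<lambda>(x, u, \<zeta>, \<eta>). ell t x u \<zeta> \<eta>))"

definition hyp_phi ::
  "('e::real_normed_vector \<Rightarrow> 'h::real_normed_vector \<Rightarrow> 'l::metric_space \<Rightarrow> 'k::metric_space \<Rightarrow> real) \<Rightarrow> bool" where
  "hyp_phi \<phi> \<longleftrightarrow> continuous_on UNIV (\<lambda>(x, u, \<zeta>, \<eta>). \<phi> x u \<zeta> \<eta>)"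

definition W_ad ::
  "real \<Rightarrow> (real \<Rightarrow> 'y::{real_inner,banach,second_countable_topology} set) \<Rightarrow> (real \<Rightarrow> 'y) set" where
  "W_ad b W = {w \<in> L2 b. AE t in lebesgue_on {0..b}. w t \<in> W t}"

definition mild_solutions ::
  "real \<Rightarrow> ('l \<Rightarrow> real \<Rightarrow> 'e \<Rightarrow>\<^sub>L 'e) \<Rightarrow> (real \<Rightarrow> 'h \<Rightarrow> 'k \<Rightarrow> 'h \<Rightarrow> 'h set) \<Rightarrow>
   (real \<Rightarrow> 'e \<Rightarrow> 'h \<Rightarrow> 'l \<Rightarrow> 'e set) \<Rightarrow> (real \<Rightarrow> 'e \<Rightarrow> 'h \<Rightarrow> 'k \<Rightarrow> 'h set) \<Rightarrow>
   ('y \<Rightarrow>\<^sub>L 'e) \<Rightarrow> ('l \<Rightarrow> 'e) \<Rightarrow> ('k \<Rightarrow> 'h) \<Rightarrow> 'l::metric_space \<Rightarrow> 'k::metric_space \<Rightarrow>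
   (real \<Rightarrow> 'y::{real_inner,banach,second_countable_topology}) \<Rightarrow>
   ((real \<Rightarrow> 'e::{real_inner,banach,second_countable_topology}) \<times>
    (real \<Rightarrow> 'h::{real_inner,banach,second_countable_topology})) set" where
  "mild_solutions b T B F G BB x0 u0 \<zeta> \<eta> w =
     {(x, u). continuous_on {0..b} x \<and> u 0 = u0 \<eta> \<and>
        (\<exists>u' f g. has_W12_derivative b u u' \<and>
           integrable (lebesgue_on {0..b}) f \<and> integrable (lebesgue_on {0..b}) g \<and>
           (AE t in lebesgue_on {0..b}.
              f t \<in> F t (x t) (u t) \<zeta> \<and> g t \<in> G t (x t) (u t) \<eta> \<and>
              - u' t + g t \<in> B t (u t) \<eta> (u t)) \<and>
           (\<forall>t\<in>{0..b}. x t = T \<zeta> t (x0 \<zeta>) +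
              (LINT s|lebesgue_on {0..t}. T \<zeta> (t - s) (f s + BB (w s)))))}"

definition cost ::
  "real \<Rightarrow> (real \<Rightarrow> 'e \<Rightarrow> 'h \<Rightarrow> 'l \<Rightarrow> 'k \<Rightarrow> real) \<Rightarrow> ('e \<Rightarrow> 'h \<Rightarrow> 'l \<Rightarrow> 'k \<Rightarrow> real) \<Rightarrow>
   'l \<Rightarrow> 'k \<Rightarrow> (real \<Rightarrow> 'e) \<Rightarrow> (real \<Rightarrow> 'h) \<Rightarrow> real" where
  "cost b ell \<phi> \<zeta> \<eta> x u =
     (LINT t|lebesgue_on {0..b}. ell t (x t) (u t) \<zeta> \<eta>) + \<phi> (x b) (u b) \<zeta> \<eta>"

text \<open>Values are extended reals, so that the infimum over an empty or unbounded family needs no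
  separate convention.\<close>

definition min_cost ::
  "real \<Rightarrow> ('l \<Rightarrow> real \<Rightarrow> 'e \<Rightarrow>\<^sub>L 'e) \<Rightarrow> (real \<Rightarrow> 'h \<Rightarrow> 'k \<Rightarrow> 'h \<Rightarrow> 'h set) \<Rightarrow>
   (real \<Rightarrow> 'e \<Rightarrow> 'h \<Rightarrow> 'l \<Rightarrow> 'e set) \<Rightarrow> (real \<Rightarrow> 'e \<Rightarrow> 'h \<Rightarrow> 'k \<Rightarrow> 'h set) \<Rightarrow>
   ('y \<Rightarrow>\<^sub>L 'e) \<Rightarrow> ('l \<Rightarrow> 'e) \<Rightarrow> ('k \<Rightarrow> 'h) \<Rightarrow>
   (real \<Rightarrow> 'e::{real_inner,banach,second_countable_topology} \<Rightarrow>
     'h::{real_inner,banach,second_countable_topology} \<Rightarrow> 'l \<Rightarrow> 'k \<Rightarrow> real) \<Rightarrow>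
   ('e \<Rightarrow> 'h \<Rightarrow> 'l \<Rightarrow> 'k \<Rightarrow> real) \<Rightarrow> 'l::metric_space \<Rightarrow> 'k::metric_space \<Rightarrow>
   (real \<Rightarrow> 'y::{real_inner,banach,second_countable_topology}) \<Rightarrow> ereal" where
  "min_cost b T B F G BB x0 u0 ell \<phi> \<zeta> \<eta> w =
     (INF (x, u) \<in> mild_solutions b T B F G BB x0 u0 \<zeta> \<eta> w. ereal (cost b ell \<phi> \<zeta> \<eta> x u))"

definition control_cost :: "real \<Rightarrow> (real \<Rightarrow> 'y::real_normed_vector) \<Rightarrow> real" where
  "control_cost b w = 1 / 2 * (LINT t|lebesgue_on {0..b}. (norm (w t))\<^sup>2)"

definition Hurwicz_cost ::
  "real \<Rightarrow> ('l \<Rightarrow> 'k \<Rightarrow> (real \<Rightarrow> 'y::real_normed_vector) \<Rightarrow> ereal) \<Rightarrow> ('l \<times> 'k) set \<Rightarrow> real \<Rightarrow>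
   (real \<Rightarrow> 'y) \<Rightarrow> ereal" where
  "Hurwicz_cost b m P \<alpha> w =
     ereal \<alpha> * (INF (\<zeta>, \<eta>)\<in>P. m \<zeta> \<eta> w) + ereal (1 - \<alpha>) * (SUP (\<zeta>, \<eta>)\<in>P. m \<zeta> \<eta> w)
       + ereal (control_cost b w)"

end

theory Submission
  imports Defs "HOL-Complex_Analysis.Great_Picard"
begin

text \<open>The set of admissible controls is nonempty (the element of minimal norm of \<open>W t\<close> depends
  measurably on \<open>t\<close>) and weakly sequentially compact, so it suffices that the Hurwicz cost is weakly
  sequentially lower semicontinuous. Infimum and supremum over the compact set \<open>P\<close> inherit lower
  semicontinuity from \<open>m\<close>; the point is that their weighted sum must not involve \<open>\<infinity> - \<infinity>\<close>, i.e. that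
  \<open>m\<close> never takes the value \<open>-\<infinity>\<close>. This follows from an a priori bound on all mild solutions together
  with relative compactness of the terminal states, on which the merely continuous terminal cost is
  bounded.\<close>

section \<open>Minimal norm selections\<close>

text \<open>The weak limit is constructed without a representation theorem for
  \<open>L2_dual\<close>. A cluster point is a norm limit of almost norm-minimal midpoint
  combinations of tails, and all that is known about it is that every functional converging along
  the sequence takes its limit value there; a diagonal extraction turns this into weak convergence.
  The value \<infinity> of \<open>m\<close> is legitimate (no mild solution), which is why
  -\<infinity> has to be excluded. The obstacle is that a continuous terminal cost need not be
  bounded on bounded sets in infinite dimensions. Compactness has two sources: for
  \<open>x b\<close> the semigroup, compact at positive times, and for \<open>u b\<close> the
  ball-relatively compact domains of the operators. Both presuppose a bound on the states, and the
  bound on \<open>u\<close> is the delicate one: linear growth is given only for the minimal section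
  of the operators, while the inclusion may select any element of the value, so the derivative of
  \<open>u\<close> must be estimated first.\<close>

lemma minimizing_sequence_Cauchy:
  fixes x :: "nat \<Rightarrow> 'a::real_inner"
  assumes "convex S" and x: "\<And>n. x n \<in> S" and lim: "(\<lambda>n. norm (x n)) \<longlonglongrightarrow> infdist 0 S"
  shows "Cauchy x"
proof (rule metric_CauchyI)
  fix e :: real assume "0 < e"
  define d where "d = infdist 0 S"
  have "(\<lambda>n. (norm (x n))\<^sup>2) \<longlonglongrightarrow> d\<^sup>2" using lim unfolding d_def by (rule tendsto_power)
  moreover have "d\<^sup>2 < d\<^sup>2 + e\<^sup>2 / 4" using \<open>0 < e\<close> by simp
  ultimately have "eventually (\<lambda>n. (norm (x n))\<^sup>2 < d\<^sup>2 + e\<^sup>2 / 4) sequentially"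
    by (rule order_tendstoD)
  then obtain N where N: "\<And>n. n \<ge> N \<Longrightarrow> (norm (x n))\<^sup>2 < d\<^sup>2 + e\<^sup>2 / 4"
    by (auto simp: eventually_sequentially)
  have "dist (x m) (x n) < e" if "m \<ge> N" "n \<ge> N" for m n
  proof -
    \<comment> \<open>Parallelogram law: the midpoint stays in the convex set, so its norm is at
      least \<open>d\<close>, and two squared norms below \<open>d\<^sup>2 + e\<^sup>2 / 4\<close>
      leave less than \<open>e\<^sup>2\<close> for the squared distance.\<close>
    have "(1/2) *\<^sub>R x m + (1/2) *\<^sub>R x n \<in> S"
      using \<open>convex S\<close> x by (intro convexD) auto
    then have "d \<le> norm ((1/2) *\<^sub>R x m + (1/2) *\<^sub>R x n)"
      unfolding d_def using infdist_le[of _ S 0] by simp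
    then have "d\<^sup>2 \<le> (norm ((1/2) *\<^sub>R x m + (1/2) *\<^sub>R x n))\<^sup>2"
      by (intro power_mono) (auto simp: d_def infdist_nonneg)
    also have "\<dots> = (norm (x m))\<^sup>2 / 2 + (norm (x n))\<^sup>2 / 2 - (norm (x m - x n))\<^sup>2 / 4"
      unfolding power2_norm_eq_inner
      by (simp add: inner_add inner_diff_left inner_diff_right inner_commute field_simps)
    finally have "(norm (x m - x n))\<^sup>2 < e\<^sup>2" using N[OF that(1)] N[OF that(2)] by simp
    then show ?thesis using \<open>0 < e\<close> by (simp add: dist_norm power2_less_imp_less)
  qed
  then show "\<exists>M. \<forall>m\<ge>M. \<forall>n\<ge>M. dist (x m) (x n) < e" by blast
qed

lemma infdist_approx:
  assumes "S \<noteq> {}" "0 < e"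
  obtains z where "z \<in> S" "dist x z < infdist x S + e"
proof -
  have "infdist x S < infdist x S + e" using assms by simp
  then obtain z where "z \<in> S" "dist x z < infdist x S + e"
    unfolding infdist_notempty[OF assms(1)] using assms(1) by (subst (asm) cINF_less_iff) auto
  then show ?thesis using that by blast
qed

lemma ex_min_norm:
  fixes S :: "'a::{real_inner,banach} set"
  assumes "S \<noteq> {}" "closed S" "convex S"
  shows "\<exists>z\<in>S. \<forall>y\<in>S. norm z \<le> norm y"
proof -
  have "\<exists>z. z \<in> S \<and> norm z < infdist 0 S + inverse (real (Suc n))" for n
    using infdist_approx[OF assms(1), of "inverse (real (Suc n))" 0] by (auto simp: dist_norm)
  then obtain z where z: "\<And>n. z n \<in> S" "\<And>n. norm (z n) < infdist 0 S + inverse (real (Suc n))"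
    by metis
  have "(\<lambda>n. norm (z n)) \<longlonglongrightarrow> infdist 0 S"
  proof (rule tendsto_sandwich)
    show "eventually (\<lambda>n. infdist 0 S \<le> norm (z n)) sequentially"
      using infdist_le[of _ S 0] z(1) by (auto simp: dist_norm)
    show "eventually (\<lambda>n. norm (z n) \<le> infdist 0 S + inverse (real (Suc n))) sequentially"
      using z(2) by (intro always_eventually allI less_imp_le)
    show "(\<lambda>n. infdist 0 S + inverse (real (Suc n))) \<longlonglongrightarrow> infdist 0 S"
      using tendsto_add[OF tendsto_const LIMSEQ_inverse_real_of_nat] by force
  qed simp
  note lim = this
  then have "Cauchy z" using assms z by (intro minimizing_sequence_Cauchy)
  then obtain p where p: "z \<longlonglongrightarrow> p" using Cauchy_convergent convergent_def by blast
  have "p \<in> S" using assms(2) z(1) p by (rule closed_sequentially)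
  moreover have "norm p = infdist 0 S"
    using tendsto_norm[OF p] lim LIMSEQ_unique by blast
  ultimately show ?thesis using infdist_le[of _ S 0] by (metis dist_0_norm)
qed

text \<open>Inclusion in an open set is the negation of meeting its closed complement, which settles
  closed sets; an open set of a metric space is a countable union of closed ones.\<close>

lemma measurable_multi_meets_open:
  fixes W :: "real \<Rightarrow> 'a::metric_space set"
  assumes W: "measurable_multi b W" and "open U"
  shows "{t\<in>{0..b}. W t \<inter> U \<noteq> {}} \<in> sets (lebesgue_on {0..b})"
proof -
  have closed: "{t\<in>{0..b}. W t \<inter> C \<noteq> {}} \<in> sets (lebesgue_on {0..b})" if "closed C" for C
  proof -
    have "{t\<in>{0..b}. W t \<subseteq> - C} \<in> sets (lebesgue_on {0..b})"
      using W that unfolding measurable_multi_def by (auto simp: open_Compl)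
    then have "space (lebesgue_on {0..b}) - {t\<in>{0..b}. W t \<subseteq> - C} \<in> sets (lebesgue_on {0..b})"
      by (rule sets.compl_sets)
    also have "space (lebesgue_on {0..b}) - {t\<in>{0..b}. W t \<subseteq> - C} = {t\<in>{0..b}. W t \<inter> C \<noteq> {}}"
      by auto
    finally show ?thesis .
  qed
  show ?thesis
  \<comment> \<open>For \<open>U = UNIV\<close> the distance to \<open>- U\<close> would be a
    distance to the empty set, which is 0 by convention.\<close>
  proof (cases "U = UNIV")
    case True
    then show ?thesis using closed[of UNIV] by simp
  next
    case False
    define C where "C n = {x. inverse (real (Suc n)) \<le> infdist x (- U)}" for n
    have "closed (C n)" for n
      unfolding C_def by (intro closed_Collect_le continuous_intros)
    have "U = (\<Union>n. C n)"
    proof (intro set_eqI iffI)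
      fix x assume "x \<in> U"
      then have "infdist x (- U) > 0"
        using False \<open>open U\<close> in_closed_iff_infdist_zero[of "- U" x] infdist_nonneg[of x "- U"]
        by (auto simp: closed_def less_le)
      then obtain n where "inverse (real (Suc n)) < infdist x (- U)"
        using reals_Archimedean by blast
      then show "x \<in> (\<Union>n. C n)" by (auto simp: C_def intro!: exI[of _ n])
    next
      fix x assume "x \<in> (\<Union>n. C n)"
      then obtain n where n: "inverse (real (Suc n)) \<le> infdist x (- U)" by (auto simp: C_def)
      have "0 < inverse (real (Suc n))" by simp
      with n have "0 < infdist x (- U)" by linarith
      then show "x \<in> U" by (metis ComplI infdist_zero less_irrefl)
    qed
    then have "{t\<in>{0..b}. W t \<inter> U \<noteq> {}} = (\<Union>n. {t\<in>{0..b}. W t \<inter> C n \<noteq> {}})" by auto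
    also have "\<dots> \<in> sets (lebesgue_on {0..b})"
      using closed[OF \<open>closed (C _)\<close>] by (intro sets.countable_UN) auto
    finally show ?thesis .
  qed
qed

text \<open>The element of minimal norm is a measurable selection: it is the pointwise limit of
  functions with values in a countable dense set.\<close>

lemma measurable_convex_selection:
  fixes W :: "real \<Rightarrow> 'a::{real_inner,banach,second_countable_topology} set"
  assumes W: "measurable_multi b W"
    and val: "\<And>t. t \<in> {0..b} \<Longrightarrow> W t \<noteq> {} \<and> closed (W t) \<and> convex (W t)"
  obtains p where "p \<in> borel_measurable (lebesgue_on {0..b})" "\<And>t. t \<in> {0..b} \<Longrightarrow> p t \<in> W t"
proof -
  let ?M = "lebesgue_on {0..b}"
  obtain D :: "'a set" where D: "countable D" "\<And>X. open X \<Longrightarrow> X \<noteq> {} \<Longrightarrow> \<exists>d\<in>D. d \<in> X"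
    by (erule countable_dense_setE)
  define e where "e = from_nat_into D"
  have dense: "\<exists>i. dist x (e i) < r" if "0 < r" for x r
  proof -
    have "x \<in> ball x r" using that by simp
    then have "ball x r \<noteq> {}" by blast
    from D(2)[OF open_ball this] obtain d where d: "d \<in> D" "d \<in> ball x r" by blast
    obtain i where "d = e i"
      using from_nat_into_surj[OF D(1) d(1)] unfolding e_def by blast
    with d(2) show ?thesis by auto
  qed
  define d where "d t = infdist 0 (W t)" for t
  have hit: "{t\<in>space ?M. W t \<inter> U \<noteq> {}} \<in> sets ?M" if "open U" for U
    using measurable_multi_meets_open[OF W that] by simp
  have d_meas: "d \<in> borel_measurable ?M"
  proof (subst borel_measurable_iff_less, rule allI)
    fix r
    have "d t < r \<longleftrightarrow> W t \<inter> ball 0 r \<noteq> {}" if "t \<in> {0..b}" for t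
    proof
      assume "d t < r"
      then obtain z where "z \<in> W t" "dist 0 z < infdist 0 (W t) + (r - d t)"
        using infdist_approx[of "W t" "r - d t" 0] val[OF \<open>t \<in> {0..b}\<close>] by auto
      then show "W t \<inter> ball 0 r \<noteq> {}" by (auto simp: d_def)
    next
      assume "W t \<inter> ball 0 r \<noteq> {}"
      then obtain z where "z \<in> W t" "norm z < r" by auto
      then show "d t < r" using infdist_le[of z "W t" 0] by (simp add: d_def)
    qed
    then have "{t\<in>space ?M. d t < r} = {t\<in>space ?M. W t \<inter> ball 0 r \<noteq> {}}" by auto
    then show "{t\<in>space ?M. d t < r} \<in> sets ?M" using hit[of "ball 0 r"] by simp
  qed
  define r where "r n = inverse (real (Suc n))" for n
  have r_pos: "0 < r n" for n by (simp add: r_def)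
  have r_lim: "r \<longlonglongrightarrow> 0" unfolding r_def by (rule LIMSEQ_inverse_real_of_nat)
  \<comment> \<open>\<open>e i\<close> is \<open>r n\<close>-close to an element of
    \<open>W t\<close> whose norm exceeds the infimum by less than \<open>r n\<close>. The least
    such index is a measurable function of \<open>t\<close>.\<close>
  define Q where "Q n i t \<longleftrightarrow> (\<exists>z\<in>W t. dist z (e i) < r n \<and> norm z < d t + r n)" for n i t
  have Q_meas: "Measurable.pred ?M (Q n i)" for n i
  proof -
    \<comment> \<open>A rational strictly between the norm and \<open>d t + r n\<close> decouples
      the two: what remains is a countable union of conditions on \<open>d\<close> alone and on
      \<open>W t\<close> meeting a fixed open set.\<close>
    have "Q n i t \<longleftrightarrow> (\<exists>q\<in>\<rat>. q < d t + r n \<and> W t \<inter> (ball (e i) (r n) \<inter> ball 0 q) \<noteq> {})" for t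
    proof
      assume "Q n i t"
      then obtain z where z: "z \<in> W t" "dist z (e i) < r n" "norm z < d t + r n"
        by (auto simp: Q_def)
      obtain q where "q \<in> \<rat>" "norm z < q" "q < d t + r n"
        using z(3) Rats_dense_in_real by blast
      then show "\<exists>q\<in>\<rat>. q < d t + r n \<and> W t \<inter> (ball (e i) (r n) \<inter> ball 0 q) \<noteq> {}"
        using z by (intro bexI[of _ q]) (auto simp: dist_commute)
    qed (force simp: Q_def dist_commute)
    then have "{t\<in>space ?M. Q n i t} = (\<Union>q\<in>\<rat>. {t\<in>space ?M. q < d t + r n} \<inter>
        {t\<in>space ?M. W t \<inter> (ball (e i) (r n) \<inter> ball 0 q) \<noteq> {}})"
      by blast
    also have "\<dots> \<in> sets ?M"
    proof (rule sets.countable_UN''[OF countable_rat])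
      have "{t\<in>space ?M. q < d t + r n} \<in> sets ?M" for q
        using d_meas by measurable
      then show "{t\<in>space ?M. q < d t + r n} \<inter>
          {t\<in>space ?M. W t \<inter> (ball (e i) (r n) \<inter> ball 0 q) \<noteq> {}} \<in> sets ?M" for q
        by (rule sets.Int[OF _ hit[OF open_Int[OF open_ball open_ball]]])
    qed
    finally show ?thesis by (simp only: pred_def)
  qed
  define pn where "pn n t = e (LEAST i. Q n i t)" for n t
  have pn_meas: "pn n \<in> borel_measurable ?M" for n
  proof -
    have "(\<lambda>t. LEAST i. Q n i t) \<in> measurable ?M (count_space UNIV)"
      using Q_meas by (rule measurable_Least)
    then show ?thesis unfolding pn_def by (rule measurable_compose) simp
  qed
  have lim: "\<exists>p\<in>W t. (\<lambda>n. pn n t) \<longlonglongrightarrow> p" if t: "t \<in> {0..b}" for t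
  proof -
    have "\<exists>i. Q n i t" for n
    proof -
      obtain z where "z \<in> W t" "dist 0 z < d t + r n"
        using infdist_approx[of "W t" "r n" 0] val[OF t] r_pos unfolding d_def by blast
      then show ?thesis using dense[OF r_pos, of z n] unfolding Q_def by auto
    qed
    then have "Q n (LEAST i. Q n i t) t" for n by (metis LeastI)
    then have "\<exists>z\<in>W t. dist z (pn n t) < r n \<and> norm z < d t + r n" for n
      by (simp add: Q_def pn_def)
    then obtain z where z: "\<And>n. z n \<in> W t" "\<And>n. dist (z n) (pn n t) < r n" "\<And>n. norm (z n) < d t + r n"
      by metis
    have "(\<lambda>n. norm (z n)) \<longlonglongrightarrow> d t"
    proof (rule tendsto_sandwich)
      show "eventually (\<lambda>n. d t \<le> norm (z n)) sequentially"
        using infdist_le[of _ "W t" 0] z(1) by (auto simp: dist_norm d_def)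
      show "eventually (\<lambda>n. norm (z n) \<le> d t + r n) sequentially"
        using z(3) by (intro always_eventually allI less_imp_le)
      show "(\<lambda>n. d t + r n) \<longlonglongrightarrow> d t"
        using tendsto_add[OF tendsto_const r_lim] by force
    qed simp
    then have "Cauchy z" using val[OF t] z(1) unfolding d_def by (intro minimizing_sequence_Cauchy) auto
    then obtain p where p: "z \<longlonglongrightarrow> p" using Cauchy_convergent convergent_def by blast
    have "p \<in> W t" using val[OF t] z(1) p closed_sequentially by blast
    moreover have "(\<lambda>n. dist (z n) (pn n t)) \<longlonglongrightarrow> 0"
      by (rule tendsto_sandwich[OF _ _ tendsto_const r_lim]) (use z(2) less_imp_le in \<open>auto intro!: always_eventually\<close>)
    then have "(\<lambda>n. z n - pn n t) \<longlonglongrightarrow> 0"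
      by (simp add: dist_norm tendsto_norm_zero_iff)
    from tendsto_diff[OF p this] have "(\<lambda>n. pn n t) \<longlonglongrightarrow> p" by simp
    ultimately show ?thesis by blast
  qed
  have "\<forall>t. \<exists>p. t \<in> {0..b} \<longrightarrow> p \<in> W t \<and> (\<lambda>n. pn n t) \<longlonglongrightarrow> p" using lim by blast
  then obtain p where p: "\<forall>t. t \<in> {0..b} \<longrightarrow> p t \<in> W t \<and> (\<lambda>n. pn n t) \<longlonglongrightarrow> p t"
    by (rule choice[THEN exE])
  have "p \<in> borel_measurable ?M"
  proof (rule borel_measurable_LIMSEQ_metric[OF pn_meas])
    show "(\<lambda>n. pn n t) \<longlonglongrightarrow> p t" if "t \<in> space ?M" for t
      using p that by (simp only: space_lebesgue_on)
  qed
  then show ?thesis using p by (intro that[of p]) simp_all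
qed

section \<open>Square integrable functions\<close>

lemma L2_if_norm_le:
  fixes f :: "real \<Rightarrow> 'a::{banach,second_countable_topology}" and \<phi> :: "real \<Rightarrow> real"
  assumes "f \<in> borel_measurable (lebesgue_on {0..b})" "\<phi> \<in> L2 b"
    "AE t in lebesgue_on {0..b}. norm (f t) \<le> \<phi> t"
  shows "f \<in> L2 b"
proof -
  have "integrable (lebesgue_on {0..b}) (\<lambda>t. (norm (f t))\<^sup>2)"
  proof (rule Bochner_Integration.integrable_bound)
    show "integrable (lebesgue_on {0..b}) (\<lambda>t. (norm (\<phi> t))\<^sup>2)" using assms(2) by (simp add: L2_def)
    show "AE t in lebesgue_on {0..b}. norm ((norm (f t))\<^sup>2) \<le> norm ((norm (\<phi> t))\<^sup>2)"
      using assms(3)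
    proof eventually_elim
      case (elim t)
      then show ?case using power_mono[OF elim norm_ge_zero, of 2] by simp
    qed
  qed (use assms(1) in measurable)
  then show ?thesis using assms(1) by (simp add: L2_def)
qed

lemma hyp_W_bound:
  assumes "hyp_W b W"
  obtains \<phi> :: "real \<Rightarrow> real" where "\<phi> \<in> L2 b" "AE t in lebesgue_on {0..b}. \<forall>v\<in>W t. norm v \<le> \<phi> t"
proof -
  obtain \<phi> :: "real \<Rightarrow> real" where \<phi>: "\<phi> \<in> L2 b"
    "AE t in lebesgue_on {0..b}. set_norm (W t) \<le> ereal (\<phi> t)"
    using assms unfolding hyp_W_def by blast
  from \<phi>(2) have "AE t in lebesgue_on {0..b}. \<forall>v\<in>W t. norm v \<le> \<phi> t"
    by eventually_elim (auto simp: set_norm_def SUP_le_iff)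
  then show ?thesis using that \<phi>(1) by blast
qed

lemma W_ad_nonempty:
  assumes W: "hyp_W b W"
  shows "W_ad b W \<noteq> {}"
proof -
  obtain p where p: "p \<in> borel_measurable (lebesgue_on {0..b})" "\<And>t. t \<in> {0..b} \<Longrightarrow> p t \<in> W t"
    using W unfolding hyp_W_def by (auto intro: measurable_convex_selection[of b W])
  obtain \<phi> :: "real \<Rightarrow> real" where \<phi>: "\<phi> \<in> L2 b" "AE t in lebesgue_on {0..b}. \<forall>v\<in>W t. norm v \<le> \<phi> t"
    using hyp_W_bound[OF W] .
  have pW: "AE t in lebesgue_on {0..b}. p t \<in> W t" using p(2) by (intro AE_I2) simp
  with \<phi>(2) have "AE t in lebesgue_on {0..b}. norm (p t) \<le> \<phi> t" by eventually_elim auto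
  then have "p \<in> L2 b" by (rule L2_if_norm_le[OF p(1) \<phi>(1)])
  with pW show ?thesis by (auto simp: W_ad_def)
qed

lemma L2_measurable: "f \<in> L2 b \<Longrightarrow> f \<in> borel_measurable (lebesgue_on {0..b})"
  by (simp add: L2_def)

lemma L2_integrable_square: "f \<in> L2 b \<Longrightarrow> integrable (lebesgue_on {0..b}) (\<lambda>t. (norm (f t))\<^sup>2)"
  by (simp add: L2_def)

lemma L2_norm_square: "(L2_norm b f)\<^sup>2 = (LINT t|lebesgue_on {0..b}. (norm (f t))\<^sup>2)"
  unfolding L2_norm_def by (simp add: integral_nonneg_AE)

lemma L2_scaleR:
  assumes "f \<in> L2 b"
  shows "(\<lambda>t. c *\<^sub>R f t) \<in> L2 b"
  using assms unfolding L2_def by (auto simp: power_mult_distrib)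

lemma L2_add:
  assumes f: "f \<in> L2 b" and g: "g \<in> L2 b"
  shows "(\<lambda>t. f t + g t) \<in> L2 b"
proof -
  have [measurable]: "f \<in> borel_measurable (lebesgue_on {0..b})" "g \<in> borel_measurable (lebesgue_on {0..b})"
    using f g by (auto simp: L2_def)
  have "integrable (lebesgue_on {0..b}) (\<lambda>t. (norm (f t + g t))\<^sup>2)"
  proof (rule Bochner_Integration.integrable_bound)
    show "integrable (lebesgue_on {0..b}) (\<lambda>t. 2 * (norm (f t))\<^sup>2 + 2 * (norm (g t))\<^sup>2)"
      using f g by (simp add: L2_def)
    have "(norm (f t + g t))\<^sup>2 \<le> 2 * (norm (f t))\<^sup>2 + 2 * (norm (g t))\<^sup>2" for t
    proof -
      have "(norm (f t + g t))\<^sup>2 \<le> (norm (f t) + norm (g t))\<^sup>2"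
        by (intro power_mono norm_triangle_ineq norm_ge_zero)
      also have "\<dots> \<le> 2 * (norm (f t))\<^sup>2 + 2 * (norm (g t))\<^sup>2"
        using sum_squares_bound[of "norm (f t)" "norm (g t)"] by (simp add: power2_sum)
      finally show ?thesis .
    qed
    then show "AE t in lebesgue_on {0..b}. norm ((norm (f t + g t))\<^sup>2)
        \<le> norm (2 * (norm (f t))\<^sup>2 + 2 * (norm (g t))\<^sup>2)"
      by simp
  qed measurable
  then show ?thesis by (simp add: L2_def)
qed

lemma L2_diff:
  assumes "f \<in> L2 b" "g \<in> L2 b"
  shows "(\<lambda>t. f t - g t) \<in> L2 b"
  using L2_add[OF assms(1) L2_scaleR[OF assms(2), of "-1"]] by simp

lemma L2_imp_integrable:
  assumes "f \<in> L2 b"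
  shows "integrable (lebesgue_on {0..b}) f"
proof (rule Bochner_Integration.integrable_bound)
  show "integrable (lebesgue_on {0..b}) (\<lambda>t. 1 + (norm (f t))\<^sup>2)"
    using assms by (intro Bochner_Integration.integrable_add) (auto simp: L2_def)
  have "norm x \<le> 1 + (norm x)\<^sup>2" for x :: 'a
    using sum_squares_bound[of 1 "norm x"] norm_ge_zero[of x] unfolding power_one mult_1_right by linarith
  then show "AE t in lebesgue_on {0..b}. norm (f t) \<le> norm (1 + (norm (f t))\<^sup>2)"
    by (simp add: add_nonneg_nonneg)
qed (use assms in \<open>simp add: L2_def\<close>)

text \<open>Polarization: the inner product is a linear combination of three integrable
  squares.\<close>

lemma L2_inner_integrable:
  fixes f g :: "real \<Rightarrow> 'a::{real_inner,banach,second_countable_topology}"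
  assumes f: "f \<in> L2 b" and g: "g \<in> L2 b"
  shows "integrable (lebesgue_on {0..b}) (\<lambda>t. f t \<bullet> g t)"
proof -
  have "f t \<bullet> g t = ((norm (f t + g t))\<^sup>2 - (norm (f t))\<^sup>2 - (norm (g t))\<^sup>2) / 2" for t
    unfolding power2_norm_eq_inner by (simp add: inner_add inner_commute field_simps)
  then have eq: "(\<lambda>t. f t \<bullet> g t) = (\<lambda>t. ((norm (f t + g t))\<^sup>2 - (norm (f t))\<^sup>2 - (norm (g t))\<^sup>2) / 2)"
    by blast
  show ?thesis
    unfolding eq using L2_integrable_square[OF L2_add[OF f g]] L2_integrable_square[OF f]
      L2_integrable_square[OF g] by (intro Bochner_Integration.integrable_diff integrable_divide)
qed

lemma integral_square_linear_combination:
  fixes f g :: "real \<Rightarrow> 'a::{real_inner,banach,second_countable_topology}"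
  assumes f: "f \<in> L2 b" and g: "g \<in> L2 b"
  shows "(LINT t|lebesgue_on {0..b}. (norm (r *\<^sub>R f t + s *\<^sub>R g t))\<^sup>2) =
    r\<^sup>2 * (L2_norm b f)\<^sup>2 + 2 * r * s * (LINT t|lebesgue_on {0..b}. f t \<bullet> g t) + s\<^sup>2 * (L2_norm b g)\<^sup>2"
proof -
  have "(norm (r *\<^sub>R f t + s *\<^sub>R g t))\<^sup>2 =
      r\<^sup>2 * (norm (f t))\<^sup>2 + 2 * r * s * (f t \<bullet> g t) + s\<^sup>2 * (norm (g t))\<^sup>2" for t
    unfolding power2_norm_eq_inner
    by (simp add: inner_add inner_commute power2_eq_square algebra_simps)
  then show ?thesis
    using L2_inner_integrable[OF f g] f g by (simp add: L2_norm_square L2_def)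
qed

lemma L2_Cauchy_Schwarz:
  fixes f g :: "real \<Rightarrow> 'a::{real_inner,banach,second_countable_topology}"
  assumes f: "f \<in> L2 b" and g: "g \<in> L2 b"
  shows "\<bar>LINT t|lebesgue_on {0..b}. f t \<bullet> g t\<bar> \<le> L2_norm b f * L2_norm b g"
proof -
  define F G I where "F = (L2_norm b f)\<^sup>2" "G = (L2_norm b g)\<^sup>2" "I = (LINT t|lebesgue_on {0..b}. f t \<bullet> g t)"
  have q: "0 \<le> r\<^sup>2 * F + 2 * r * s * I + s\<^sup>2 * G" for r s
    unfolding F_G_I_def integral_square_linear_combination[OF f g, symmetric]
    by (rule integral_nonneg_AE) simp
  have FG: "0 \<le> F" "0 \<le> G" by (auto simp: F_G_I_def)
  have "I\<^sup>2 \<le> F * G"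
  proof (cases "F = 0")
    case True
    have "I = 0"
    proof (rule ccontr)
      assume "I \<noteq> 0"
      \<comment> \<open>The coefficient is chosen so that the quadratic form would take the value
        -1.\<close>
      have "0 \<le> 2 * (- (G + 1) / (2 * I)) * 1 * I + 1\<^sup>2 * G" using q[of "- (G + 1) / (2 * I)" 1] True by simp
      then show False using \<open>I \<noteq> 0\<close> by (simp add: field_simps)
    qed
    then show ?thesis using FG by simp
  next
    case False
    \<comment> \<open>Up to scaling, \<open>- I\<close> and \<open>F\<close> are the minimizing
      coefficients; the form takes the value \<open>F\<close> times the Gram determinant.\<close>
    have "0 \<le> F * (F * G - I\<^sup>2)" using q[of "- I" F] by (simp add: power2_eq_square algebra_simps)
    then show ?thesis using False FG by (simp add: zero_le_mult_iff)
  qed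
  also have "F * G = (L2_norm b f * L2_norm b g)\<^sup>2" by (simp add: F_G_I_def power_mult_distrib)
  finally have "\<bar>I\<bar> \<le> \<bar>L2_norm b f * L2_norm b g\<bar>" by (simp add: abs_le_square_iff)
  then show ?thesis by (simp add: F_G_I_def(3) L2_norm_def integral_nonneg_AE)
qed

section \<open>Bounded linear functionals on square integrable functions\<close>

lemma inner_in_L2_dual:
  fixes v :: "real \<Rightarrow> 'a::{real_inner,banach,second_countable_topology}"
  assumes v: "v \<in> L2 b"
  shows "(\<lambda>f. LINT t|lebesgue_on {0..b}. v t \<bullet> f t) \<in> L2_dual b"
  unfolding L2_dual_def
proof (intro CollectI conjI ballI allI)
  show "\<exists>C. \<forall>f\<in>L2 b. \<bar>LINT t|lebesgue_on {0..b}. v t \<bullet> f t\<bar> \<le> C * L2_norm b f"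
    using L2_Cauchy_Schwarz[OF v] by blast
qed (use L2_inner_integrable[OF v] in \<open>simp_all add: inner_add_right\<close>)

lemma L2_dual_add:
  "\<Phi> \<in> L2_dual b \<Longrightarrow> f \<in> L2 b \<Longrightarrow> g \<in> L2 b \<Longrightarrow> \<Phi> (\<lambda>t. f t + g t) = \<Phi> f + \<Phi> g"
  by (simp add: L2_dual_def)

lemma L2_dual_scaleR:
  "\<Phi> \<in> L2_dual b \<Longrightarrow> f \<in> L2 b \<Longrightarrow> \<Phi> (\<lambda>t. c *\<^sub>R f t) = c * \<Phi> f"
  by (simp add: L2_dual_def)

lemma L2_dual_diff:
  assumes "\<Phi> \<in> L2_dual b" "f \<in> L2 b" "g \<in> L2 b"
  shows "\<Phi> (\<lambda>t. f t - g t) = \<Phi> f - \<Phi> g"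
  using L2_dual_add[OF assms(1,2) L2_scaleR[OF assms(3), of "-1"]] L2_dual_scaleR[OF assms(1,3), of "-1"]
  by simp

text \<open>Functionals act on functions, not on classes; the bound by the seminorm
  \<open>L2_norm\<close> makes them continuous and blind to null sets.\<close>

lemma L2_dual_tendsto:
  assumes \<Phi>: "\<Phi> \<in> L2_dual b" and q: "\<And>n. q n \<in> L2 b" and p: "p \<in> L2 b"
    and lim: "(\<lambda>n. L2_norm b (\<lambda>t. q n t - p t)) \<longlonglongrightarrow> 0"
  shows "(\<lambda>n. \<Phi> (q n)) \<longlonglongrightarrow> \<Phi> p"
proof -
  obtain C where C: "\<And>f. f \<in> L2 b \<Longrightarrow> \<bar>\<Phi> f\<bar> \<le> C * L2_norm b f"
    using \<Phi> unfolding L2_dual_def by blast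
  have "norm (\<Phi> (q n) - \<Phi> p) \<le> C * L2_norm b (\<lambda>t. q n t - p t)" for n
    using C[OF L2_diff[OF q p]] L2_dual_diff[OF \<Phi> q p] by simp
  then have "(\<lambda>n. \<Phi> (q n) - \<Phi> p) \<longlonglongrightarrow> 0"
    by (intro Lim_null_comparison[OF always_eventually tendsto_mult_right_zero[OF lim, of C]]) simp
  then show ?thesis by (simp add: LIM_zero_iff)
qed

text \<open>Midpoints stand in for general convex combinations: they are all that the parallelogram
  law uses, and every property needed passes to the hull by a two-case induction.\<close>

inductive_set midpoint_hull :: "(real \<Rightarrow> 'a::real_vector) set \<Rightarrow> (real \<Rightarrow> 'a) set" for S where
  base: "f \<in> S \<Longrightarrow> f \<in> midpoint_hull S"
| mid: "f \<in> midpoint_hull S \<Longrightarrow> g \<in> midpoint_hull S \<Longrightarrow>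
    (\<lambda>t. (1/2) *\<^sub>R (f t + g t)) \<in> midpoint_hull S"

lemma midpoint_hull_mono:
  assumes "f \<in> midpoint_hull S" "S \<subseteq> S'"
  shows "f \<in> midpoint_hull S'"
  using assms by (induction rule: midpoint_hull.induct) (auto intro: midpoint_hull.intros)

lemma midpoint_hull_W_ad:
  assumes W: "hyp_W b W" and "S \<subseteq> W_ad b W" "f \<in> midpoint_hull S"
  shows "f \<in> W_ad b W"
  using assms(3)
proof (induction rule: midpoint_hull.induct)
  case (base f)
  then show ?case using assms(2) by auto
next
  case (mid f g)
  then have "AE t in lebesgue_on {0..b}. f t \<in> W t" "AE t in lebesgue_on {0..b}. g t \<in> W t"
    by (auto simp: W_ad_def)
  then have "AE t in lebesgue_on {0..b}. (1/2) *\<^sub>R (f t + g t) \<in> W t"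
    using AE_space
  proof eventually_elim
    case (elim t)
    then have "convex (W t)" using W by (auto simp: hyp_W_def)
    from convexD[OF this elim(1,2), of "1/2" "1/2"] show ?case by (simp add: scaleR_add_right)
  qed
  moreover have "(\<lambda>t. (1/2) *\<^sub>R (f t + g t)) \<in> L2 b"
    using mid by (intro L2_scaleR L2_add) (auto simp: W_ad_def)
  ultimately show ?case by (simp add: W_ad_def)
qed

text \<open>The condition describes a slab, which is convex. Applied to a tail of a sequence, it
  carries the limiting behaviour of \<Phi> over to the hull of that tail.\<close>

lemma midpoint_hull_functional_bound:
  assumes \<Phi>: "\<Phi> \<in> L2_dual b" and S: "S \<subseteq> L2 b" and bd: "\<And>f. f \<in> S \<Longrightarrow> \<bar>\<Phi> f - c\<bar> \<le> e"
    and "f \<in> midpoint_hull S"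
  shows "f \<in> L2 b \<and> \<bar>\<Phi> f - c\<bar> \<le> e"
  using assms(4)
proof (induction rule: midpoint_hull.induct)
  case (base f)
  then show ?case using S bd by auto
next
  case (mid f g)
  then have L: "f \<in> L2 b" "g \<in> L2 b" by auto
  have "\<Phi> (\<lambda>t. (1/2) *\<^sub>R (f t + g t)) = 1/2 * \<Phi> (\<lambda>t. f t + g t)"
    by (rule L2_dual_scaleR[OF \<Phi> L2_add[OF L]])
  also have "\<Phi> (\<lambda>t. f t + g t) = \<Phi> f + \<Phi> g"
    by (rule L2_dual_add[OF \<Phi> L])
  finally have "\<Phi> (\<lambda>t. (1/2) *\<^sub>R (f t + g t)) = (\<Phi> f + \<Phi> g) / 2" by simp
  then show ?case using mid L2_scaleR[OF L2_add[OF L], of "1/2"] by (auto simp: abs_le_iff)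
qed

text \<open>Cauchy-Schwarz against the constant 1 turns an L2-Cauchy sequence into an L1-Cauchy one,
  which has an almost everywhere convergent subsequence; the common bound on the values of
  \<open>W\<close> then allows dominated convergence of the squares, and closed values keep the
  limit admissible.\<close>

lemma L2_Cauchy_limit:
  fixes q :: "nat \<Rightarrow> real \<Rightarrow> 'a::{real_inner,banach,second_countable_topology}"
  assumes W: "hyp_W b W" and q: "\<And>n. q n \<in> W_ad b W"
    and cauchy: "\<And>e. 0 < e \<Longrightarrow> \<exists>N. \<forall>i\<ge>N. \<forall>j\<ge>N. L2_norm b (\<lambda>t. q i t - q j t) < e"
  obtains p r where "p \<in> W_ad b W" "strict_mono (r :: nat \<Rightarrow> nat)"
    "(\<lambda>n. L2_norm b (\<lambda>t. q (r n) t - p t)) \<longlonglongrightarrow> 0"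
proof -
  let ?M = "lebesgue_on {0..b}"
  have qL2: "q n \<in> L2 b" for n using q by (auto simp: W_ad_def)
  have qL1: "integrable ?M (q n)" for n using qL2 by (rule L2_imp_integrable)
  have L1: "(LINT t|?M. norm (f t)) \<le> sqrt (LINT t|?M. 1) * L2_norm b f" if "f \<in> L2 b" for f :: "real \<Rightarrow> 'a"
  proof -
    have 1: "(\<lambda>t. 1::real) \<in> L2 b" "(\<lambda>t. norm (f t)) \<in> L2 b"
      using that by (auto simp: L2_def)
    have "(LINT t|?M. norm (f t)) \<le> L2_norm b (\<lambda>t. 1::real) * L2_norm b (\<lambda>t. norm (f t))"
      using L2_Cauchy_Schwarz[OF 1] by (simp add: integral_nonneg_AE)
    then show ?thesis by (simp add: L2_norm_def)
  qed
  have "\<exists>N. \<forall>i\<ge>N. \<forall>j\<ge>N. (LINT t|?M. norm (q i t - q j t)) < e" if "0 < e" for e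
  proof -
    \<comment> \<open>The added 1 keeps the divisor positive even if the interval is null.\<close>
    define s where "s = sqrt (LINT t|?M. 1) + 1"
    have s: "0 < s" by (simp add: s_def add_nonneg_pos)
    then obtain N where N: "\<And>i j. i \<ge> N \<Longrightarrow> j \<ge> N \<Longrightarrow> L2_norm b (\<lambda>t. q i t - q j t) < e / s"
      using cauchy[of "e / s"] \<open>0 < e\<close> by auto
    have "(LINT t|?M. norm (q i t - q j t)) < e" if "i \<ge> N" "j \<ge> N" for i j
    proof -
      have "(LINT t|?M. norm (q i t - q j t)) \<le> sqrt (LINT t|?M. 1) * L2_norm b (\<lambda>t. q i t - q j t)"
        by (rule L1[OF L2_diff[OF qL2 qL2]])
      also have "\<dots> \<le> s * L2_norm b (\<lambda>t. q i t - q j t)"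
        by (intro mult_right_mono) (auto simp: s_def L2_norm_def integral_nonneg_AE)
      also have "\<dots> < s * (e / s)" using N[OF that] s by (intro mult_strict_left_mono)
      finally show ?thesis using s by simp
    qed
    then show ?thesis by blast
  qed
  then obtain r where r: "strict_mono r" "AE t in ?M. Cauchy (\<lambda>i. q (r i) t)"
    by (rule cauchy_L1_AE_cauchy_subseq[OF qL1])
  obtain \<phi> :: "real \<Rightarrow> real" where \<phi>: "\<phi> \<in> L2 b" "AE t in ?M. \<forall>v\<in>W t. norm v \<le> \<phi> t"
    using hyp_W_bound[OF W] .
  define p where "p t = lim (\<lambda>i. q (r i) t)" for t
  have p_meas: "p \<in> borel_measurable ?M"
    unfolding p_def using L2_measurable[OF qL2] by (rule borel_measurable_lim_metric)
  have "AE t in ?M. \<forall>n. q n t \<in> W t" using q by (simp add: W_ad_def AE_all_countable)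
  with r(2) have lim: "AE t in ?M. (\<lambda>i. q (r i) t) \<longlonglongrightarrow> p t \<and> p t \<in> W t \<and> (\<forall>n. q n t \<in> W t)"
    using AE_space
  proof eventually_elim
    case (elim t)
    then have lim: "(\<lambda>i. q (r i) t) \<longlonglongrightarrow> p t"
      unfolding p_def by (simp add: Cauchy_convergent_iff convergent_LIMSEQ_iff)
    have "closed (W t)" using W elim(3) by (auto simp: hyp_W_def)
    then have "p t \<in> W t" using closed_sequentially[OF _ _ lim] elim by blast
    then show ?case using lim elim by blast
  qed
  have "AE t in ?M. p t \<in> W t" using lim by eventually_elim simp
  with \<phi>(2) have "AE t in ?M. norm (p t) \<le> \<phi> t" by eventually_elim auto
  then have pL2: "p \<in> L2 b" by (rule L2_if_norm_le[OF p_meas \<phi>(1)])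
  have "(\<lambda>n. LINT t|?M. (norm (q (r n) t - p t))\<^sup>2) \<longlonglongrightarrow> (LINT t|?M. 0)"
  proof (rule integral_dominated_convergence)
    \<comment> \<open>Both functions are bounded by \<phi>, so their difference is bounded by twice
      \<phi>.\<close>
    show "integrable ?M (\<lambda>t. 4 * (norm (\<phi> t))\<^sup>2)" using \<phi>(1) by (simp add: L2_def)
    show "AE t in ?M. (\<lambda>n. (norm (q (r n) t - p t))\<^sup>2) \<longlonglongrightarrow> 0"
      using lim
    proof eventually_elim
      case (elim t)
      then have "(\<lambda>n. q (r n) t - p t) \<longlonglongrightarrow> 0" by (simp add: LIM_zero_iff)
      then show ?case using tendsto_power[OF tendsto_norm_zero, of "\<lambda>n. q (r n) t - p t" sequentially 2] by simp
    qed
    show "AE t in ?M. norm ((norm (q (r n) t - p t))\<^sup>2) \<le> 4 * (norm (\<phi> t))\<^sup>2" for n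
      using lim \<phi>(2)
    proof eventually_elim
      case (elim t)
      then have "norm (q (r n) t) \<le> \<phi> t" "norm (p t) \<le> \<phi> t" by auto
      then have "norm (q (r n) t - p t) \<le> 2 * norm (\<phi> t)"
        using norm_triangle_ineq4[of "q (r n) t" "p t"] by simp
      from power_mono[OF this norm_ge_zero, of 2] show ?case by (simp add: power_mult_distrib)
    qed
  next
    show "(\<lambda>t. (norm (q (r n) t - p t))\<^sup>2) \<in> borel_measurable ?M" for n
      using L2_integrable_square[OF L2_diff[OF qL2 pL2]] by (rule borel_measurable_integrable)
  qed simp
  then have "(\<lambda>n. sqrt (LINT t|?M. (norm (q (r n) t - p t))\<^sup>2)) \<longlonglongrightarrow> sqrt 0"
    by (intro tendsto_real_sqrt) simp
  then have "(\<lambda>n. L2_norm b (\<lambda>t. q (r n) t - p t)) \<longlonglongrightarrow> 0"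
    by (simp add: L2_norm_def)
  then show ?thesis using that[of p r] pL2 \<open>AE t in ?M. p t \<in> W t\<close> r(1) by (simp add: W_ad_def)
qed

section \<open>Weak compactness of the set of admissible controls\<close>

text \<open>Bolzano-Weierstrass. It allows the limit of a functional to be identified on
  subsequences along which its values already converge.\<close>

lemma bounded_LIMSEQ_if_unique_cluster:
  fixes X :: "nat \<Rightarrow> real"
  assumes bd: "\<And>n. \<bar>X n\<bar> \<le> K"
    and uniq: "\<And>r c. strict_mono r \<Longrightarrow> (\<lambda>n. X (r n)) \<longlonglongrightarrow> c \<Longrightarrow> c = L"
  shows "X \<longlonglongrightarrow> L"
proof (rule ccontr)
  assume "\<not> X \<longlonglongrightarrow> L"
  then obtain e where e: "0 < e" "\<And>N. \<exists>n\<ge>N. e \<le> dist (X n) L"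
    unfolding lim_sequentially by (metis not_le)
  then have "infinite {n. e \<le> dist (X n) L}"
    unfolding infinite_nat_iff_unbounded_le by simp
  then obtain r :: "nat \<Rightarrow> nat" where r: "strict_mono r" "\<And>n. e \<le> dist (X (r n)) L"
    using infinite_enumerate by (metis mem_Collect_eq)
  have "\<forall>n. X (r n) \<in> {- K..K}" using bd by (simp add: abs_le_iff minus_le_iff)
  then obtain c s where s: "strict_mono s" "((\<lambda>n. X (r n)) \<circ> s) \<longlonglongrightarrow> c"
    using seq_compactE[OF compact_imp_seq_compact[OF compact_Icc]] by metis
  have "c = L" using uniq[OF strict_mono_o[OF r(1) s(1)]] s(2) by (simp add: o_def)
  moreover have "e \<le> dist c L"
    using s(2) r(2) by (intro Lim_bounded2[OF tendsto_dist[OF s(2) tendsto_const], of 0]) simp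
  ultimately show False using e(1) by simp
qed

lemma W_ad_L2_bounded:
  assumes W: "hyp_W b W"
  obtains K where "\<And>w. w \<in> W_ad b W \<Longrightarrow> L2_norm b w \<le> K"
proof -
  obtain \<phi> :: "real \<Rightarrow> real" where \<phi>: "\<phi> \<in> L2 b"
    "AE t in lebesgue_on {0..b}. \<forall>v\<in>W t. norm v \<le> \<phi> t"
    using hyp_W_bound[OF W] .
  have "L2_norm b w \<le> L2_norm b \<phi>" if w: "w \<in> W_ad b W" for w
    unfolding L2_norm_def
  proof (intro real_sqrt_le_mono integral_mono_AE')
    have "AE t in lebesgue_on {0..b}. w t \<in> W t" using w by (simp add: W_ad_def)
    with \<phi>(2) show "AE t in lebesgue_on {0..b}. (norm (w t))\<^sup>2 \<le> (norm (\<phi> t))\<^sup>2"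
      by eventually_elim (auto intro!: power_mono order_trans[OF _ abs_ge_self])
  qed (use \<phi>(1) in \<open>simp_all add: L2_def\<close>)
  then show ?thesis by (rule that)
qed

text \<open>Almost norm-minimal elements of the midpoint hulls of the tails form a Cauchy sequence by the
  parallelogram law; its limit lies in all closed hulls of tails.\<close>

lemma weak_cluster_point:
  fixes w :: "nat \<Rightarrow> real \<Rightarrow> 'a::{real_inner,banach,second_countable_topology}"
  assumes W: "hyp_W b W" and w: "\<And>n. w n \<in> W_ad b W"
  obtains p where "p \<in> W_ad b W"
    "\<And>\<Phi> c. \<Phi> \<in> L2_dual b \<Longrightarrow> (\<lambda>n. \<Phi> (w n)) \<longlonglongrightarrow> c \<Longrightarrow> \<Phi> p = c"
proof -
  define N where "N f = (LINT t|lebesgue_on {0..b}. (norm (f t))\<^sup>2)" for f :: "real \<Rightarrow> 'a"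
  define H where "H k = midpoint_hull (w ` {k..})" for k
  \<comment> \<open>The hulls of the tails shrink, so \<open>d\<close> increases, and it stays below
    the squared norm bound on admissible controls. Its convergence is what forces almost minimal
    elements of different hulls together.\<close>
  define d where "d k = Inf (N ` H k)" for k
  have wH: "w k \<in> H k" for k unfolding H_def by (rule midpoint_hull.base) simp
  have H_W: "f \<in> W_ad b W" if "f \<in> H k" for f k
    by (rule midpoint_hull_W_ad[OF W _ that[unfolded H_def]]) (use w in auto)
  have H_mono: "f \<in> H k" if "f \<in> H j" "k \<le> j" for f j k
    using that(1) unfolding H_def by (rule midpoint_hull_mono) (use that(2) in auto)
  have N_nonneg: "0 \<le> N f" for f unfolding N_def by (rule integral_nonneg_AE) simp
  have bdd: "bdd_below (N ` H k)" for k using N_nonneg by (intro bdd_belowI[of _ 0]) auto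
  have d_le: "d k \<le> N f" if "f \<in> H k" for f k
    unfolding d_def using that bdd by (intro cInf_lower) auto
  have "incseq d"
  proof (rule incseq_SucI)
    show "d k \<le> d (Suc k)" for k
      unfolding d_def using wH[of "Suc k"] bdd H_mono[of _ "Suc k" k] by (intro cInf_superset_mono) auto
  qed
  obtain K where K: "\<And>w. w \<in> W_ad b W \<Longrightarrow> L2_norm b w \<le> K"
    using W_ad_L2_bounded[OF W] by blast
  have "\<forall>k. d k \<le> K\<^sup>2"
  proof
    fix k
    have "d k \<le> N (w k)" using wH by (rule d_le)
    also have "\<dots> = (L2_norm b (w k))\<^sup>2" by (simp add: L2_norm_square N_def)
    also have "\<dots> \<le> K\<^sup>2" using K[OF w] by (intro power_mono) (auto simp: L2_norm_def integral_nonneg_AE)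
    finally show "d k \<le> K\<^sup>2" .
  qed
  then obtain D where D: "d \<longlonglongrightarrow> D" "\<forall>k. d k \<le> D"
    by (rule incseq_convergent[OF \<open>incseq d\<close>])
  define \<rho> where "\<rho> k = inverse (real (Suc k))" for k
  have "\<exists>f\<in>H k. N f < d k + \<rho> k" for k
  proof -
    have "Inf (N ` H k) < d k + \<rho> k" unfolding d_def \<rho>_def by simp
    then show ?thesis using cInf_lessD[of "N ` H k"] wH by blast
  qed
  then obtain q where q: "\<And>k. q k \<in> H k" "\<And>k. N (q k) < d k + \<rho> k" by metis
  have qW: "q k \<in> W_ad b W" for k using H_W q(1) by blast
  then have qL2: "q k \<in> L2 b" for k by (simp add: W_ad_def)
  \<comment> \<open>For \<open>k \<le> j\<close> the midpoint of \<open>q j\<close> and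
    \<open>q k\<close> lies in \<open>H k\<close>, so the parallelogram law bounds the squared
    distance by \<open>2 * (d j + \<rho> j) + 2 * (d k + \<rho> k) - 4 * d k\<close>; then use
    \<open>d j \<le> D\<close> and \<open>\<rho> j \<le> \<rho> k\<close>.\<close>
  define c where "c k = 2 * (D - d k) + 4 * \<rho> k" for k
  have diff: "N (\<lambda>t. q j t - q k t) \<le> c k" if "k \<le> j" for j k
  proof -
    define h where "h = (\<lambda>t. (1/2) *\<^sub>R (q j t + q k t))"
    have "h \<in> H k"
      using H_mono[OF q(1) that] q(1)[of k] unfolding H_def h_def by (rule midpoint_hull.mid)
    then have dh: "d k \<le> N h" by (rule d_le)
    have eq: "N (\<lambda>t. q j t - q k t) =
        2 * N (q j) + 2 * N (q k) - 4 * N h"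
      using integral_square_linear_combination[OF qL2[of j] qL2[of k], of 1 "-1"]
        integral_square_linear_combination[OF qL2[of j] qL2[of k], of "1/2" "1/2"]
      by (simp add: N_def h_def L2_norm_square scaleR_add_right power_divide)
    have "\<rho> j \<le> \<rho> k" using that by (simp add: \<rho>_def)
    moreover have "d j \<le> D" using D(2) by blast
    ultimately have "2 * N (q j) + 2 * N (q k) - 4 * N h \<le> c k"
      using dh q(2)[of j] q(2)[of k] unfolding c_def by argo
    then show ?thesis using eq by simp
  qed
  have "c \<longlonglongrightarrow> 2 * (D - D) + 4 * 0"
    unfolding c_def \<rho>_def by (intro tendsto_intros D(1) LIMSEQ_inverse_real_of_nat)
  then have c0: "c \<longlonglongrightarrow> 0" by simp
  have "\<exists>N. \<forall>i\<ge>N. \<forall>j\<ge>N. L2_norm b (\<lambda>t. q i t - q j t) < e" if "0 < e" for e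
  proof -
    have "eventually (\<lambda>k. c k < e\<^sup>2) sequentially"
      using c0 \<open>0 < e\<close> by (intro order_tendstoD) auto
    then obtain K where K: "\<And>k. k \<ge> K \<Longrightarrow> c k < e\<^sup>2" by (auto simp: eventually_sequentially)
    have *: "L2_norm b (\<lambda>t. q j t - q k t) < e" if "K \<le> k" "k \<le> j" for j k
    proof -
      have "(L2_norm b (\<lambda>t. q j t - q k t))\<^sup>2 < e\<^sup>2"
        using le_less_trans[OF diff[OF that(2)] K[OF that(1)]] by (simp only: L2_norm_square N_def)
      then show ?thesis by (rule power2_less_imp_less) (use \<open>0 < e\<close> in simp)
    qed
    have "L2_norm b (\<lambda>t. q i t - q j t) < e" if "K \<le> i" "K \<le> j" for i j
    proof (cases "j \<le> i")
      case True
      then show ?thesis by (rule *[OF that(2)])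
    next
      case False
      have "L2_norm b (\<lambda>t. q i t - q j t) = L2_norm b (\<lambda>t. q j t - q i t)"
        unfolding L2_norm_def by (subst norm_minus_commute) (rule refl)
      with *[OF that(1), of j] False show ?thesis by simp
    qed
    then show ?thesis by blast
  qed
  then obtain p r where p: "p \<in> W_ad b W" "strict_mono r"
    "(\<lambda>n. L2_norm b (\<lambda>t. q (r n) t - p t)) \<longlonglongrightarrow> 0"
    by (rule L2_Cauchy_limit[OF W qW])
  have "\<Phi> p = c" if \<Phi>: "\<Phi> \<in> L2_dual b" and lim: "(\<lambda>n. \<Phi> (w n)) \<longlonglongrightarrow> c" for \<Phi> c
  proof -
    \<comment> \<open>\<open>q k\<close> combines only terms of index at least \<open>k\<close>, so
      \<Phi> maps it as close to \<open>c\<close> as it maps that tail.\<close>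
    have "(\<lambda>k. \<Phi> (q k)) \<longlonglongrightarrow> c"
    proof (rule LIMSEQ_I)
      fix e :: real assume "0 < e"
      then obtain K where K: "\<And>n. n \<ge> K \<Longrightarrow> \<bar>\<Phi> (w n) - c\<bar> < e / 2"
        using LIMSEQ_D[OF lim, of "e / 2"] by auto
      have "norm (\<Phi> (q k) - c) < e" if "K \<le> k" for k
      proof -
        have "\<bar>\<Phi> (q k) - c\<bar> \<le> e / 2"
        proof (rule midpoint_hull_functional_bound[OF \<Phi>, THEN conjunct2])
          show "q k \<in> midpoint_hull (w ` {k..})" using q(1) by (simp add: H_def)
          show "w ` {k..} \<subseteq> L2 b" using w by (auto simp: W_ad_def)
          show "\<bar>\<Phi> f - c\<bar> \<le> e / 2" if "f \<in> w ` {k..}" for f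
            using that K \<open>K \<le> k\<close> by (auto intro: less_imp_le)
        qed
        then show ?thesis using \<open>0 < e\<close> by simp
      qed
      then show "\<exists>no. \<forall>n\<ge>no. norm (\<Phi> (q n) - c) < e" by blast
    qed
    from LIMSEQ_subseq_LIMSEQ[OF this p(2)] have "(\<lambda>n. \<Phi> (q (r n))) \<longlonglongrightarrow> c" by (simp add: o_def)
    moreover have "(\<lambda>n. \<Phi> (q (r n))) \<longlonglongrightarrow> \<Phi> p"
      using p by (intro L2_dual_tendsto[OF \<Phi> qL2 _ p(3)]) (simp add: W_ad_def)
    ultimately show ?thesis using LIMSEQ_unique by blast
  qed
  then show ?thesis using that p(1) by blast
qed

text \<open>A cluster point only identifies limits of functionals that already converge. Diagonal
  extraction makes the inner products with every \<open>w m\<close> converge, which forces the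
  cluster points of all further subsequences to agree under every functional; the bounded values of
  each functional then have a single cluster value.\<close>

lemma W_ad_weakly_compact:
  fixes w :: "nat \<Rightarrow> real \<Rightarrow> 'a::{real_inner,banach,second_countable_topology}"
  assumes W: "hyp_W b W" and w: "\<And>n. w n \<in> W_ad b W"
  obtains p r where "p \<in> W_ad b W" "strict_mono (r :: nat \<Rightarrow> nat)"
    "L2_weakly_converges b (\<lambda>n. w (r n)) p"
proof -
  define ip where "ip f g = (LINT t|lebesgue_on {0..b}. f t \<bullet> g t)" for f g :: "real \<Rightarrow> 'a"
  have wL2: "w n \<in> L2 b" for n using w by (simp add: W_ad_def)
  obtain K where K: "\<And>w. w \<in> W_ad b W \<Longrightarrow> L2_norm b w \<le> K"
    using W_ad_L2_bounded[OF W] by blast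
  have nonneg: "0 \<le> L2_norm b f" for f :: "real \<Rightarrow> 'a" by (simp add: L2_norm_def integral_nonneg_AE)
  have w_le: "L2_norm b (w k) \<le> K" for k using K[OF w] .
  have "norm (ip (w m) (w n)) \<le> K * K" for m n
  proof -
    have "norm (ip (w m) (w n)) \<le> L2_norm b (w m) * L2_norm b (w n)"
      using L2_Cauchy_Schwarz[OF wL2 wL2] by (simp add: ip_def)
    also have "\<dots> \<le> K * K" using w_le nonneg order_trans[OF nonneg w_le] by (intro mult_mono)
    finally show ?thesis .
  qed
  then have "\<exists>r. strict_mono r \<and> (\<forall>m. \<exists>l. (\<lambda>n. ip (w m) (w (r n))) \<longlonglongrightarrow> l)"
    by (rule function_convergent_subsequence[OF countableI_type[of "UNIV :: nat set"],
          of "\<lambda>n m. ip (w m) (w n)" "K * K"]) blast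
  then obtain r :: "nat \<Rightarrow> nat" where r: "strict_mono r" "\<And>m. \<exists>l. (\<lambda>n. ip (w m) (w (r n))) \<longlonglongrightarrow> l"
    by blast
  then obtain a where a: "\<And>m. (\<lambda>n. ip (w m) (w (r n))) \<longlonglongrightarrow> a m" by metis
  obtain p where p: "p \<in> W_ad b W"
    "\<And>\<Phi> c. \<Phi> \<in> L2_dual b \<Longrightarrow> (\<lambda>n. \<Phi> (w (r n))) \<longlonglongrightarrow> c \<Longrightarrow> \<Phi> p = c"
    using weak_cluster_point[OF W, of "\<lambda>n. w (r n)"] w by blast
  have pL2: "p \<in> L2 b" using p(1) by (simp add: W_ad_def)
  have "(\<lambda>n. \<Phi> (w (r n))) \<longlonglongrightarrow> \<Phi> p" if \<Phi>: "\<Phi> \<in> L2_dual b" for \<Phi>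
  proof -
    obtain C where C: "\<And>f. f \<in> L2 b \<Longrightarrow> \<bar>\<Phi> f\<bar> \<le> C * L2_norm b f"
      using \<Phi> unfolding L2_dual_def by blast
    show ?thesis
    proof (rule bounded_LIMSEQ_if_unique_cluster)
      show "\<bar>\<Phi> (w (r n))\<bar> \<le> \<bar>C\<bar> * K" for n
      proof -
        have "\<bar>\<Phi> (w (r n))\<bar> \<le> C * L2_norm b (w (r n))" by (rule C[OF wL2])
        also have "\<dots> \<le> \<bar>C\<bar> * K" using w_le nonneg by (intro mult_mono) auto
        finally show ?thesis .
      qed
      fix s :: "nat \<Rightarrow> nat" and c assume s: "strict_mono s" "(\<lambda>n. \<Phi> (w (r (s n)))) \<longlonglongrightarrow> c"
      obtain p' where p': "p' \<in> W_ad b W"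
        "\<And>\<Phi> c. \<Phi> \<in> L2_dual b \<Longrightarrow> (\<lambda>n. \<Phi> (w (r (s n)))) \<longlonglongrightarrow> c \<Longrightarrow> \<Phi> p' = c"
        using weak_cluster_point[OF W, of "\<lambda>n. w (r (s n))"] w by blast
      have p'L2: "p' \<in> L2 b" using p'(1) by (simp add: W_ad_def)
      \<comment> \<open>\<open>p\<close> and \<open>p'\<close> have the same inner products with all \<open>w m\<close> and lie in their weak closure.\<close>
      define v where "v = (\<lambda>t. p t - p' t)"
      have vL2: "v \<in> L2 b" unfolding v_def by (rule L2_diff[OF pL2 p'L2])
      have orth: "ip v (w m) = 0" for m
      proof -
        have "ip (w m) p = a m"
          using p(2)[OF inner_in_L2_dual[OF wL2]] a unfolding ip_def by blast
        moreover have "(\<lambda>n. ip (w m) (w (r (s n)))) \<longlonglongrightarrow> a m"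
          using LIMSEQ_subseq_LIMSEQ[OF a s(1)] by (simp add: o_def)
        then have "ip (w m) p' = a m"
          using p'(2)[OF inner_in_L2_dual[OF wL2]] unfolding ip_def by blast
        ultimately show ?thesis
          using L2_inner_integrable[OF wL2[of m] pL2] L2_inner_integrable[OF wL2[of m] p'L2]
          by (simp add: ip_def v_def inner_commute inner_diff_right)
      qed
      have "ip v p = 0" "ip v p' = 0"
        using p(2)[OF inner_in_L2_dual[OF vL2], of 0] p'(2)[OF inner_in_L2_dual[OF vL2], of 0] orth
        unfolding ip_def by simp_all
      then have "ip v v = 0"
        using L2_inner_integrable[OF vL2 pL2] L2_inner_integrable[OF vL2 p'L2]
        unfolding ip_def by (simp add: v_def inner_diff_right)
      \<comment> \<open>\<open>v\<close> need only vanish almost everywhere; the bound on \<Phi> by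
        \<open>L2_norm\<close> still gives \<Phi> the value 0 at \<open>v\<close>.\<close>
      then have "L2_norm b v = 0" by (simp add: L2_norm_def ip_def power2_norm_eq_inner)
      then have "\<Phi> p = \<Phi> p'"
        using C[OF vL2] L2_dual_diff[OF \<Phi> pL2 p'L2] by (simp add: v_def)
      then show "c = \<Phi> p" using p'(2)[OF \<Phi> s(2)] by simp
    qed
  qed
  then show ?thesis using that[OF p(1) r(1)] by (simp add: L2_weakly_converges_def)
qed

text \<open>Test with \<open>p\<close> itself: its squared norm is the limit of the inner products
  with \<open>w n\<close>, which Cauchy-Schwarz bounds in the limit by
  \<open>L2_norm b p * c\<close>.\<close>

lemma L2_norm_weak_lsc:
  fixes w :: "nat \<Rightarrow> real \<Rightarrow> 'a::{real_inner,banach,second_countable_topology}"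
  assumes conv: "L2_weakly_converges b w p" and w: "\<And>n. w n \<in> L2 b" and p: "p \<in> L2 b"
    and lim: "(\<lambda>n. L2_norm b (w n)) \<longlonglongrightarrow> c"
  shows "L2_norm b p \<le> c"
proof -
  have "(\<lambda>n. LINT t|lebesgue_on {0..b}. p t \<bullet> w n t) \<longlonglongrightarrow> (LINT t|lebesgue_on {0..b}. p t \<bullet> p t)"
    using conv[unfolded L2_weakly_converges_def] inner_in_L2_dual[OF p] by (rule bspec)
  then have "(LINT t|lebesgue_on {0..b}. p t \<bullet> p t) \<le> L2_norm b p * c"
  proof (rule LIMSEQ_le)
    show "(\<lambda>n. L2_norm b p * L2_norm b (w n)) \<longlonglongrightarrow> L2_norm b p * c"
      by (intro tendsto_intros lim)
    show "\<exists>N. \<forall>n\<ge>N. (LINT t|lebesgue_on {0..b}. p t \<bullet> w n t) \<le> L2_norm b p * L2_norm b (w n)"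
      using L2_Cauchy_Schwarz[OF p w] by (auto simp: abs_le_iff)
  qed
  then have le: "L2_norm b p * L2_norm b p \<le> L2_norm b p * c"
    using L2_norm_square[of b p] by (simp add: power2_eq_square[symmetric] power2_norm_eq_inner)
  have nonneg: "0 \<le> L2_norm b f" for f :: "real \<Rightarrow> 'a" by (simp add: L2_norm_def integral_nonneg_AE)
  have "0 \<le> c" using lim nonneg by (intro LIMSEQ_le_const) auto
  then show ?thesis using le nonneg[of p] by (cases "L2_norm b p = 0") auto
qed

section \<open>A priori bounds for mild solutions\<close>

text \<open>Adding \<open>z\<close> to the value at \<open>v\<close> keeps the graph monotone, so by
  maximality it was there already.\<close>

lemma maximal_monotone_mem:
  assumes B: "maximal_monotone B" and z: "\<And>x' y'. y' \<in> B x' \<Longrightarrow> 0 \<le> (z - y') \<bullet> (v - x')"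
  shows "z \<in> B v"
proof -
  define C where "C = B(v := insert z (B v))"
  have B_mono: "0 \<le> (y - y') \<bullet> (x - x')" if "y \<in> B x" "y' \<in> B x'" for x x' y y'
    using B that unfolding maximal_monotone_def monotone_operator_def by blast
  have "monotone_operator C"
    unfolding monotone_operator_def
  proof (intro allI ballI)
    fix x x' y y' assume y: "y \<in> C x" and y': "y' \<in> C x'"
    consider "y \<in> B x" "y' \<in> B x'" | "y = z" "x = v" "y' \<in> B x'" | "y \<in> B x" "y' = z" "x' = v"
      | "y = z" "x = v" "y' = z" "x' = v"
      using y y' unfolding C_def by (auto split: if_splits)
    then show "0 \<le> (y - y') \<bullet> (x - x')"
    proof cases
      case 3
      then have "0 \<le> (z - y) \<bullet> (v - x)" by (intro z)
      also have "\<dots> = (y - y') \<bullet> (x - x')" using 3 by (simp add: inner_diff_left inner_diff_right)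
      finally show ?thesis .
    qed (use z B_mono in simp_all)
  qed
  moreover have "\<forall>x. B x \<subseteq> C x" by (auto simp: C_def)
  ultimately have "C = B" using B unfolding maximal_monotone_def by blast
  then show ?thesis unfolding C_def by (metis fun_upd_same insertI1)
qed

text \<open>The membership criterion consists of inequalities affine in the candidate, so values are
  closed and convex and a minimal element exists; this guarantees that the choice behind
  \<open>arg_min_on\<close> is meaningful.\<close>

lemma min_section_mem:
  fixes B :: "'h::{real_inner,banach} \<Rightarrow> 'h set"
  assumes B: "maximal_monotone B" and "v \<in> op_dom B"
  shows "min_section B v \<in> B v"
proof -
  have B_mono: "0 \<le> (y - y') \<bullet> (x - x')" if "y \<in> B x" "y' \<in> B x'" for x x' y y'
    using B that unfolding maximal_monotone_def monotone_operator_def by blast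
  have "closed (B v)"
  proof (rule closed_sequential_limits[THEN iffD2, rule_format])
    fix y l assume y: "(\<forall>n. y n \<in> B v) \<and> y \<longlonglongrightarrow> l"
    show "l \<in> B v"
    proof (rule maximal_monotone_mem[OF B])
      fix x' y' assume "y' \<in> B x'"
      then have "\<forall>n\<ge>0. 0 \<le> (y n - y') \<bullet> (v - x')" using B_mono y by blast
      moreover have "(\<lambda>n. (y n - y') \<bullet> (v - x')) \<longlonglongrightarrow> (l - y') \<bullet> (v - x')"
        using y by (intro tendsto_intros) auto
      ultimately show "0 \<le> (l - y') \<bullet> (v - x')" by (meson LIMSEQ_le_const)
    qed
  qed
  moreover have "convex (B v)"
  proof (rule convexI)
    fix y1 y2 and a c :: real assume *: "y1 \<in> B v" "y2 \<in> B v" "0 \<le> a" "0 \<le> c" "a + c = 1"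
    show "a *\<^sub>R y1 + c *\<^sub>R y2 \<in> B v"
    proof (rule maximal_monotone_mem[OF B])
      fix x' y' assume y': "y' \<in> B x'"
      have "a *\<^sub>R y1 + c *\<^sub>R y2 - y' = a *\<^sub>R (y1 - y') + c *\<^sub>R (y2 - y')"
        using *(5) by (simp add: algebra_simps flip: scaleR_add_left)
      then have "(a *\<^sub>R y1 + c *\<^sub>R y2 - y') \<bullet> (v - x') =
          a * ((y1 - y') \<bullet> (v - x')) + c * ((y2 - y') \<bullet> (v - x'))"
        by (simp add: inner_add_left)
      also have "\<dots> \<ge> 0" using * B_mono y' by (intro add_nonneg_nonneg mult_nonneg_nonneg) auto
      finally show "0 \<le> (a *\<^sub>R y1 + c *\<^sub>R y2 - y') \<bullet> (v - x')" .
    qed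
  qed
  moreover have "B v \<noteq> {}" using assms(2) by (simp add: op_dom_def)
  ultimately obtain z where "z \<in> B v" "\<forall>y\<in>B v. norm z \<le> norm y" using ex_min_norm by blast
  then have "\<exists>z. is_arg_min norm (\<lambda>x. x \<in> B v) z" by (auto simp: is_arg_min_def not_less)
  then have "is_arg_min norm (\<lambda>x. x \<in> B v) (min_section B v)"
    unfolding min_section_def arg_min_on_def arg_min_def by (rule someI_ex)
  then show ?thesis by (simp add: is_arg_min_def)
qed

lemma op_dis_leD:
  assumes "op_dis B1 B2 \<le> ereal c" and y: "y \<in> B1 x" and y': "y' \<in> B2 x'"
  shows "(y - y') \<bullet> (x' - x) \<le> c * (1 + norm y + norm y')"
proof -
  have "ereal (((y - y') \<bullet> (x' - x)) / (1 + norm y + norm y')) \<le> op_dis B1 B2"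
    unfolding op_dis_def using y y'
    by (intro SUP_upper2[of "(x, y, x', y')"]) (auto simp: op_dom_def)
  from order_trans[OF this assms(1)]
  have "((y - y') \<bullet> (x' - x)) / (1 + norm y + norm y') \<le> c" by simp
  moreover have "0 < 1 + norm y + norm y'" by (simp add: add_pos_nonneg)
  ultimately show ?thesis by (simp add: pos_divide_le_eq)
qed

text \<open>An interval of positive length is not null. This supplies good times arbitrarily close
  to a prescribed one.\<close>

lemma AE_lebesgue_on_ex:
  assumes "AE s in lebesgue_on {0..b::real}. P s" "c < d" "{c<..<d} \<subseteq> {0..b}"
  obtains s where "s \<in> {c<..<d}" "P s"
proof (rule ccontr)
  assume "\<not> thesis"
  then have none: "\<And>s. s \<in> {c<..<d} \<Longrightarrow> \<not> P s" using that by blast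
  have "AE s in lebesgue. s \<in> {0..b} \<longrightarrow> P s"
    using assms(1) by (subst (asm) AE_restrict_space_iff) auto
  then have "AE s in lebesgue. s \<notin> {c<..<d}"
    by eventually_elim (use none assms(3) in blast)
  then have "{c<..<d} \<in> null_sets lebesgue" by (subst AE_iff_null_sets) auto
  then have "emeasure lebesgue {c<..<d} = 0" by (rule null_setsD1)
  then show False using assms(2) by simp
qed

lemma has_vector_derivative_left_sequence:
  fixes u :: "real \<Rightarrow> 'a::real_normed_vector"
  assumes u: "(u has_vector_derivative u') (at t within S)"
    and s: "s \<longlonglongrightarrow> t" "\<And>n. s n < t" "\<And>n. s n \<in> S"
  shows "(\<lambda>n. (1 / (t - s n)) *\<^sub>R (u t - u (s n))) \<longlonglongrightarrow> u'"
proof -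
  have "((\<lambda>y. (1 / norm (y - t)) *\<^sub>R (u y - (u t + (y - t) *\<^sub>R u'))) \<longlongrightarrow> 0) (at t within S)"
    using u unfolding has_vector_derivative_def has_derivative_within by blast
  moreover have "filterlim s (at t within S) sequentially"
    unfolding filterlim_at using s by (auto intro!: always_eventually simp: less_imp_neq)
  ultimately have "(\<lambda>n. (1 / norm (s n - t)) *\<^sub>R (u (s n) - (u t + (s n - t) *\<^sub>R u'))) \<longlonglongrightarrow> 0"
    by (rule filterlim_compose)
  from tendsto_diff[OF tendsto_const[of u'] this]
  have "(\<lambda>n. u' - (1 / norm (s n - t)) *\<^sub>R (u (s n) - (u t + (s n - t) *\<^sub>R u'))) \<longlonglongrightarrow> u'" by simp
  also have "(\<lambda>n. u' - (1 / norm (s n - t)) *\<^sub>R (u (s n) - (u t + (s n - t) *\<^sub>R u'))) =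
      (\<lambda>n. (1 / (t - s n)) *\<^sub>R (u t - u (s n)))"
  proof
    fix n
    define h where "h = t - s n"
    have h: "0 < h" "norm (s n - t) = h" "s n - t = - h" using s(2)[of n] by (auto simp: h_def)
    have "(1 / h) *\<^sub>R (u (s n) - (u t + (- h) *\<^sub>R u')) = - ((1 / h) *\<^sub>R (u t - u (s n))) + ((1 / h) * h) *\<^sub>R u'"
      by (simp add: scaleR_diff_right scaleR_add_right)
    then show "u' - (1 / norm (s n - t)) *\<^sub>R (u (s n) - (u t + (s n - t) *\<^sub>R u')) =
        (1 / (t - s n)) *\<^sub>R (u t - u (s n))"
      using h by (simp add: h_def[symmetric])
  qed
  finally show ?thesis .
qed

text \<open>Testing the pseudo-distance of the operators at times \<open>t\<close> and \<open>s < t\<close> with the minimal section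
  at time \<open>s\<close>, whose size is controlled, and letting \<open>s \<rightarrow> t\<close> bounds the derivative; this is where
  \<open>L < 1\<close> is needed.\<close>

lemma derivative_bound:
  fixes B :: "real \<Rightarrow> 'h::{real_inner,banach,second_countable_topology} \<Rightarrow> 'k::metric_space \<Rightarrow> 'h \<Rightarrow> 'h set"
  assumes mm: "\<forall>t\<in>{0..b}. \<forall>u \<eta>. maximal_monotone (B t u \<eta>)"
    and L: "0 \<le> L" "L < 1"
    and dis: "\<And>t s u v. t \<in> {0..b} \<Longrightarrow> s \<in> {0..b} \<Longrightarrow>
      op_dis (B t u \<eta>) (B s v \<eta>) \<le> ereal (\<bar>\<theta> t - \<theta> s\<bar> + L * norm (u - v))"
    and M: "0 < M" "\<And>t u v. t \<in> {0..b} \<Longrightarrow> v \<in> op_dom (B t u \<eta>) \<Longrightarrow>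
      norm (min_section (B t u \<eta>) v) \<le> M * (1 + norm u + norm v)"
    and t: "0 < t" "t \<le> b"
    and u': "(u has_vector_derivative u') (at t within {0..b})"
    and \<theta>': "(\<theta> has_vector_derivative \<theta>') (at t within {0..b})"
    and incl: "- u' + g \<in> B t (u t) \<eta> (u t)"
    and dom: "AE s in lebesgue_on {0..b}. u s \<in> op_dom (B s (u s) \<eta>)"
  shows "norm u' \<le> 3 * (1 + norm g + M * (1 + 2 * norm (u t)) + \<bar>\<theta>'\<bar>) / (1 - L)"
proof -
  \<comment> \<open>Membership in the domain is known only for almost every time, so
    \<open>t\<close> is approached through a sequence of good times.\<close>
  have "\<exists>s. max 0 (t - inverse (real (Suc n))) < s \<and> s < t \<and> u s \<in> op_dom (B s (u s) \<eta>)" for n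
    by (rule AE_lebesgue_on_ex[OF dom, of "max 0 (t - inverse (real (Suc n)))" t]) (use t in auto)
  then obtain s where s: "\<And>n. max 0 (t - inverse (real (Suc n))) < s n" "\<And>n. s n < t"
    "\<And>n. u (s n) \<in> op_dom (B (s n) (u (s n)) \<eta>)"
    by metis
  have s_mem: "s n \<in> {0..b}" for n using s(1)[of n] s(2)[of n] t by simp
  have s_lim: "s \<longlonglongrightarrow> t"
  proof (rule tendsto_sandwich)
    show "eventually (\<lambda>n. t - inverse (real (Suc n)) \<le> s n) sequentially"
      using s(1) by (intro always_eventually allI) (simp add: less_imp_le)
    show "eventually (\<lambda>n. s n \<le> t) sequentially"
      using s(2) by (intro always_eventually allI) (simp add: less_imp_le)
    show "(\<lambda>n. t - inverse (real (Suc n))) \<longlonglongrightarrow> t"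
      using tendsto_diff[OF tendsto_const LIMSEQ_inverse_real_of_nat, of t] by simp
  qed simp
  define Du where "Du n = (1 / (t - s n)) *\<^sub>R (u t - u (s n))" for n
  define D\<theta> where "D\<theta> n = (1 / (t - s n)) *\<^sub>R (\<theta> t - \<theta> (s n))" for n
  have Du: "Du \<longlonglongrightarrow> u'" unfolding Du_def
    by (rule has_vector_derivative_left_sequence[OF u' s_lim s(2) s_mem])
  have D\<theta>: "D\<theta> \<longlonglongrightarrow> \<theta>'" unfolding D\<theta>_def
    by (rule has_vector_derivative_left_sequence[OF \<theta>' s_lim s(2) s_mem])
  have "continuous (at t within {0..b}) u"
    using u' by (rule has_vector_derivative_continuous)
  then have u_lim: "(\<lambda>n. u (s n)) \<longlonglongrightarrow> u t"
    using s_mem s_lim unfolding continuous_within_sequentially o_def by blast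
  \<comment> \<open>The factor 2 arises because the state enters both as parameter of the operator
    and as the point where it is evaluated.\<close>
  define K where "K n = M * (1 + 2 * norm (u (s n)))" for n
  define k where "k = M * (1 + 2 * norm (u t))"
  have K: "K \<longlonglongrightarrow> k" unfolding K_def k_def by (intro tendsto_intros u_lim)
  define \<gamma> where "\<gamma> = norm g"
  define p where "p = norm u'"
  have ineq: "u' \<bullet> Du n \<le> (\<gamma> + K n) * norm (Du n) + (1 + (p + \<gamma>) + K n) * (\<bar>D\<theta> n\<bar> + L * norm (Du n))" for n
  proof -
    define h where "h = t - s n"
    have h: "0 < h" using s(2) by (simp add: h_def)
    define \<Delta> where "\<Delta> = u t - u (s n)"
    define y where "y = - u' + g"
    define y' where "y' = min_section (B (s n) (u (s n)) \<eta>) (u (s n))"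
    have y'_mem: "y' \<in> B (s n) (u (s n)) \<eta> (u (s n))"
      unfolding y'_def using mm s_mem s(3) by (intro min_section_mem) auto
    have y'_le: "norm y' \<le> K n"
      using M(2)[OF s_mem s(3)] by (simp add: y'_def K_def algebra_simps)
    have y_mem: "y \<in> B t (u t) \<eta> (u t)" using incl by (simp only: y_def)
    have y_le: "norm y \<le> p + \<gamma>" unfolding y_def p_def \<gamma>_def using norm_triangle_ineq[of "- u'" g] by simp
    define c where "c = \<bar>\<theta> t - \<theta> (s n)\<bar> + L * norm \<Delta>"
    have c0: "0 \<le> c" using L by (simp add: c_def)
    have "(y - y') \<bullet> (u (s n) - u t) \<le> c * (1 + norm y + norm y')"
      unfolding c_def \<Delta>_def using t s_mem by (intro op_dis_leD[OF dis y_mem y'_mem]) auto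
    also have "\<dots> \<le> c * (1 + (p + \<gamma>) + K n)" using c0 y'_le y_le by (intro mult_left_mono) auto
    finally have 1: "(y - y') \<bullet> (u (s n) - u t) \<le> c * (1 + (p + \<gamma>) + K n)" .
    have 2: "(g - y') \<bullet> \<Delta> \<le> (\<gamma> + K n) * norm \<Delta>"
    proof -
      have "(g - y') \<bullet> \<Delta> \<le> norm (g - y') * norm \<Delta>" by (rule norm_cauchy_schwarz)
      also have "norm (g - y') \<le> \<gamma> + K n"
        using norm_triangle_ineq4[of g y'] y'_le by (simp add: \<gamma>_def)
      finally show ?thesis by (simp add: mult_right_mono)
    qed
    \<comment> \<open>Since \<open>u' = g - y\<close>, inserting \<open>y'\<close> splits the
      product into a term controlled by norms and one controlled by the pseudo-distance.\<close>
    have "u' \<bullet> \<Delta> = (g - y') \<bullet> \<Delta> + (y - y') \<bullet> (u (s n) - u t)"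
      by (simp add: y_def \<Delta>_def inner_diff_left inner_diff_right inner_add_left)
    with 1 2 have "u' \<bullet> \<Delta> \<le> (\<gamma> + K n) * norm \<Delta> + c * (1 + (p + \<gamma>) + K n)" by linarith
    then have "(u' \<bullet> \<Delta>) / h \<le> ((\<gamma> + K n) * norm \<Delta> + c * (1 + (p + \<gamma>) + K n)) / h"
      using h by (intro divide_right_mono) auto
    moreover have iDu: "u' \<bullet> Du n = (u' \<bullet> \<Delta>) / h" by (simp add: Du_def h_def \<Delta>_def)
    have nDu: "norm (Du n) = norm \<Delta> / h" using h by (simp add: Du_def h_def \<Delta>_def)
    have nD\<theta>: "\<bar>D\<theta> n\<bar> = \<bar>\<theta> t - \<theta> (s n)\<bar> / h" using h by (simp add: D\<theta>_def h_def abs_mult)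
    moreover have "(\<gamma> + K n) * norm (Du n) + (1 + (p + \<gamma>) + K n) * (\<bar>D\<theta> n\<bar> + L * norm (Du n)) =
        ((\<gamma> + K n) * norm \<Delta> + c * (1 + (p + \<gamma>) + K n)) / h"
      unfolding nDu nD\<theta> c_def using h by (simp add: field_simps)
    ultimately show ?thesis unfolding iDu by simp
  qed
  have "u' \<bullet> u' \<le> (\<gamma> + k) * norm u' + (1 + (p + \<gamma>) + k) * (\<bar>\<theta>'\<bar> + L * norm u')"
  proof (rule LIMSEQ_le)
    show "(\<lambda>n. u' \<bullet> Du n) \<longlonglongrightarrow> u' \<bullet> u'" by (intro tendsto_intros Du)
    show "(\<lambda>n. (\<gamma> + K n) * norm (Du n) + (1 + (p + \<gamma>) + K n) * (\<bar>D\<theta> n\<bar> + L * norm (Du n)))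
        \<longlonglongrightarrow> (\<gamma> + k) * norm u' + (1 + (p + \<gamma>) + k) * (\<bar>\<theta>'\<bar> + L * norm u')"
      by (intro tendsto_intros Du D\<theta> K)
  qed (use ineq in blast)
  then have main: "p * p \<le> (\<gamma> + k) * p + (1 + (p + \<gamma>) + k) * (\<bar>\<theta>'\<bar> + L * p)"
    by (simp add: p_def power2_norm_eq_inner[symmetric] power2_eq_square)
  define Q where "Q = 1 + \<gamma> + k + \<bar>\<theta>'\<bar>"
  have nn: "0 \<le> p" "0 \<le> \<gamma>" "0 \<le> k" using M(1) by (auto simp: p_def \<gamma>_def k_def)
  have Q: "1 \<le> Q" using nn by (simp add: Q_def)
  \<comment> \<open>Moving \<open>L * (p * p)\<close> to the left leaves three groups of terms. Once
    \<open>p\<close> exceeds \<open>Q\<close>, each is at most \<open>Q * p\<close>, whence the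
    factor 3.\<close>
  have "p \<le> 3 * Q / (1 - L)"
  proof (cases "p \<le> Q")
    case True
    have "Q * (1 - L) \<le> Q * 3" using Q L by (intro mult_left_mono) auto
    then have "Q \<le> 3 * Q / (1 - L)" using L by (simp add: pos_le_divide_eq mult.commute)
    with True show ?thesis by linarith
  next
    case False
    have "(1 - L) * (p * p) \<le> (\<gamma> + k + \<bar>\<theta>'\<bar>) * p + L * ((1 + \<gamma> + k) * p) + (1 + \<gamma> + k) * \<bar>\<theta>'\<bar>"
      using main by (simp add: algebra_simps)
    also have "\<dots> \<le> Q * p + Q * p + Q * p"
    proof (intro add_mono)
      show "(\<gamma> + k + \<bar>\<theta>'\<bar>) * p \<le> Q * p" using nn by (intro mult_right_mono) (auto simp: Q_def)
      have "L * ((1 + \<gamma> + k) * p) \<le> 1 * ((1 + \<gamma> + k) * p)" using L nn by (intro mult_right_mono) auto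
      also have "\<dots> \<le> Q * p" unfolding mult_1 using nn by (intro mult_right_mono) (auto simp: Q_def)
      finally show "L * ((1 + \<gamma> + k) * p) \<le> Q * p" .
      have "\<bar>\<theta>'\<bar> \<le> p" using False nn by (simp add: Q_def)
      then show "(1 + \<gamma> + k) * \<bar>\<theta>'\<bar> \<le> Q * p" using nn by (intro mult_mono) (auto simp: Q_def)
    qed
    finally have "((1 - L) * p) * p \<le> (3 * Q) * p" by (simp add: algebra_simps)
    moreover have "0 < p" using False Q by simp
    ultimately have "(1 - L) * p \<le> 3 * Q" by (simp only: mult_le_cancel_right_pos)
    then show ?thesis using L by (simp add: pos_le_divide_eq mult.commute)
  qed
  then show ?thesis by (simp add: p_def Q_def \<gamma>_def k_def)
qed

section \<open>Gronwall's inequality and integrals over subintervals\<close>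

lemma Gronwall:
  fixes \<phi> :: "real \<Rightarrow> real"
  assumes \<phi>: "continuous_on {0..b} \<phi>" and "0 \<le> c"
    and le: "\<And>s. s \<in> {0..b} \<Longrightarrow> \<phi> s \<le> a + c * integral {0..s} \<phi>" and t: "t \<in> {0..b}"
  shows "\<phi> t \<le> a * exp (c * t)"
proof -
  \<comment> \<open>Integrating factor: the derivative of \<open>y\<close> is
    \<open>c * exp (- c * s)\<close> times a difference that the assumed inequality makes
    nonpositive, and \<open>y 0 = a\<close>.\<close>
  define y where "y s = (a + c * integral {0..s} \<phi>) * exp (- c * s)" for s
  have "y 0 \<ge> y t"
  proof (rule DERIV_nonpos_imp_decreasing_open[of 0 t y])
    show "0 \<le> t" using t by simp
    have "continuous_on {0..b} (\<lambda>s. integral {0..s} \<phi>)"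
      using \<phi> by (intro indefinite_integral_continuous_1 integrable_continuous_interval)
    then show "continuous_on {0..t} y"
      unfolding y_def using t by (intro continuous_intros) (auto elim: continuous_on_subset)
    fix s assume s: "0 < s" "s < t"
    have "((\<lambda>s. integral {0..s} \<phi>) has_real_derivative \<phi> s) (at s within {0..b})"
      using integral_has_real_derivative[OF \<phi>, of s] s t by simp
    then have d: "((\<lambda>s. integral {0..s} \<phi>) has_real_derivative \<phi> s) (at s)"
      using s t by (subst (asm) at_within_Icc_at) auto
    have "(y has_real_derivative (c * \<phi> s) * exp (- c * s) +
        (a + c * integral {0..s} \<phi>) * (exp (- c * s) * - c)) (at s)"
      unfolding y_def by (rule derivative_eq_intros d refl | simp)+
    moreover have "(c * \<phi> s) * exp (- c * s) + (a + c * integral {0..s} \<phi>) * (exp (- c * s) * - c) =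
        (c * exp (- c * s)) * (\<phi> s - (a + c * integral {0..s} \<phi>))"
      by (simp add: algebra_simps)
    moreover have "\<dots> \<le> 0"
      using le[of s] s t \<open>0 \<le> c\<close> by (intro mult_nonneg_nonpos) auto
    ultimately show "\<exists>z. (y has_real_derivative z) (at s) \<and> z \<le> 0" by metis
  qed
  then have "(a + c * integral {0..t} \<phi>) * exp (- c * t) \<le> a" by (simp add: y_def)
  then have "(a + c * integral {0..t} \<phi>) * exp (- c * t) * exp (c * t) \<le> a * exp (c * t)"
    by (rule mult_right_mono) simp
  then have "a + c * integral {0..t} \<phi> \<le> a * exp (c * t)"
    by (simp add: mult.assoc flip: exp_add)
  then show ?thesis using le[OF t] by linarith
qed

text \<open>This also covers nonintegrable \<open>f\<close>, whose Bochner integral is 0 by default,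
  so integrands along trajectories can be estimated by a dominating function alone.\<close>

lemma norm_integral_le_AE:
  fixes f :: "'a \<Rightarrow> 'b::{banach,second_countable_topology}"
  assumes h: "integrable M h" and le: "AE x in M. norm (f x) \<le> h x"
  shows "norm (integral\<^sup>L M f) \<le> integral\<^sup>L M h"
proof -
  have "norm (integral\<^sup>L M f) \<le> (LINT x|M. norm (f x))" by (rule integral_norm_bound)
  also have "\<dots> \<le> integral\<^sup>L M h"
  proof (rule integral_mono_AE'[OF h le])
    show "AE x in M. 0 \<le> h x" using le by eventually_elim (rule order_trans[OF norm_ge_zero])
  qed
  finally show ?thesis .
qed

lemma AE_lebesgue_on_subset:
  assumes "AE x in lebesgue_on T. P x" "S \<subseteq> T" "S \<in> sets lebesgue" "T \<in> sets lebesgue"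
  shows "AE x in lebesgue_on S. P x"
proof -
  have "AE x in lebesgue. x \<in> T \<longrightarrow> P x"
    using assms by (subst (asm) AE_restrict_space_iff) auto
  then have "AE x in lebesgue. x \<in> S \<longrightarrow> P x" by eventually_elim (use assms(2) in blast)
  then show ?thesis using assms by (subst AE_restrict_space_iff) auto
qed

lemma integrable_lebesgue_on_iff:
  fixes f :: "real \<Rightarrow> 'b::{banach,second_countable_topology}"
  assumes "S \<in> sets lebesgue"
  shows "integrable (lebesgue_on S) f \<longleftrightarrow> set_integrable lebesgue S f"
  unfolding set_integrable_def using assms by (intro integrable_restrict_space) simp

lemma integral_lebesgue_on_eq:
  fixes f :: "real \<Rightarrow> 'b::{banach,second_countable_topology}"
  assumes "S \<in> sets lebesgue"
  shows "integral\<^sup>L (lebesgue_on S) f = set_lebesgue_integral lebesgue S f"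
  unfolding set_lebesgue_integral_def using assms by (intro integral_restrict_space) simp

lemma integrable_lebesgue_on_subset:
  fixes f :: "real \<Rightarrow> 'b::{banach,second_countable_topology}"
  assumes "integrable (lebesgue_on T) f" "S \<subseteq> T" "S \<in> sets lebesgue" "T \<in> sets lebesgue"
  shows "integrable (lebesgue_on S) f"
  using assms set_integrable_subset[of lebesgue T f S] by (simp add: integrable_lebesgue_on_iff)

lemma integral_lebesgue_on_mono_set:
  fixes f :: "real \<Rightarrow> real"
  assumes f: "integrable (lebesgue_on T) f" and "S \<subseteq> T" "S \<in> sets lebesgue" "T \<in> sets lebesgue"
    and "\<And>x. 0 \<le> f x"
  shows "integral\<^sup>L (lebesgue_on S) f \<le> integral\<^sup>L (lebesgue_on T) f"
proof -
  have "set_integrable lebesgue S f" "set_integrable lebesgue T f"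
    using integrable_lebesgue_on_subset[OF assms(1-4)] f assms by (simp_all add: integrable_lebesgue_on_iff)
  then have "set_lebesgue_integral lebesgue S f \<le> set_lebesgue_integral lebesgue T f"
    unfolding set_lebesgue_integral_def set_integrable_def
    by (rule integral_mono) (use assms in \<open>auto simp: indicator_def\<close>)
  then show ?thesis using assms by (simp add: integral_lebesgue_on_eq)
qed

lemma integral_lebesgue_on_split:
  fixes f :: "real \<Rightarrow> 'b::{banach,second_countable_topology}"
  assumes f: "integrable (lebesgue_on {0..b}) f" and c: "0 \<le> c" "c \<le> b"
  shows "integral\<^sup>L (lebesgue_on {0..b}) f =
    integral\<^sup>L (lebesgue_on {0..c}) f + integral\<^sup>L (lebesgue_on {c<..b}) f"
proof -
  have "set_integrable lebesgue {0..c} f" "set_integrable lebesgue {c<..b} f"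
    using f c by (auto simp: integrable_lebesgue_on_iff elim!: set_integrable_subset)
  moreover have "{0..b} = {0..c} \<union> {c<..b}" "{0..c} \<inter> {c<..b} = {}" using c by auto
  ultimately show ?thesis
    using set_integral_Un[of "{0..c}" "{c<..b}" lebesgue f] by (simp add: integral_lebesgue_on_eq)
qed

lemma indefinite_integral_continuous_on:
  fixes v :: "real \<Rightarrow> 'b::{banach,second_countable_topology}"
  assumes v: "integrable (lebesgue_on {0..b}) v"
  shows "continuous_on {0..b} (\<lambda>t. integral\<^sup>L (lebesgue_on {0..t}) v)"
proof (rule continuous_on_sequentiallyI)
  fix s t assume s: "\<forall>n. s n \<in> {0..b}" and t: "t \<in> {0..b}" and lim: "s \<longlonglongrightarrow> t"
  have vb: "integrable lebesgue (\<lambda>x. indicator {0..b} x *\<^sub>R v x)"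
    using v by (simp add: integrable_lebesgue_on_iff set_integrable_def)
  have int: "integrable lebesgue (\<lambda>x. indicator {0..r} x *\<^sub>R v x)" if "r \<in> {0..b}" for r
    using integrable_lebesgue_on_subset[OF v, of "{0..r}"] that
    by (simp add: integrable_lebesgue_on_iff set_integrable_def)
  have "(\<lambda>n. LINT x|lebesgue. indicator {0..s n} x *\<^sub>R v x) \<longlonglongrightarrow> (LINT x|lebesgue. indicator {0..t} x *\<^sub>R v x)"
  proof (rule integral_dominated_convergence)
    show "integrable lebesgue (\<lambda>x. norm (indicator {0..b} x *\<^sub>R v x))" using vb by (rule integrable_norm)
    show "AE x in lebesgue. norm (indicator {0..s n} x *\<^sub>R v x) \<le> norm (indicator {0..b} x *\<^sub>R v x)" for n
      using s by (intro AE_I2) (auto simp: indicator_def intro: order_trans)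
    \<comment> \<open>At the endpoint itself the indicators may oscillate when \<open>s n\<close>
      approaches \<open>t\<close> from both sides.\<close>
    have "{t} \<in> null_sets lebesgue" by simp
    then have "AE x in lebesgue. x \<notin> {t}" by (rule AE_not_in)
    then show "AE x in lebesgue. (\<lambda>n. indicator {0..s n} x *\<^sub>R v x) \<longlonglongrightarrow> indicator {0..t} x *\<^sub>R v x"
    proof eventually_elim
      case (elim x)
      then consider "x < t" | "t < x" by fastforce
      then have "eventually (\<lambda>n. indicator {0..s n} x *\<^sub>R v x = indicator {0..t} x *\<^sub>R v x) sequentially"
      proof cases
        case 1
        show ?thesis using order_tendstoD(1)[OF lim 1] by eventually_elim (use 1 in \<open>simp add: indicator_def\<close>)
      next
        case 2
        show ?thesis using order_tendstoD(2)[OF lim 2] by eventually_elim (use 2 in \<open>simp add: indicator_def\<close>)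
      qed
      then show ?case by (rule tendsto_eventually)
    qed
  qed (use int s t in \<open>auto intro: borel_measurable_integrable\<close>)
  then show "(\<lambda>n. integral\<^sup>L (lebesgue_on {0..s n}) v) \<longlonglongrightarrow> integral\<^sup>L (lebesgue_on {0..t}) v"
    by (simp add: integral_lebesgue_on_eq set_lebesgue_integral_def)
qed

lemma has_W12_derivative_continuous_on:
  assumes "has_W12_derivative b u v" "integrable (lebesgue_on {0..b}) v"
  shows "continuous_on {0..b} u"
proof -
  have "continuous_on {0..b} (\<lambda>t. u 0 + integral\<^sup>L (lebesgue_on {0..t}) v)"
    by (intro continuous_intros indefinite_integral_continuous_on assms(2))
  moreover have "u t = u 0 + integral\<^sup>L (lebesgue_on {0..t}) v" if "t \<in> {0..b}" for t
    using assms(1) that unfolding has_W12_derivative_def by blast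
  ultimately show ?thesis by (metis (no_types, lifting) continuous_on_eq)
qed

section \<open>Strongly continuous and compact semigroups\<close>

lemma C0_semigroup_add:
  "C0_semigroup T \<Longrightarrow> 0 \<le> s \<Longrightarrow> 0 \<le> t \<Longrightarrow> T (s + t) = T s o\<^sub>L T t"
  by (simp add: C0_semigroup_def)

text \<open>Only right continuity at 0 is postulated. For \<open>s < t\<close> the difference is
  \<open>T s\<close> applied to \<open>T (t - s) x - x\<close>, so the uniform bound spreads it over
  the interval, from both sides and uniformly.\<close>

lemma C0_semigroup_strongly_continuous:
  fixes T :: "real \<Rightarrow> 'e::real_normed_vector \<Rightarrow>\<^sub>L 'e"
  assumes T: "C0_semigroup T" and M: "0 < M" "\<And>t. t \<in> {0..b} \<Longrightarrow> norm (T t) \<le> M"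
  shows "continuous_on {0..b} (\<lambda>t. T t x)"
proof -
  have "\<exists>d>0. \<forall>t\<in>{0..b}. \<forall>s\<in>{0..b}. dist s t < d \<longrightarrow> dist (T s x) (T t x) < e" if "0 < e" for e
  proof -
    have "((\<lambda>t. T t x) \<longlongrightarrow> x) (at_right 0)" using T by (simp add: C0_semigroup_def)
    then have "eventually (\<lambda>h. dist (T h x) x < e / M) (at_right 0)"
      using M(1) \<open>0 < e\<close> by (intro tendstoD) auto
    then obtain d where d: "0 < d" "\<And>h. 0 < h \<Longrightarrow> h < d \<Longrightarrow> dist (T h x) x < e / M"
      unfolding eventually_at_right_field by auto
    have *: "dist (T s x) (T t x) < e" if "s \<in> {0..b}" "t \<in> {0..b}" "s < t" "t - s < d" for s t
    proof -
      have "T (s + (t - s)) = T s o\<^sub>L T (t - s)" using that by (intro C0_semigroup_add[OF T]) auto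
      then have "T t x - T s x = T s (T (t - s) x - x)" by (simp add: blinfun.diff_right)
      then have "norm (T t x - T s x) \<le> norm (T s) * norm (T (t - s) x - x)"
        using norm_blinfun by metis
      also have "\<dots> \<le> M * norm (T (t - s) x - x)" using M(2)[OF that(1)] by (intro mult_right_mono) auto
      also have "\<dots> < M * (e / M)"
        using d(2)[of "t - s"] that M(1) by (intro mult_strict_left_mono) (auto simp: dist_norm)
      finally show ?thesis using M(1) by (simp add: dist_norm norm_minus_commute)
    qed
    have "dist (T s x) (T t x) < e" if "t \<in> {0..b}" "s \<in> {0..b}" "dist s t < d" for s t
    proof (cases s t rule: linorder_cases)
      case less
      then show ?thesis using *[OF that(2,1) less] that(3) by (simp add: dist_real_def)
    next
      case equal
      then show ?thesis using \<open>0 < e\<close> by simp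
    next
      case greater
      then show ?thesis using *[OF that(1,2) greater] that(3) by (simp add: dist_real_def dist_commute)
    qed
    then show ?thesis using d(1) by blast
  qed
  then have "uniformly_continuous_on {0..b} (\<lambda>t. T t x)" unfolding uniformly_continuous_on_def by blast
  then show ?thesis by (rule uniformly_continuous_imp_continuous)
qed

text \<open>Measurability is the issue: strong continuity and the uniform bound make
  \<open>T t x\<close> jointly continuous in \<open>t\<close> and \<open>x\<close>, and this is
  composed with \<open>s \<mapsto> (s, h s)\<close>.\<close>

lemma semigroup_integrand_integrable:
  fixes T :: "real \<Rightarrow> 'e::{banach,second_countable_topology} \<Rightarrow>\<^sub>L 'e"
  assumes T: "C0_semigroup T" and M: "0 < M" "\<And>t. t \<in> {0..b} \<Longrightarrow> norm (T t) \<le> M"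
    and c: "0 \<le> c" "c \<le> b" and h: "integrable (lebesgue_on {0..c}) h"
  shows "integrable (lebesgue_on {0..c}) (\<lambda>s. T (c - s) (h s))"
proof (rule Bochner_Integration.integrable_bound)
  show "integrable (lebesgue_on {0..c}) (\<lambda>s. M * norm (h s))" using h by simp
  show "AE s in lebesgue_on {0..c}. norm (T (c - s) (h s)) \<le> norm (M * norm (h s))"
  proof (rule AE_I2)
    fix s assume "s \<in> space (lebesgue_on {0..c})"
    then have "norm (T (c - s)) \<le> M" using c by (intro M(2)) auto
    then have "norm (T (c - s)) * norm (h s) \<le> M * norm (h s)" by (intro mult_right_mono) auto
    then show "norm (T (c - s) (h s)) \<le> norm (M * norm (h s))"
      using norm_blinfun[of "T (c - s)" "h s"] by simp
  qed
  \<comment> \<open>Clipping extends \<open>c - s\<close> continuously to the whole line with values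
    in \<open>{0..b}\<close>, where the bound on \<open>T\<close> is available.\<close>
  define clip where "clip s = min b (max 0 (c - s))" for s
  have clip: "clip s \<in> {0..b}" for s using c by (auto simp: clip_def)
  have "continuous_on UNIV (\<lambda>(s, x). T (clip s) x)"
  proof (rule continuous_on_sequentiallyI)
    fix z :: "nat \<Rightarrow> real \<times> 'e" and a assume z: "z \<longlonglongrightarrow> a"
    obtain s x where a: "a = (s, x)" by (cases a)
    have s: "(\<lambda>n. fst (z n)) \<longlonglongrightarrow> s" and x: "(\<lambda>n. snd (z n)) \<longlonglongrightarrow> x"
      using tendsto_fst[OF z] tendsto_snd[OF z] a by auto
    have cont: "continuous_on {0..b} (\<lambda>t. T t x)"
      by (rule C0_semigroup_strongly_continuous[OF T M])
    have lim: "(\<lambda>n. clip (fst (z n))) \<longlonglongrightarrow> clip s" unfolding clip_def by (intro tendsto_intros s)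
    have 1: "(\<lambda>n. T (clip (fst (z n))) x) \<longlonglongrightarrow> T (clip s) x"
      using continuous_on_tendsto_compose[OF cont lim clip] clip by simp
    have "(\<lambda>n. snd (z n) - x) \<longlonglongrightarrow> 0" using x by (simp add: LIM_zero_iff)
    from tendsto_mult_right_zero[OF tendsto_norm_zero[OF this], of M]
    have "(\<lambda>n. T (clip (fst (z n))) (snd (z n) - x)) \<longlonglongrightarrow> 0"
    proof (rule Lim_null_comparison[OF always_eventually, rotated], intro allI)
      fix n
      have "norm (T (clip (fst (z n))) (snd (z n) - x)) \<le> norm (T (clip (fst (z n)))) * norm (snd (z n) - x)"
        by (rule norm_blinfun)
      also have "\<dots> \<le> M * norm (snd (z n) - x)" using M(2)[OF clip] by (rule mult_right_mono) simp
      finally show "norm (T (clip (fst (z n))) (snd (z n) - x)) \<le> M * norm (snd (z n) - x)" .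
    qed
    from tendsto_add[OF 1 this] show "(\<lambda>n. case z n of (s, x) \<Rightarrow> T (clip s) x) \<longlonglongrightarrow> (case a of (s, x) \<Rightarrow> T (clip s) x)"
      by (simp add: a blinfun.diff_right case_prod_beta)
  qed
  moreover have "(\<lambda>s. (s, h s)) \<in> borel_measurable (lebesgue_on {0..c})"
  proof (rule borel_measurable_Pair)
    show "(\<lambda>s. s) \<in> borel_measurable (lebesgue_on {0..c})"
      by (intro measurable_restrict_space1 measurable_completion) simp
    show "h \<in> borel_measurable (lebesgue_on {0..c})" using h by (rule borel_measurable_integrable)
  qed
  ultimately have "(\<lambda>s. case (s, h s) of (s, x) \<Rightarrow> T (clip s) x) \<in> borel_measurable (lebesgue_on {0..c})"
    by (rule borel_measurable_continuous_on)
  also have "?this \<longleftrightarrow> (\<lambda>s. T (c - s) (h s)) \<in> borel_measurable (lebesgue_on {0..c})"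
  proof (rule measurable_cong)
    fix s assume "s \<in> space (lebesgue_on {0..c})"
    then have "clip s = c - s" using c by (auto simp: clip_def)
    then show "(case (s, h s) of (s, x) \<Rightarrow> T (clip s) x) = T (c - s) (h s)" by simp
  qed
  finally show "(\<lambda>s. T (c - s) (h s)) \<in> borel_measurable (lebesgue_on {0..c})" .
qed

text \<open>Total boundedness survives approximation; the compact set may change with the
  precision.\<close>

lemma compact_closure_if_approximable:
  fixes K :: "'a::complete_space set"
  assumes "\<And>e. 0 < e \<Longrightarrow> \<exists>C. compact C \<and> (\<forall>x\<in>K. \<exists>y\<in>C. dist x y < e)"
  shows "compact (closure K)"
  unfolding compact_eq_totally_bounded
proof (intro conjI allI impI)
  show "complete (closure K)" by (simp add: complete_eq_closed)
  fix e :: real assume "0 < e"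
  then obtain C where C: "compact C" "\<And>x. x \<in> K \<Longrightarrow> \<exists>y\<in>C. dist x y < e / 4"
    using assms[of "e / 4"] by auto
  obtain k where k: "finite k" "C \<subseteq> (\<Union>x\<in>k. ball x (e / 4))"
    using C(1) \<open>0 < e\<close> unfolding compact_eq_totally_bounded by (meson zero_less_divide_iff zero_less_numeral)
  have "closure K \<subseteq> (\<Union>x\<in>k. ball x e)"
  proof
    fix z assume "z \<in> closure K"
    then obtain x where x: "x \<in> K" "dist x z < e / 4"
      using \<open>0 < e\<close> unfolding closure_approachable by (meson zero_less_divide_iff zero_less_numeral)
    obtain y where y: "y \<in> C" "dist x y < e / 4" using C(2)[OF x(1)] by blast
    obtain v where v: "v \<in> k" "dist v y < e / 4" using k(2) y(1) by auto
    have "dist v z \<le> dist v y + dist x y + dist x z"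
      using dist_triangle[of v z y] dist_triangle[of y z x] by (simp add: dist_commute)
    also have "\<dots> < e" using x y v \<open>0 < e\<close> by linarith
    finally show "z \<in> (\<Union>x\<in>k. ball x e)" using v(1) by auto
  qed
  then show "\<exists>k. finite k \<and> closure K \<subseteq> (\<Union>x\<in>k. ball x e)" using k(1) by blast
qed

text \<open>The integral over \<open>{0..c}\<close> equals \<open>T (b - c)\<close> applied to a
  vector of bounded norm, hence lies in a compact set; the rest is at most \<open>M\<close> times
  the integral of \<psi> over \<open>{c<..b}\<close>. As \<psi> dominates all \<open>h\<close>, one
  \<open>c\<close> serves the whole family.\<close>

lemma semigroup_convolution_compact:
  fixes T :: "real \<Rightarrow> 'e::{banach,second_countable_topology} \<Rightarrow>\<^sub>L 'e"
  assumes "0 < b" and T: "C0_semigroup T" and comp: "\<And>t. 0 < t \<Longrightarrow> compact_operator (T t)"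
    and M: "0 < M" "\<And>t. t \<in> {0..b} \<Longrightarrow> norm (T t) \<le> M"
    and \<psi>: "integrable (lebesgue_on {0..b}) \<psi>" "\<And>s. 0 \<le> \<psi> s"
  shows "compact (closure {(LINT s|lebesgue_on {0..b}. T (b - s) (h s)) | h.
    integrable (lebesgue_on {0..b}) h \<and> (AE s in lebesgue_on {0..b}. norm (h s) \<le> \<psi> s)})"
proof (rule compact_closure_if_approximable)
  fix e :: real assume "0 < e"
  let ?I = "\<lambda>t. integral\<^sup>L (lebesgue_on {0..t}) \<psi>"
  have "continuous (at b within {0..b}) ?I"
    using indefinite_integral_continuous_on[OF \<psi>(1)] \<open>0 < b\<close>
    unfolding continuous_on_eq_continuous_within by simp
  moreover have "0 < e / M" using \<open>0 < e\<close> M(1) by simp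
  ultimately obtain d where d: "0 < d" "\<And>c. c \<in> {0..b} \<Longrightarrow> dist c b < d \<Longrightarrow> dist (?I c) (?I b) < e / M"
    unfolding continuous_within_eps_delta by blast
  \<comment> \<open>Positive, strictly below \<open>b\<close> so that \<open>T (b - c)\<close> is
    compact, and within \<open>d\<close> of \<open>b\<close>.\<close>
  define c where "c = max (b / 2) (b - d / 2)"
  have c: "0 < c" "c < b" "dist c b < d" using d(1) \<open>0 < b\<close> by (auto simp: c_def dist_real_def)
  then have Ic: "\<bar>?I c - ?I b\<bar> < e / M" using d(2)[of c] by (simp add: dist_real_def)
  have \<psi>_split: "?I b = ?I c + integral\<^sup>L (lebesgue_on {c<..b}) \<psi>"
    using c by (intro integral_lebesgue_on_split[OF \<psi>(1)]) auto
  have C: "compact (closure (blinfun_apply (T (b - c)) ` cball 0 (M * ?I c)))"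
    using comp[of "b - c"] c unfolding compact_operator_def by auto
  have near: "\<exists>y\<in>closure (blinfun_apply (T (b - c)) ` cball 0 (M * ?I c)).
      dist (LINT s|lebesgue_on {0..b}. T (b - s) (h s)) y < e"
    if h: "integrable (lebesgue_on {0..b}) h" "AE s in lebesgue_on {0..b}. norm (h s) \<le> \<psi> s" for h
  proof -
    have T_le: "norm (T t x) \<le> M * norm x" if "t \<in> {0..b}" for t x
    proof -
      have "norm (T t x) \<le> norm (T t) * norm x" by (rule norm_blinfun)
      also have "\<dots> \<le> M * norm x" using M(2)[OF that] by (rule mult_right_mono) simp
      finally show ?thesis .
    qed
    have hc: "integrable (lebesgue_on {0..c}) h" "AE s in lebesgue_on {0..c}. norm (h s) \<le> \<psi> s"
      "integrable (lebesgue_on {0..c}) \<psi>"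
      using c by (auto intro: integrable_lebesgue_on_subset[OF h(1)] AE_lebesgue_on_subset[OF h(2)]
          integrable_lebesgue_on_subset[OF \<psi>(1)])
    have hr: "AE s in lebesgue_on {c<..b}. norm (h s) \<le> \<psi> s" "integrable (lebesgue_on {c<..b}) \<psi>"
      using c by (auto intro: AE_lebesgue_on_subset[OF h(2)] integrable_lebesgue_on_subset[OF \<psi>(1)])
    have Th: "integrable (lebesgue_on {0..b}) (\<lambda>s. T (b - s) (h s))"
      using \<open>0 < b\<close> by (intro semigroup_integrand_integrable[OF T M _ _ h(1)]) auto
    have Thc: "integrable (lebesgue_on {0..c}) (\<lambda>s. T (c - s) (h s))"
      using c by (intro semigroup_integrand_integrable[OF T M _ _ hc(1)]) auto
    define v where "v = (LINT s|lebesgue_on {0..c}. T (c - s) (h s))"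
    have "norm v \<le> (LINT s|lebesgue_on {0..c}. M * \<psi> s)"
      unfolding v_def
    proof (rule norm_integral_le_AE)
      show "integrable (lebesgue_on {0..c}) (\<lambda>s. M * \<psi> s)" using hc(3) by simp
      show "AE s in lebesgue_on {0..c}. norm (T (c - s) (h s)) \<le> M * \<psi> s"
        using hc(2) AE_space
      proof eventually_elim
        case (elim s)
        then have "norm (T (c - s) (h s)) \<le> M * norm (h s)" using c by (intro T_le) auto
        also have "\<dots> \<le> M * \<psi> s" using elim M(1) by simp
        finally show ?case .
      qed
    qed
    then have v: "norm v \<le> M * ?I c" by simp
    have "(LINT s|lebesgue_on {0..c}. T (b - s) (h s)) = (LINT s|lebesgue_on {0..c}. T (b - c) (T (c - s) (h s)))"
    proof (rule Bochner_Integration.integral_cong[OF refl])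
      fix s assume "s \<in> space (lebesgue_on {0..c})"
      then have "T ((b - c) + (c - s)) = T (b - c) o\<^sub>L T (c - s)"
        using c by (intro C0_semigroup_add[OF T]) auto
      then show "T (b - s) (h s) = T (b - c) (T (c - s) (h s))" by simp
    qed
    also have "\<dots> = T (b - c) v"
      unfolding v_def by (rule integral_bounded_linear[OF blinfun.bounded_linear_right Thc])
    finally have "(LINT s|lebesgue_on {0..b}. T (b - s) (h s)) =
        T (b - c) v + (LINT s|lebesgue_on {c<..b}. T (b - s) (h s))"
      using integral_lebesgue_on_split[OF Th, of c] c by simp
    moreover have "norm (LINT s|lebesgue_on {c<..b}. T (b - s) (h s)) \<le> (LINT s|lebesgue_on {c<..b}. M * \<psi> s)"
    proof (rule norm_integral_le_AE)
      show "integrable (lebesgue_on {c<..b}) (\<lambda>s. M * \<psi> s)" using hr(2) by simp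
      show "AE s in lebesgue_on {c<..b}. norm (T (b - s) (h s)) \<le> M * \<psi> s"
        using hr(1) AE_space
      proof eventually_elim
        case (elim s)
        then have "norm (T (b - s) (h s)) \<le> M * norm (h s)" using c by (intro T_le) auto
        also have "\<dots> \<le> M * \<psi> s" using elim M(1) by simp
        finally show ?case .
      qed
    qed
    moreover have "(LINT s|lebesgue_on {c<..b}. M * \<psi> s) < e"
    proof -
      have "integral\<^sup>L (lebesgue_on {c<..b}) \<psi> < e / M" using Ic \<psi>_split by simp
      then show ?thesis using M(1) by (simp add: pos_less_divide_eq mult.commute)
    qed
    ultimately have "dist (LINT s|lebesgue_on {0..b}. T (b - s) (h s)) (T (b - c) v) < e"
      by (simp add: dist_norm)
    moreover have "T (b - c) v \<in> closure (blinfun_apply (T (b - c)) ` cball 0 (M * ?I c))"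
      using v by (intro closure_subset[THEN subsetD] imageI) simp
    ultimately show ?thesis by blast
  qed
  show "\<exists>C. compact C \<and> (\<forall>x\<in>{(LINT s|lebesgue_on {0..b}. T (b - s) (h s)) | h.
    integrable (lebesgue_on {0..b}) h \<and> (AE s in lebesgue_on {0..b}. norm (h s) \<le> \<psi> s)}. \<exists>y\<in>C. dist x y < e)"
    by (rule exI, rule conjI[OF C]) (use near in blast)
qed

section \<open>The common bound on all mild solutions\<close>

lemma set_normD: "set_norm S \<le> ereal c \<Longrightarrow> s \<in> S \<Longrightarrow> norm s \<le> c"
  by (auto simp: set_norm_def SUP_le_iff)

text \<open>The two equations are coupled, so the sum of both norms is estimated: the mild formula
  bounds \<open>x\<close> and the derivative estimate bounds \<open>u\<close>, each by an integral
  linear in this sum, and Gronwall closes the loop.\<close>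

lemma mild_solution_bound:
  fixes T :: "'l::metric_space \<Rightarrow> real \<Rightarrow> 'e::{real_inner,banach,second_countable_topology} \<Rightarrow>\<^sub>L 'e"
    and B :: "real \<Rightarrow> 'h::{real_inner,banach,second_countable_topology} \<Rightarrow> 'k::metric_space \<Rightarrow> 'h \<Rightarrow> 'h set"
    and BB :: "'y::{real_inner,banach,second_countable_topology} \<Rightarrow>\<^sub>L 'e"
  assumes "0 < b" and mm: "\<forall>t\<in>{0..b}. \<forall>u \<eta>. maximal_monotone (B t u \<eta>)"
    and A: "hyp_A b DA A T" and B: "hyp_B b B" and F: "hyp_F b F" and G: "hyp_G b G" and w: "w \<in> L2 b"
  shows "\<exists>R>0. \<forall>(x, u)\<in>mild_solutions b T B F G BB x0 u0 \<zeta> \<eta> w. \<forall>t\<in>{0..b}.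
    norm (x t) \<le> R \<and> norm (u t) \<le> R"
proof -
  let ?M = "lebesgue_on {0..b}"
  have bdd: "bounded {\<zeta>}" "bounded {\<eta>}" by simp_all
  have T: "C0_semigroup (T \<zeta>)" using A by (simp add: hyp_A_def generates_def)
  obtain MT where MT: "0 < MT" "\<And>t. t \<in> {0..b} \<Longrightarrow> norm (T \<zeta> t) \<le> MT"
    using A bdd(1) unfolding hyp_A_def by (metis insertI1)
  obtain MF where MF: "0 < MF" "AE t in ?M. \<forall>x u. \<forall>\<zeta>\<in>{\<zeta>}. set_norm (F t x u \<zeta>) \<le> ereal (MF * (1 + norm x + norm u))"
    using F bdd(1) unfolding hyp_F_def by meson
  obtain MG where MG: "0 < MG" "AE t in ?M. \<forall>x u. \<forall>\<eta>\<in>{\<eta>}. set_norm (G t x u \<eta>) \<le> ereal (MG * (1 + norm x + norm u))"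
    using G bdd(2) unfolding hyp_G_def by meson
  obtain MB where MB: "0 < MB" "\<And>t u v. t \<in> {0..b} \<Longrightarrow> v \<in> op_dom (B t u \<eta>) \<Longrightarrow>
      norm (min_section (B t u \<eta>) v) \<le> MB * (1 + norm u + norm v)"
    using B unfolding hyp_B_def by meson
  obtain \<theta> L L' where \<theta>: "\<theta> \<in> W12 b" and L: "0 \<le> L" "L < 1" and dis0:
    "\<And>t s u v \<eta>1 \<eta>2. t \<in> {0..b} \<Longrightarrow> s \<in> {0..b} \<Longrightarrow> op_dis (B t u \<eta>1) (B s v \<eta>2) \<le>
             ereal (\<bar>\<theta> t - \<theta> s\<bar> + L * norm (u - v) + L' * dist \<eta>1 \<eta>2)"
    using B unfolding hyp_B_def by meson
  have dis: "op_dis (B t u \<eta>) (B s v \<eta>) \<le> ereal (\<bar>\<theta> t - \<theta> s\<bar> + L * norm (u - v))"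
    if "t \<in> {0..b}" "s \<in> {0..b}" for t s u v
    using dis0[OF that, of u \<eta> v \<eta>] by simp
  obtain \<theta>' where \<theta>': "has_W12_derivative b \<theta> \<theta>'" using \<theta> by (auto simp: W12_def)
  have \<theta>'_int: "integrable ?M \<theta>'" using \<theta>' by (intro L2_imp_integrable) (simp add: has_W12_derivative_def)
  have \<theta>'_der: "AE t in ?M. (\<theta> has_vector_derivative \<theta>' t) (at t within {0..b})"
    using \<theta>' by (simp add: has_W12_derivative_def)
  have w_int: "integrable ?M w" using w by (rule L2_imp_integrable)
  define C where "C = 3 / (1 - L)"
  have C: "0 < C" using L by (simp add: C_def)
  define c1 where "c1 = MT * MF"
  define c2 where "c2 = C * (MG + 2 * MB)"
  define c where "c = c1 + c2"
  have c: "0 < c1" "0 < c2" "0 < c" using MT(1) MF(1) C MG(1) MB(1)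
    by (auto simp: c1_def c2_def c_def intro!: add_pos_pos mult_pos_pos)
  define a1 where "a1 s = MT * norm BB * norm (w s)" for s
  \<comment> \<open>\<open>a1\<close> and \<open>a2\<close> collect the contributions of the control
    and of \<theta>. Adding \<open>c\<close>, the constant part of the growth terms, and integrating
    over the whole interval yields a constant admissible in Gronwall's inequality.\<close>
  define a2 where "a2 s = C + C * norm (\<theta>' s)" for s
  define as where "as s = a1 s + a2 s + c" for s
  have a_int: "integrable ?M a1" "integrable ?M a2" "integrable ?M as"
    using w_int \<theta>'_int unfolding a1_def a2_def as_def by simp_all
  have as_nonneg: "0 \<le> as s" for s using C c MT by (simp add: as_def a1_def a2_def)
  define a where "a = MT * norm (x0 \<zeta>) + norm (u0 \<eta>) + integral\<^sup>L ?M as"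
  have a_nonneg: "0 \<le> a" using MT as_nonneg by (simp add: a_def)
  have bound: "norm (x t) + norm (u t) \<le> a * exp (c * b)"
    if sol: "(x, u) \<in> mild_solutions b T B F G BB x0 u0 \<zeta> \<eta> w" and t: "t \<in> {0..b}" for x u t
  proof -
    obtain u' f g where x: "continuous_on {0..b} x" and u0: "u 0 = u0 \<eta>" and u: "has_W12_derivative b u u'"
      and f: "integrable ?M f"
      and incl: "AE t in ?M. f t \<in> F t (x t) (u t) \<zeta> \<and> g t \<in> G t (x t) (u t) \<eta> \<and>
              - u' t + g t \<in> B t (u t) \<eta> (u t)"
      and mild: "\<And>t. t \<in> {0..b} \<Longrightarrow> x t = T \<zeta> t (x0 \<zeta>) +
              (LINT s|lebesgue_on {0..t}. T \<zeta> (t - s) (f s + BB (w s)))"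
      using sol unfolding mild_solutions_def by blast
    have u'_int: "integrable ?M u'" using u by (intro L2_imp_integrable) (simp add: has_W12_derivative_def)
    have u_cont: "continuous_on {0..b} u" by (rule has_W12_derivative_continuous_on[OF u u'_int])
    have u_eq: "u t = u 0 + integral\<^sup>L (lebesgue_on {0..t}) u'" if "t \<in> {0..b}" for t
      using u that unfolding has_W12_derivative_def by blast
    define \<phi> where "\<phi> s = norm (x s) + norm (u s)" for s
    have \<phi>_cont: "continuous_on {0..b} \<phi>" unfolding \<phi>_def by (intro continuous_intros x u_cont)
    have \<phi>_int: "integrable ?M \<phi>"
      using \<phi>_cont by (intro continuous_imp_integrable_real)
    have f_le: "AE s in ?M. norm (f s + BB (w s)) \<le> MF * (1 + \<phi> s) + norm BB * norm (w s)"
      using incl MF(2)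
    proof eventually_elim
      case (elim s)
      then have "norm (f s) \<le> MF * (1 + norm (x s) + norm (u s))" by (intro set_normD) auto
      moreover have "norm (BB (w s)) \<le> norm BB * norm (w s)" by (rule norm_blinfun)
      ultimately show ?case using norm_triangle_ineq[of "f s" "BB (w s)"] by (simp add: \<phi>_def add.assoc)
    qed
    have dom: "AE s in ?M. u s \<in> op_dom (B s (u s) \<eta>)"
      using incl by eventually_elim (auto simp: op_dom_def)
    have u_der: "AE s in ?M. (u has_vector_derivative u' s) (at s within {0..b})"
      using u by (simp add: has_W12_derivative_def)
    \<comment> \<open>Time 0 is discarded because the derivative estimate approaches a time from the
      left.\<close>
    have "{0} \<in> null_sets lebesgue" by simp
    then have "AE s in lebesgue. s \<in> {0..b} \<longrightarrow> s \<noteq> 0"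
      by (rule AE_not_in[THEN eventually_mono]) auto
    then have not0: "AE s in ?M. s \<noteq> 0" by (subst AE_restrict_space_iff) auto
    have u'_le: "AE s in ?M. norm (u' s) \<le> c2 * (1 + \<phi> s) + a2 s"
      using incl MG(2) u_der \<theta>'_der not0 AE_space
    proof eventually_elim
      case (elim s)
      then have s: "0 < s" "s \<le> b" by auto
      have "norm (g s) \<le> MG * (1 + norm (x s) + norm (u s))" using elim by (intro set_normD) auto
      then have g: "norm (g s) \<le> MG * (1 + \<phi> s)" by (simp add: \<phi>_def add.assoc)
      have "norm (u' s) \<le> 3 * (1 + norm (g s) + MB * (1 + 2 * norm (u s)) + \<bar>\<theta>' s\<bar>) / (1 - L)"
        using elim by (intro derivative_bound[OF mm L dis MB s _ _ _ dom]) auto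
      also have "\<dots> = C * (1 + norm (g s) + MB * (1 + 2 * norm (u s)) + \<bar>\<theta>' s\<bar>)" by (simp add: C_def)
      also have "\<dots> \<le> C * (1 + MG * (1 + \<phi> s) + MB * (2 * (1 + \<phi> s)) + \<bar>\<theta>' s\<bar>)"
        using C MB(1) g by (intro mult_left_mono add_mono) (auto simp: \<phi>_def)
      also have "\<dots> = c2 * (1 + \<phi> s) + a2 s" by (simp add: c2_def a2_def algebra_simps)
      finally show ?case .
    qed
    have "\<phi> s \<le> a + c * integral {0..s} \<phi>" if s: "s \<in> {0..b}" for s
    proof -
      let ?N = "lebesgue_on {0..s}"
      have sub: "{0..s} \<subseteq> {0..b}" using s by simp
      have int: "integrable ?N a1" "integrable ?N a2" "integrable ?N as" "integrable ?N \<phi>"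
        by (rule integrable_lebesgue_on_subset[OF _ sub]; simp add: a_int \<phi>_int)+
      have one: "norm (T \<zeta> s (x0 \<zeta>)) \<le> MT * norm (x0 \<zeta>)"
        using norm_blinfun[of "T \<zeta> s" "x0 \<zeta>"] mult_right_mono[OF MT(2)[OF s], of "norm (x0 \<zeta>)"] by simp
      have f_leN: "AE s in ?N. norm (f s + BB (w s)) \<le> MF * (1 + \<phi> s) + norm BB * norm (w s)"
        by (rule AE_lebesgue_on_subset[OF f_le sub]) simp_all
      have "norm (LINT r|?N. T \<zeta> (s - r) (f r + BB (w r))) \<le> (LINT r|?N. c1 * (1 + \<phi> r) + a1 r)"
      proof (rule norm_integral_le_AE)
        show "integrable ?N (\<lambda>r. c1 * (1 + \<phi> r) + a1 r)" using int by simp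
        show "AE r in ?N. norm (T \<zeta> (s - r) (f r + BB (w r))) \<le> c1 * (1 + \<phi> r) + a1 r"
          using f_leN AE_space
        proof eventually_elim
          case (elim r)
          have "norm (T \<zeta> (s - r) (f r + BB (w r))) \<le> norm (T \<zeta> (s - r)) * norm (f r + BB (w r))"
            by (rule norm_blinfun)
          also have "\<dots> \<le> MT * (MF * (1 + \<phi> r) + norm BB * norm (w r))"
            using elim s MT(1) by (intro mult_mono MT(2)) auto
          also have "\<dots> = c1 * (1 + \<phi> r) + a1 r" by (simp add: c1_def a1_def algebra_simps)
          finally show ?case .
        qed
      qed
      with one have xs: "norm (x s) \<le> MT * norm (x0 \<zeta>) + (LINT r|?N. c1 * (1 + \<phi> r) + a1 r)"
        unfolding mild[OF s]
        using norm_triangle_ineq[of "T \<zeta> s (x0 \<zeta>)" "LINT r|?N. T \<zeta> (s - r) (f r + BB (w r))"] by linarith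
      have "norm (integral\<^sup>L ?N u') \<le> (LINT r|?N. c2 * (1 + \<phi> r) + a2 r)"
      proof (rule norm_integral_le_AE)
        show "integrable ?N (\<lambda>r. c2 * (1 + \<phi> r) + a2 r)" using int by simp
      qed (rule AE_lebesgue_on_subset[OF u'_le sub]; simp)
      then have us: "norm (u s) \<le> norm (u0 \<eta>) + (LINT r|?N. c2 * (1 + \<phi> r) + a2 r)"
        using norm_triangle_ineq[of "u 0" "integral\<^sup>L ?N u'"] u_eq[OF s] u0 by simp
      have "(LINT r|?N. c1 * (1 + \<phi> r) + a1 r) + (LINT r|?N. c2 * (1 + \<phi> r) + a2 r) =
          (LINT r|?N. (c1 * (1 + \<phi> r) + a1 r) + (c2 * (1 + \<phi> r) + a2 r))"
        using int by (intro Bochner_Integration.integral_add[symmetric]) simp_all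
      also have "\<dots> = (LINT r|?N. as r + c * \<phi> r)"
        by (intro Bochner_Integration.integral_cong) (simp_all add: as_def c_def algebra_simps)
      also have "\<dots> = integral\<^sup>L ?N as + c * integral\<^sup>L ?N \<phi>" using int by simp
      also have "integral\<^sup>L ?N \<phi> = integral {0..s} \<phi>"
        using int(4) by (intro lebesgue_integral_eq_integral) auto
      finally have "\<phi> s \<le> MT * norm (x0 \<zeta>) + norm (u0 \<eta>) + (integral\<^sup>L ?N as + c * integral {0..s} \<phi>)"
        using xs us unfolding \<phi>_def by linarith
      moreover have "integral\<^sup>L ?N as \<le> integral\<^sup>L ?M as"
        using as_nonneg by (intro integral_lebesgue_on_mono_set[OF a_int(3) sub]) auto
      ultimately show ?thesis by (simp add: a_def)
    qed
    then have "\<phi> t \<le> a * exp (c * t)" using c t by (intro Gronwall[OF \<phi>_cont]) auto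
    also have "\<dots> \<le> a * exp (c * b)" using a_nonneg c t by (intro mult_left_mono) auto
    finally show ?thesis by (simp add: \<phi>_def)
  qed
  have "norm (x t) \<le> a * exp (c * b) + 1 \<and> norm (u t) \<le> a * exp (c * b) + 1"
    if "(x, u) \<in> mild_solutions b T B F G BB x0 u0 \<zeta> \<eta> w" "t \<in> {0..b}" for x u t
    using bound[OF that] norm_ge_zero[of "x t"] norm_ge_zero[of "u t"] by linarith
  moreover have "0 < a * exp (c * b) + 1" using a_nonneg by (simp add: add_nonneg_pos)
  ultimately show ?thesis by (intro exI[of _ "a * exp (c * b) + 1"]) auto
qed

section \<open>Existence of a minimizer\<close>

text \<open>Without solutions the infimum is \<infinity>; otherwise a common lower bound of the
  costs is needed. The bound on the states settles the running cost, compactness of the possible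
  terminal states the terminal cost.\<close>

lemma min_cost_ne_MInfty:
  fixes T :: "'l::metric_space \<Rightarrow> real \<Rightarrow> 'e::{real_inner,banach,second_countable_topology} \<Rightarrow>\<^sub>L 'e"
    and B :: "real \<Rightarrow> 'h::{real_inner,banach,second_countable_topology} \<Rightarrow> 'k::metric_space \<Rightarrow> 'h \<Rightarrow> 'h set"
    and BB :: "'y::{real_inner,banach,second_countable_topology} \<Rightarrow>\<^sub>L 'e"
  assumes "0 < b" and mm: "\<forall>t\<in>{0..b}. \<forall>u \<eta>. maximal_monotone (B t u \<eta>)"
    and A: "hyp_A b DA A T" and B: "hyp_B b B" and F: "hyp_F b F" and G: "hyp_G b G" and w: "w \<in> L2 b"
    and ell: "hyp_ell b ell" and \<phi>: "hyp_phi \<phi>"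
  shows "min_cost b T B F G BB x0 u0 ell \<phi> \<zeta> \<eta> w \<noteq> - \<infinity>"
proof -
  let ?M = "lebesgue_on {0..b}"
  let ?S = "mild_solutions b T B F G BB x0 u0 \<zeta> \<eta> w"
  obtain R where R0: "0 < R" "\<forall>(x, u)\<in>?S. \<forall>t\<in>{0..b}. norm (x t) \<le> R \<and> norm (u t) \<le> R"
    using mild_solution_bound[OF assms(1-7), of BB x0 u0 \<zeta> \<eta>] by (elim exE conjE)
  have R: "norm (x t) \<le> R \<and> norm (u t) \<le> R" if "(x, u) \<in> ?S" "t \<in> {0..b}" for x u t
    using bspec[OF R0(2) that(1)] that(2) by simp
  have bdd: "bounded {\<zeta>}" "bounded {(\<zeta>, \<eta>)}" by simp_all
  obtain \<kappa> where \<kappa>: "\<forall>R>0. \<exists>\<beta>\<in>L1_nonneg b. AE t in ?M. \<forall>r\<in>{0..R}. \<kappa> t r \<le> \<beta> t"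
    "AE t in ?M. \<forall>x y u \<zeta> \<eta>.
       \<bar>ell t x u \<zeta> \<eta> - ell t y u \<zeta> \<eta>\<bar> \<le> (1 + max (norm x) (norm y)) * \<kappa> t (norm (x - y))"
    using ell[unfolded hyp_ell_def, THEN conjunct2, THEN conjunct1] by (elim exE conjE) (rule that; assumption)
  obtain \<beta> where \<beta>: "\<beta> \<in> L1_nonneg b" "AE t in ?M. \<forall>r\<in>{0..R}. \<kappa> t r \<le> \<beta> t"
    using \<kappa>(1) R0(1) by blast
  obtain \<theta> where \<theta>: "\<theta> \<in> L1_nonneg b"
    "AE t in ?M. \<forall>u. \<forall>(\<zeta>, \<eta>)\<in>{(\<zeta>, \<eta>)}. \<bar>ell t 0 u \<zeta> \<eta>\<bar> \<le> \<theta> t * (1 + norm u)"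
    using ell[unfolded hyp_ell_def, THEN conjunct2, THEN conjunct2, THEN conjunct2, THEN conjunct1,
        THEN spec, THEN mp, OF bdd(2)] by (elim bexE) (rule that; assumption)
  \<comment> \<open>Comparison with the running cost at \<open>x = 0\<close>: the first summand pays
    for the change of \<open>x\<close> through the modulus \<kappa> on \<open>{0..R}\<close>, the
    second for the growth in \<open>u\<close>.\<close>
  define l where "l t = (1 + R) * \<beta> t + \<theta> t * (1 + R)" for t
  have l_int: "integrable ?M l" using \<beta>(1) \<theta>(1) unfolding l_def by (simp add: L1_nonneg_def)
  have running: "- integral\<^sup>L ?M l \<le> (LINT t|?M. ell t (x t) (u t) \<zeta> \<eta>)" if sol: "(x, u) \<in> ?S" for x u
  proof -
    have "AE t in ?M. norm (ell t (x t) (u t) \<zeta> \<eta>) \<le> l t"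
      using \<kappa>(2) \<beta>(2) \<theta>(2) AE_space
    proof eventually_elim
      case (elim t)
      then have t: "t \<in> {0..b}" by simp
      have xu: "norm (x t) \<le> R" "norm (u t) \<le> R" using R[OF sol t] by auto
      have nn: "0 \<le> \<beta> t" "0 \<le> \<theta> t" using \<beta>(1) \<theta>(1) t by (auto simp: L1_nonneg_def)
      have \<kappa>_le: "\<kappa> t (norm (x t)) \<le> \<beta> t" using elim(2) xu by simp
      have "\<bar>ell t (x t) (u t) \<zeta> \<eta> - ell t 0 (u t) \<zeta> \<eta>\<bar> \<le> (1 + max (norm (x t)) (norm (0::'e))) * \<kappa> t (norm (x t - 0))"
        using elim(1) by blast
      also have "\<dots> = (1 + norm (x t)) * \<kappa> t (norm (x t))" by simp
      also have "\<dots> \<le> (1 + norm (x t)) * \<beta> t" using \<kappa>_le by (intro mult_left_mono) auto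
      also have "\<dots> \<le> (1 + R) * \<beta> t" using xu nn by (intro mult_right_mono) auto
      finally have 1: "\<bar>ell t (x t) (u t) \<zeta> \<eta> - ell t 0 (u t) \<zeta> \<eta>\<bar> \<le> (1 + R) * \<beta> t" .
      have "\<bar>ell t 0 (u t) \<zeta> \<eta>\<bar> \<le> \<theta> t * (1 + norm (u t))" using elim(3) by simp
      also have "\<dots> \<le> \<theta> t * (1 + R)" using xu nn by (intro mult_left_mono) auto
      finally show ?case using 1 by (simp add: l_def)
    qed
    from norm_integral_le_AE[OF l_int this] show ?thesis by (simp add: abs_le_iff)
  qed
  have T: "C0_semigroup (T \<zeta>)" "\<And>t. 0 < t \<Longrightarrow> compact_operator (T \<zeta> t)"
    using A by (simp_all add: hyp_A_def generates_def)
  obtain MT where MT: "0 < MT" "\<And>t. t \<in> {0..b} \<Longrightarrow> norm (T \<zeta> t) \<le> MT"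
    using A bdd(1) unfolding hyp_A_def by (metis insertI1)
  obtain MF where MF: "0 < MF" "AE t in ?M. \<forall>x u. \<forall>\<zeta>\<in>{\<zeta>}. set_norm (F t x u \<zeta>) \<le> ereal (MF * (1 + norm x + norm u))"
    using F bdd(1) unfolding hyp_F_def by meson
  \<comment> \<open>With the state bound \<open>R\<close>, one function dominates the
    inhomogeneities of all solutions.\<close>
  define \<psi> where "\<psi> s = MF * (1 + R + R) + norm BB * norm (w s)" for s
  have \<psi>_int: "integrable ?M \<psi>" using L2_imp_integrable[OF w] unfolding \<psi>_def by simp
  have \<psi>_nonneg: "0 \<le> \<psi> s" for s using MF(1) R0(1) by (simp add: \<psi>_def)
  define K1 where "K1 = closure {(LINT s|?M. T \<zeta> (b - s) (h s)) | h.
    integrable ?M h \<and> (AE s in ?M. norm (h s) \<le> \<psi> s)}"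
  have K1: "compact K1" unfolding K1_def
    by (rule semigroup_convolution_compact[OF \<open>0 < b\<close> T MT \<psi>_int \<psi>_nonneg])
  define U where "U = (\<Union>t\<in>{0..b}. \<Union>(u, \<eta>)\<in>cball 0 R \<times> {\<eta>}. op_dom (B t u \<eta>))"
  have "bounded (cball (0::'h) R \<times> {\<eta>})" by (intro bounded_Times) auto
  then have "ball_relatively_compact U" using B unfolding hyp_B_def U_def by blast
  define K2 where "K2 = closure (U \<inter> cball 0 R)"
  have K2: "compact K2" using \<open>ball_relatively_compact U\<close> by (simp add: K2_def ball_relatively_compact_def)
  have terminal: "\<exists>i\<in>K1. x b = T \<zeta> b (x0 \<zeta>) + i \<and> u b \<in> K2" if sol: "(x, u) \<in> ?S" for x u
  proof -
    obtain u' f g where u: "has_W12_derivative b u u'"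
      and f: "integrable ?M f"
      and incl: "AE t in ?M. f t \<in> F t (x t) (u t) \<zeta> \<and> g t \<in> G t (x t) (u t) \<eta> \<and>
              - u' t + g t \<in> B t (u t) \<eta> (u t)"
      and mild: "\<And>t. t \<in> {0..b} \<Longrightarrow> x t = T \<zeta> t (x0 \<zeta>) +
              (LINT s|lebesgue_on {0..t}. T \<zeta> (t - s) (f s + BB (w s)))"
      using sol unfolding mild_solutions_def by blast
    have u'_int: "integrable ?M u'" using u by (intro L2_imp_integrable) (simp add: has_W12_derivative_def)
    have u_cont: "continuous_on {0..b} u" by (rule has_W12_derivative_continuous_on[OF u u'_int])
    have h_int: "integrable ?M (\<lambda>s. f s + BB (w s))"
      using f L2_imp_integrable[OF w]
      by (intro Bochner_Integration.integrable_add integrable_bounded_linear[OF blinfun.bounded_linear_right])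
    have h_le: "AE s in ?M. norm (f s + BB (w s)) \<le> \<psi> s"
      using incl MF(2) AE_space
    proof eventually_elim
      case (elim s)
      then have "norm (f s) \<le> MF * (1 + norm (x s) + norm (u s))" by (intro set_normD) auto
      also have "\<dots> \<le> MF * (1 + R + R)"
        using MF(1) R[OF sol, of s] elim by (intro mult_left_mono add_mono) auto
      finally have "norm (f s) \<le> MF * (1 + R + R)" .
      moreover have "norm (BB (w s)) \<le> norm BB * norm (w s)" by (rule norm_blinfun)
      ultimately show ?case using norm_triangle_ineq[of "f s" "BB (w s)"] by (simp add: \<psi>_def)
    qed
    have "(LINT s|?M. T \<zeta> (b - s) (f s + BB (w s))) \<in> K1"
      unfolding K1_def using h_int h_le
      by (intro closure_subset[THEN subsetD] CollectI exI[of _ "\<lambda>s. f s + BB (w s)"] conjI refl)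
    moreover have "x b = T \<zeta> b (x0 \<zeta>) + (LINT s|?M. T \<zeta> (b - s) (f s + BB (w s)))"
      using \<open>0 < b\<close> by (intro mild) simp
    moreover have "u b \<in> K2"
    proof -
      \<comment> \<open>\<open>u\<close> lies in the domain only almost everywhere, perhaps not at
        \<open>b\<close>; good times approaching \<open>b\<close> from the left place
        \<open>u b\<close> in the closure.\<close>
      have "AE s in ?M. u s \<in> U \<inter> cball 0 R"
        using incl AE_space
      proof eventually_elim
        case (elim s)
        then have s: "s \<in> {0..b}" by simp
        have "u s \<in> cball 0 R" using R[OF sol s] by simp
        moreover have "u s \<in> op_dom (B s (u s) \<eta>)" using elim by (auto simp: op_dom_def)
        ultimately show ?case using s unfolding U_def by blast
      qed
      note in_U = this
      have "\<exists>s. max 0 (b - inverse (real (Suc n))) < s \<and> s < b \<and> u s \<in> U \<inter> cball 0 R" for n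
        by (rule AE_lebesgue_on_ex[OF in_U, of "max 0 (b - inverse (real (Suc n)))" b]) (use \<open>0 < b\<close> in auto)
      then obtain s where s: "\<And>n. max 0 (b - inverse (real (Suc n))) < s n" "\<And>n. s n < b"
        "\<And>n. u (s n) \<in> U \<inter> cball 0 R"
        by metis
      have "s \<longlonglongrightarrow> b"
      proof (rule tendsto_sandwich)
        show "eventually (\<lambda>n. b - inverse (real (Suc n)) \<le> s n) sequentially"
          using s(1) by (intro always_eventually allI) (simp add: less_imp_le)
        show "eventually (\<lambda>n. s n \<le> b) sequentially"
          using s(2) by (intro always_eventually allI) (simp add: less_imp_le)
        show "(\<lambda>n. b - inverse (real (Suc n))) \<longlonglongrightarrow> b"
          using tendsto_diff[OF tendsto_const LIMSEQ_inverse_real_of_nat, of b] by simp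
      qed simp
      moreover have s_mem: "s n \<in> {0..b}" for n using s(1,2)[of n] by simp
      ultimately have "(\<lambda>n. u (s n)) \<longlonglongrightarrow> u b"
        using \<open>0 < b\<close> by (intro continuous_on_tendsto_compose[OF u_cont]) (auto intro!: always_eventually)
      moreover have "u (s n) \<in> K2" for n unfolding K2_def using s(3) closure_subset by blast
      ultimately show ?thesis using closed_sequentially[of K2 "\<lambda>n. u (s n)"] by (simp add: K2_def)
    qed
    ultimately show ?thesis by blast
  qed
  have "continuous_on (K1 \<times> K2) (\<lambda>z. (\<lambda>(x, u, \<zeta>, \<eta>). \<phi> x u \<zeta> \<eta>) (T \<zeta> b (x0 \<zeta>) + fst z, snd z, \<zeta>, \<eta>))"
    using \<phi> unfolding hyp_phi_def
    by (rule continuous_on_compose2) (auto intro!: continuous_intros)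
  then have "compact ((\<lambda>z. \<phi> (T \<zeta> b (x0 \<zeta>) + fst z) (snd z) \<zeta> \<eta>) ` (K1 \<times> K2))"
    using compact_Times[OF K1 K2] by (intro compact_continuous_image) simp_all
  then have "bounded ((\<lambda>z. \<phi> (T \<zeta> b (x0 \<zeta>) + fst z) (snd z) \<zeta> \<eta>) ` (K1 \<times> K2))"
    by (rule compact_imp_bounded)
  then obtain C where C0: "\<forall>y\<in>(\<lambda>z. \<phi> (T \<zeta> b (x0 \<zeta>) + fst z) (snd z) \<zeta> \<eta>) ` (K1 \<times> K2). norm y \<le> C"
    unfolding bounded_iff by (elim exE)
  have C: "\<bar>\<phi> (T \<zeta> b (x0 \<zeta>) + i) v \<zeta> \<eta>\<bar> \<le> C" if "i \<in> K1" "v \<in> K2" for i v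
    using bspec[OF C0, OF imageI, of "(i, v)"] that by simp
  have "- integral\<^sup>L ?M l - C \<le> cost b ell \<phi> \<zeta> \<eta> x u" if sol: "(x, u) \<in> ?S" for x u
  proof -
    obtain i where i: "i \<in> K1" "x b = T \<zeta> b (x0 \<zeta>) + i" "u b \<in> K2" using terminal[OF sol] by blast
    then show ?thesis using C[OF i(1,3)] running[OF sol] by (simp add: cost_def)
  qed
  then have "ereal (- integral\<^sup>L ?M l - C) \<le> min_cost b T B F G BB x0 u0 ell \<phi> \<zeta> \<eta> w"
    unfolding min_cost_def by (intro INF_greatest) (auto simp only: ereal_less_eq split: prod.splits)
  then show ?thesis by auto
qed

section \<open>The direct method for the Hurwicz cost\<close>

lemma ereal_mult_ne_MInfty:
  fixes x :: ereal
  assumes "0 \<le> c" "x \<noteq> - \<infinity>"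
  shows "ereal c * x \<noteq> - \<infinity>"
  using assms by (cases x) (auto simp: less_le)

text \<open>Infimum and supremum use lower semicontinuity differently: the infimum needs it jointly,
  along minimizing parameters that move with the control, the supremum only for each fixed
  parameter.\<close>

lemma Hurwicz_cost_minimizer:
  fixes m :: "'l::metric_space \<Rightarrow> 'k::metric_space \<Rightarrow> (real \<Rightarrow> 'y::{real_inner,banach,second_countable_topology}) \<Rightarrow> ereal"
  assumes W: "hyp_W b W" and P: "P \<noteq> {}" "compact P"
    and lsc: "\<And>w w' \<zeta> \<zeta>' \<eta> \<eta>'. (\<And>n. w n \<in> W_ad b W) \<Longrightarrow> (\<And>n. (\<zeta> n, \<eta> n) \<in> P) \<Longrightarrow> w' \<in> W_ad b W \<Longrightarrow>
      (\<zeta>', \<eta>') \<in> P \<Longrightarrow> L2_weakly_converges b w w' \<Longrightarrow> (\<lambda>n. (\<zeta> n, \<eta> n)) \<longlonglongrightarrow> (\<zeta>', \<eta>') \<Longrightarrow>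
      m \<zeta>' \<eta>' w' \<le> liminf (\<lambda>n. m (\<zeta> n) (\<eta> n) (w n))"
    and proper: "\<And>w \<zeta> \<eta>. w \<in> W_ad b W \<Longrightarrow> (\<zeta>, \<eta>) \<in> P \<Longrightarrow> m \<zeta> \<eta> w \<noteq> - \<infinity>"
    and \<alpha>: "0 \<le> \<alpha>" "\<alpha> \<le> 1"
  shows "\<exists>w\<in>W_ad b W. Hurwicz_cost b m P \<alpha> w = (INF w'\<in>W_ad b W. Hurwicz_cost b m P \<alpha> w')"
proof -
  define mp where "mp q w = m (fst q) (snd q) w" for q w
  have lsc': "mp q' w' \<le> liminf (\<lambda>n. mp (q n) (w n))"
    if "\<And>n. w n \<in> W_ad b W" "\<And>n. q n \<in> P" "w' \<in> W_ad b W" "q' \<in> P" "L2_weakly_converges b w w'" "q \<longlonglongrightarrow> q'"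
    for w w' q q'
    using lsc[of w "\<lambda>n. fst (q n)" "\<lambda>n. snd (q n)" w' "fst q'" "snd q'"] that by (simp add: mp_def)
  define lo where "lo w = (INF q\<in>P. mp q w)" for w
  define hi where "hi w = (SUP q\<in>P. mp q w)" for w
  define H where "H w = ereal \<alpha> * lo w + ereal (1 - \<alpha>) * hi w + ereal ((L2_norm b w)\<^sup>2 / 2)" for w
  have H: "Hurwicz_cost b m P \<alpha> = H"
    by (rule ext) (simp add: Hurwicz_cost_def H_def lo_def hi_def mp_def control_cost_def L2_norm_square case_prod_beta)
  have attained: "\<exists>q\<in>P. mp q w = lo w" if w: "w \<in> W_ad b W" for w
  proof -
    obtain v where v: "\<And>n. v n \<in> (\<lambda>q. mp q w) ` P" "v \<longlonglongrightarrow> lo w"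
      using Inf_as_limit[of "(\<lambda>q. mp q w) ` P"] P(1) unfolding lo_def by auto
    then have "\<forall>n. \<exists>q. q \<in> P \<and> v n = mp q w" by blast
    then obtain q where "\<forall>n. q n \<in> P \<and> v n = mp (q n) w" by (rule choice[THEN exE])
    then have q: "\<And>n. q n \<in> P" "v = (\<lambda>n. mp (q n) w)" by auto
    obtain q' r where r: "q' \<in> P" "strict_mono r" "(q \<circ> r) \<longlonglongrightarrow> q'"
      using seq_compactE[OF compact_imp_seq_compact[OF P(2)]] q(1) by metis
    \<comment> \<open>A constant sequence of controls reduces the assumption to lower semicontinuity
      in the parameters.\<close>
    have "L2_weakly_converges b (\<lambda>n. w) w" by (simp add: L2_weakly_converges_def)
    then have "mp q' w \<le> liminf (\<lambda>n. mp ((q \<circ> r) n) w)"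
      using w q(1) r by (intro lsc'[of "\<lambda>n. w" "q \<circ> r" w q']) simp_all
    moreover have "(\<lambda>n. mp ((q \<circ> r) n) w) \<longlonglongrightarrow> lo w"
      using LIMSEQ_subseq_LIMSEQ[OF v(2) r(2)] by (simp add: q(2) o_def)
    then have "liminf (\<lambda>n. mp ((q \<circ> r) n) w) = lo w" by (intro lim_imp_Liminf) simp_all
    moreover have "lo w \<le> mp q' w" unfolding lo_def using r(1) by (rule INF_lower)
    ultimately show ?thesis using r(1) by (intro bexI[of _ q']) auto
  qed
  \<comment> \<open>Values above -\<infinity> can still have infimum -\<infinity>; attainment
    excludes this.\<close>
  have lo_ne: "lo w \<noteq> - \<infinity>" if w: "w \<in> W_ad b W" for w
  proof -
    obtain q where q: "q \<in> P" "mp q w = lo w" using attained[OF w] by blast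
    then show ?thesis using proper[OF w, of "fst q" "snd q"] by (simp add: mp_def)
  qed
  have lo_hi: "lo w \<le> hi w" for w
    unfolding lo_def hi_def using P(1) by (rule INF_le_SUP)
  obtain v where v: "\<And>n. v n \<in> H ` W_ad b W" "v \<longlonglongrightarrow> (INF w\<in>W_ad b W. H w)"
    using Inf_as_limit[of "H ` W_ad b W"] W_ad_nonempty[OF W] by auto
  then have "\<forall>n. \<exists>w. w \<in> W_ad b W \<and> v n = H w" by blast
  then obtain w where "\<forall>n. w n \<in> W_ad b W \<and> v n = H (w n)" by (rule choice[THEN exE])
  then have w: "\<And>n. w n \<in> W_ad b W" "v = (\<lambda>n. H (w n))" by auto
  obtain w' r where w': "w' \<in> W_ad b W" "strict_mono r" "L2_weakly_converges b (\<lambda>n. w (r n)) w'"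
    by (rule W_ad_weakly_compact[OF W w(1)])
  obtain q where q: "\<And>w. w \<in> W_ad b W \<Longrightarrow> q w \<in> P \<and> mp (q w) w = lo w"
    using attained by metis
  obtain K where K: "\<And>w. w \<in> W_ad b W \<Longrightarrow> L2_norm b w \<le> K"
    using W_ad_L2_bounded[OF W] by blast
  \<comment> \<open>All four quantities live in compact spaces, the extended reals included, so a
    single extraction makes them converge simultaneously without finiteness of the costs.\<close>
  define Z where "Z n = (q (w (r n)), lo (w (r n)), hi (w (r n)), L2_norm b (w (r n)))" for n
  have "compact (P \<times> (UNIV :: ereal set) \<times> (UNIV :: ereal set) \<times> {0..K})"
    using P(2) by (intro compact_Times compact_UNIV compact_Icc)
  moreover have "\<forall>n. Z n \<in> P \<times> UNIV \<times> UNIV \<times> {0..K}"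
    using q[OF w(1)] K[OF w(1)] by (auto simp: Z_def L2_norm_def integral_nonneg_AE)
  ultimately obtain z s where z: "z \<in> P \<times> UNIV \<times> UNIV \<times> {0..K}" "strict_mono s" "(Z \<circ> s) \<longlonglongrightarrow> z"
    using seq_compactE[OF compact_imp_seq_compact] by metis
  obtain q' a' h' N' where z_eq: "z = (q', a', h', N')" by (cases z) auto
  have q': "q' \<in> P" using z(1) z_eq by simp
  define x where "x n = w (r (s n))" for n
  have x: "x n \<in> W_ad b W" for n unfolding x_def by (rule w(1))
  have Zs: "(\<lambda>n. (q (x n), lo (x n), hi (x n), L2_norm b (x n))) \<longlonglongrightarrow> (q', a', h', N')"
    using z(3) z_eq by (simp add: Z_def x_def o_def)
  have lims: "(\<lambda>n. q (x n)) \<longlonglongrightarrow> q'" "(\<lambda>n. lo (x n)) \<longlonglongrightarrow> a'" "(\<lambda>n. hi (x n)) \<longlonglongrightarrow> h'"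
    "(\<lambda>n. L2_norm b (x n)) \<longlonglongrightarrow> N'"
    using tendsto_fst[OF Zs] tendsto_fst[OF tendsto_snd[OF Zs]] tendsto_fst[OF tendsto_snd[OF tendsto_snd[OF Zs]]]
      tendsto_snd[OF tendsto_snd[OF tendsto_snd[OF Zs]]] by simp_all
  have weak: "L2_weakly_converges b x w'"
    unfolding L2_weakly_converges_def
  proof
    fix \<Phi> :: "(real \<Rightarrow> 'y) \<Rightarrow> real" assume "\<Phi> \<in> L2_dual b"
    then have "(\<lambda>n. \<Phi> (w (r n))) \<longlonglongrightarrow> \<Phi> w'" using w'(3) by (simp add: L2_weakly_converges_def)
    from LIMSEQ_subseq_LIMSEQ[OF this z(2)] show "(\<lambda>n. \<Phi> (x n)) \<longlonglongrightarrow> \<Phi> w'" by (simp add: x_def o_def)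
  qed
  \<comment> \<open>The parameters minimizing for \<open>x n\<close> converge to \<open>q'\<close>,
    so joint lower semicontinuity compares their values with that at \<open>q'\<close>.\<close>
  have lo_le: "lo w' \<le> a'"
  proof -
    have "lo w' \<le> mp q' w'" unfolding lo_def using q' by (rule INF_lower)
    also have "\<dots> \<le> liminf (\<lambda>n. mp (q (x n)) (x n))"
      using q[OF x] x w'(1) q' weak lims(1) by (intro lsc') auto
    also have "(\<lambda>n. mp (q (x n)) (x n)) = (\<lambda>n. lo (x n))" using q[OF x] by simp
    also have "liminf (\<lambda>n. lo (x n)) = a'" using lims(2) by (intro lim_imp_Liminf) simp_all
    finally show ?thesis .
  qed
  have hi_le: "hi w' \<le> h'"
    unfolding hi_def
  proof (rule SUP_least)
    fix p assume p: "p \<in> P"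
    have "mp p w' \<le> liminf (\<lambda>n. mp p (x n))"
      using p x w'(1) weak by (intro lsc') auto
    also have "\<dots> \<le> liminf (\<lambda>n. hi (x n))"
      unfolding hi_def using p by (intro Liminf_mono always_eventually allI SUP_upper)
    also have "\<dots> = h'" using lims(3) by (intro lim_imp_Liminf) simp_all
    finally show "mp p w' \<le> h'" .
  qed
  have norm_le: "L2_norm b w' \<le> N'"
    using x w'(1) by (intro L2_norm_weak_lsc[OF weak _ _ lims(4)]) (auto simp: W_ad_def)
  \<comment> \<open>The limits dominate \<open>lo w'\<close> and \<open>hi w'\<close>, hence stay
    above -\<infinity>; addition is therefore continuous at them even if one or both are
    \<infinity>.\<close>
  have ne: "a' \<noteq> - \<infinity>" "h' \<noteq> - \<infinity>"
    using lo_ne[OF w'(1)] lo_le hi_le lo_hi[of w'] by auto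
  have "(\<lambda>n. H (x n)) \<longlonglongrightarrow> ereal \<alpha> * a' + ereal (1 - \<alpha>) * h' + ereal (N'\<^sup>2 / 2)"
    unfolding H_def
  proof (intro tendsto_add_ereal_general tendsto_cmult_ereal lims)
    show "(\<lambda>n. ereal ((L2_norm b (x n))\<^sup>2 / 2)) \<longlonglongrightarrow> ereal (N'\<^sup>2 / 2)"
      by (intro tendsto_intros lims(4)) simp
  qed (use ne \<alpha> ereal_mult_ne_MInfty[of \<alpha> a'] ereal_mult_ne_MInfty[of "1 - \<alpha>" h'] in auto)
  moreover have "(\<lambda>n. H (x n)) \<longlonglongrightarrow> (INF w\<in>W_ad b W. H w)"
    using LIMSEQ_subseq_LIMSEQ[OF LIMSEQ_subseq_LIMSEQ[OF v(2) w'(2)] z(2)] by (simp add: w(2) x_def o_def)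
  ultimately have "(INF w\<in>W_ad b W. H w) = ereal \<alpha> * a' + ereal (1 - \<alpha>) * h' + ereal (N'\<^sup>2 / 2)"
    using LIMSEQ_unique by blast
  moreover have "H w' \<le> ereal \<alpha> * a' + ereal (1 - \<alpha>) * h' + ereal (N'\<^sup>2 / 2)"
  proof -
    have "(L2_norm b w')\<^sup>2 \<le> N'\<^sup>2"
      using norm_le by (intro power_mono) (auto simp: L2_norm_def integral_nonneg_AE)
    then show ?thesis
      unfolding H_def using \<alpha> lo_le hi_le by (intro add_mono ereal_mult_left_mono) auto
  qed
  moreover have "(INF w\<in>W_ad b W. H w) \<le> H w'" using w'(1) by (rule INF_lower)
  ultimately have "H w' = (INF w\<in>W_ad b W. H w)" by order
  then show ?thesis unfolding H using w'(1) by blast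
qed

theorem theorem5p4:
  fixes b :: real
    and DA :: "'l::metric_space \<Rightarrow> 'e::{real_inner,banach,second_countable_topology} set"
    and A :: "'l \<Rightarrow> 'e \<Rightarrow> 'e"
    and T :: "'l \<Rightarrow> real \<Rightarrow> 'e \<Rightarrow>\<^sub>L 'e"
    and B :: "real \<Rightarrow> 'h::{real_inner,banach,second_countable_topology} \<Rightarrow> 'k::metric_space \<Rightarrow> 'h \<Rightarrow> 'h set"
    and F :: "real \<Rightarrow> 'e \<Rightarrow> 'h \<Rightarrow> 'l \<Rightarrow> 'e set"
    and G :: "real \<Rightarrow> 'e \<Rightarrow> 'h \<Rightarrow> 'k \<Rightarrow> 'h set"
    and W :: "real \<Rightarrow> 'y::{real_inner,banach,second_countable_topology} set"
    and BB :: "'y \<Rightarrow>\<^sub>L 'e"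
    and x0 :: "'l \<Rightarrow> 'e"
    and u0 :: "'k \<Rightarrow> 'h"
    and ell :: "real \<Rightarrow> 'e \<Rightarrow> 'h \<Rightarrow> 'l \<Rightarrow> 'k \<Rightarrow> real"
    and \<phi> :: "'e \<Rightarrow> 'h \<Rightarrow> 'l \<Rightarrow> 'k \<Rightarrow> real"
    and P :: "('l \<times> 'k) set"
    and m :: "'l \<Rightarrow> 'k \<Rightarrow> (real \<Rightarrow> 'y) \<Rightarrow> ereal"
  assumes "0 < b"
    and "\<forall>\<zeta>. linear_operator (DA \<zeta>) (A \<zeta>)"
    and "\<forall>t\<in>{0..b}. \<forall>u \<eta>. maximal_monotone (B t u \<eta>)"
    and "\<forall>\<eta>. u0 \<eta> \<in> op_dom (B 0 (u0 \<eta>) \<eta>)"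
    and "hyp_A b DA A T"
    and "hyp_B b B"
    and "hyp_F b F"
    and "hyp_G b G"
    and "hyp_0 x0 u0"
    and "hyp_W b W"
    and "hyp_ell b ell"
    and "hyp_phi \<phi>"
    and "P \<noteq> {}" and "compact P"
    and m_def: "m = min_cost b T B F G BB x0 u0 ell \<phi>"
    and lsc: "\<forall>w w' \<zeta> \<zeta>' \<eta> \<eta>'.
      (\<forall>n. w n \<in> W_ad b W \<and> (\<zeta> n, \<eta> n) \<in> P) \<and> w' \<in> W_ad b W \<and> (\<zeta>', \<eta>') \<in> P \<and>
      L2_weakly_converges b w w' \<and> (\<lambda>n. (\<zeta> n, \<eta> n)) \<longlonglongrightarrow> (\<zeta>', \<eta>') \<longrightarrow>
      m \<zeta>' \<eta>' w' \<le> liminf (\<lambda>n. m (\<zeta> n) (\<eta> n) (w n))"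
  shows "\<forall>\<alpha>\<in>{0..1}. \<exists>w\<in>W_ad b W.
    Hurwicz_cost b m P \<alpha> w = (INF w'\<in>W_ad b W. Hurwicz_cost b m P \<alpha> w')"
proof
  fix \<alpha> :: real assume \<alpha>: "\<alpha> \<in> {0..1}"
  show "\<exists>w\<in>W_ad b W. Hurwicz_cost b m P \<alpha> w = (INF w'\<in>W_ad b W. Hurwicz_cost b m P \<alpha> w')"
  proof (rule Hurwicz_cost_minimizer[OF \<open>hyp_W b W\<close> \<open>P \<noteq> {}\<close> \<open>compact P\<close>])
    show "m \<zeta> \<eta> w \<noteq> - \<infinity>" if "w \<in> W_ad b W" for w \<zeta> \<eta>
      unfolding m_def
      by (rule min_cost_ne_MInfty[OF assms(1,3,5-8) _ assms(11,12)]) (use that in \<open>simp add: W_ad_def\<close>)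
    show "m \<zeta>' \<eta>' w' \<le> liminf (\<lambda>n. m (\<zeta> n) (\<eta> n) (w n))"
      if "\<And>n. w n \<in> W_ad b W" "\<And>n. (\<zeta> n, \<eta> n) \<in> P" "w' \<in> W_ad b W" "(\<zeta>', \<eta>') \<in> P"
        "L2_weakly_converges b w w'" "(\<lambda>n. (\<zeta> n, \<eta> n)) \<longlonglongrightarrow> (\<zeta>', \<eta>')"
      for w w' \<zeta> \<zeta>' \<eta> \<eta>'
      by (rule lsc[rule_format]) (use that in simp)
  qed (use \<alpha> in auto)
qed

end
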